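(* Let $X$ be a Banach space with a Schauder basis. Then either $X$ is ergodic, or there exist $K\ge 1$ and a sequence $(F_n)_{n\in\mathbb{N}}$ of successive finite-dimensional subspaces of $X$ such that all spaces with a finite dimensional decomposition on the basis passing through infinitely many of the $F_n$'s are mutually $K$-isomorphic.
   Context: $X$ is an infinite-dimensional Banach space with Schauder basis $\{e_i\}$. Finite-dimensional subspaces $F,G$ considered here are nonzero and consist of finitely supported vectors; they are successive, $F<G$, if for all nonzero $x\in F$, $y\in G$ one has $\max\mathrm{supp}(x)<\min\mathrm{supp}(y)$. A sequence $(F_n)$ is successive if $F_n<F_{n+1}$ for all $n$. A space with a finite dimensional decomposition on the basis is a space of the form $\bigoplus_{k\in\mathbb{N}}E_k$ (closed linear span in $X$) where $(E_k)_{k\in\mathbb{N}}$ is an infinite sequence of successive finite-dimensional subspaces of $X$; such a space (with its decomposition) passes through $E$ if $E_k=E$ for some $k$. Two spaces are $K$-isomorphic if there is an isomorphism $T$ between them with $\|T\|\,\|T^{-1}\|\le K$. $\mathcal{B}_X$ is the set of closed linear subspaces of $X$ with its Effros-Borel structure (the $\sigma$-algebra generated by the sets $\{F : F\cap U\neq\emptyset\}$, $U\subset X$ open). $E_0$ is the relation on $2^\omega$ of eventual agreement of binary sequences. $X$ is ergodic if there is a Borel map $f:2^\omega\to\mathcal{B}_X$ such that $\alpha E_0\beta$ if and only if $f(\alpha)$ and $f(\beta)$ are isomorphic. *)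

theory Defs
  imports "HOL-Analysis.Analysis"
begin

definition schauder_basis :: "(nat \<Rightarrow> 'a::banach) \<Rightarrow> bool" where
  "schauder_basis e \<longleftrightarrow> (\<forall>x. \<exists>!a :: nat \<Rightarrow> real. (\<lambda>n. a n *\<^sub>R e n) sums x)"

definition basis_coeff :: "(nat \<Rightarrow> 'a::banach) \<Rightarrow> 'a \<Rightarrow> nat \<Rightarrow> real" where
  "basis_coeff e x = (THE a. (\<lambda>n. a n *\<^sub>R e n) sums x)"

definition supp :: "(nat \<Rightarrow> 'a::banach) \<Rightarrow> 'a \<Rightarrow> nat set" where
  "supp e x = {n. basis_coeff e x n \<noteq> 0}"

definition fin_dim_block :: "(nat \<Rightarrow> 'a::banach) \<Rightarrow> 'a set \<Rightarrow> bool" where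
  "fin_dim_block e F \<longleftrightarrow>
     (\<exists>B. finite B \<and> F = span B) \<and> F \<noteq> {0} \<and> (\<forall>x\<in>F. finite (supp e x))"

text \<open>\<open>Max\<close> and \<open>Min\<close> are only meaningful on finite nonempty sets; this relation is only
  used between spaces satisfying \<open>fin_dim_block\<close>.\<close>

definition block_less :: "(nat \<Rightarrow> 'a::banach) \<Rightarrow> 'a set \<Rightarrow> 'a set \<Rightarrow> bool" where
  "block_less e F G \<longleftrightarrow> (\<forall>x\<in>F - {0}. \<forall>y\<in>G - {0}. Max (supp e x) < Min (supp e y))"

definition successive_blocks :: "(nat \<Rightarrow> 'a::banach) \<Rightarrow> (nat \<Rightarrow> 'a set) \<Rightarrow> bool" where
  "successive_blocks e F \<longleftrightarrow>
     (\<forall>n. fin_dim_block e (F n)) \<and> (\<forall>n. block_less e (F n) (F (Suc n)))"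

text \<open>The closed linear span of the pieces of a decomposition.\<close>

definition decomp_space :: "(nat \<Rightarrow> 'a::banach set) \<Rightarrow> 'a set" where
  "decomp_space E = closure (span (\<Union>k. E k))"

definition passes_through :: "(nat \<Rightarrow> 'a set) \<Rightarrow> 'a set \<Rightarrow> bool" where
  "passes_through E F \<longleftrightarrow> (\<exists>k. E k = F)"

text \<open>Operators between subspaces are represented by total functions of which only the values
  on the domain matter; an isomorphism need not extend to the ambient space.\<close>

definition bounded_linear_on ::
  "'a::real_normed_vector set \<Rightarrow> ('a \<Rightarrow> 'b::real_normed_vector) \<Rightarrow> bool" where
  "bounded_linear_on Y T \<longleftrightarrow>
     (\<forall>x\<in>Y. \<forall>y\<in>Y. T (x + y) = T x + T y) \<and>
     (\<forall>c. \<forall>x\<in>Y. T (c *\<^sub>R x) = c *\<^sub>R T x) \<and>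
     (\<exists>C. \<forall>x\<in>Y. norm (T x) \<le> C * norm x)"

definition onorm_on ::
  "'a::real_normed_vector set \<Rightarrow> ('a \<Rightarrow> 'b::real_normed_vector) \<Rightarrow> real" where
  "onorm_on Y T = (SUP x\<in>Y. norm (T x) / norm x)"

definition isomorphism_on ::
  "'a::real_normed_vector set \<Rightarrow> 'b::real_normed_vector set \<Rightarrow> ('a \<Rightarrow> 'b) \<Rightarrow> bool" where
  "isomorphism_on Y Z T \<longleftrightarrow>
     bij_betw T Y Z \<and> bounded_linear_on Y T \<and> bounded_linear_on Z (inv_into Y T)"

definition isomorphic_spaces ::
  "'a::real_normed_vector set \<Rightarrow> 'b::real_normed_vector set \<Rightarrow> bool" where
  "isomorphic_spaces Y Z \<longleftrightarrow> (\<exists>T. isomorphism_on Y Z T)"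

definition K_isomorphic ::
  "real \<Rightarrow> 'a::real_normed_vector set \<Rightarrow> 'b::real_normed_vector set \<Rightarrow> bool" where
  "K_isomorphic K Y Z \<longleftrightarrow>
     (\<exists>T. isomorphism_on Y Z T \<and> onorm_on Y T * onorm_on Z (inv_into Y T) \<le> K)"

definition closed_subspaces :: "'a::real_normed_vector set set" where
  "closed_subspaces = {Y. subspace Y \<and> closed Y}"

definition effros_borel :: "'a::real_normed_vector set measure" where
  "effros_borel = sigma closed_subspaces
     ((\<lambda>U. {Y \<in> closed_subspaces. Y \<inter> U \<noteq> {}}) ` {U. open U})"

definition E0 :: "(nat \<Rightarrow> bool) \<Rightarrow> (nat \<Rightarrow> bool) \<Rightarrow> bool" where
  "E0 \<alpha> \<beta> \<longleftrightarrow> (\<exists>m. \<forall>n\<ge>m. \<alpha> n = \<beta> n)"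

text \<open>Here \<open>borel\<close> on \<open>nat \<Rightarrow> bool\<close> refers to the product topology of discrete two-point spaces,
  i.e. to Cantor space.\<close>

definition ergodic :: "'a::banach itself \<Rightarrow> bool" where
  "ergodic _ \<longleftrightarrow>
     (\<exists>f :: (nat \<Rightarrow> bool) \<Rightarrow> 'a set. f \<in> borel \<rightarrow>\<^sub>M effros_borel \<and>
        (\<forall>\<alpha> \<beta>. E0 \<alpha> \<beta> \<longleftrightarrow> isomorphic_spaces (f \<alpha>) (f \<beta>)))"

end

theory Submission
  imports Defs
begin

text \<open>
  Up to a small perturbation every block subspace is spanned by vectors from a finite net, so
  decompositions form a space in which only finitely many initial segments end at a given
  coordinate. In the product of this space with itself consider the relation of isomorphism.

  If it is meager, one builds two blocks of equal dimension on each of successive intervals so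
  that choosing different blocks at stage \<open>n\<close> avoids the first \<open>n\<close> nowhere dense sets, for all of the
  finitely many earlier choices. Points of Cantor space that differ infinitely often then give
  non-isomorphic spaces, while a finite change only alters a finite-dimensional head of
  unchanged dimension.

  Otherwise \<open>K\<close>-isomorphism is non-meager for some \<open>K\<close>, and, being the projection of a closed set, it
  is comeager below some condition. A fusion argument produces one space and blocks \<open>F n\<close> such that
  every decomposition in the net which extends the condition and passes through infinitely many
  \<open>F n\<close> is \<open>K\<close>-isomorphic to that space. Perturbation and the exchange of finite-dimensional pieces of
  bounded dimension extend this, with a larger constant, to all decompositions through
  infinitely many \<open>F n\<close>.
\<close>

section \<open>Isomorphisms as graphs\<close>

text \<open>The uniform constant rests on one fact: adding one vector to each of two isomorphic
  closed spaces costs a factor that depends neither on the spaces nor on the vectors.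
  Finite-dimensional changes are therefore controlled by their dimension alone, and the final
  \<open>K\<close> depends only on the constant found by category and on the length
  \<open>m0\<close> of the condition below which it holds.

  Finiteness of \<open>R 0 m\<close> turns category into combinatorics: one block can enter a dense
  open set for all heads at once, so a comeager set contains every point that agrees infinitely
  often with a fixed sequence of blocks, as in Cantor space. Because the comeager set lives in a
  product, its left coordinate is built in the same recursion; this takes the place of a
  Kuratowski-Ulam argument and of any comeager isomorphism class.

  The obstacle in the non-meager case is that the isomorphism is not part of the point. It is
  recovered from codes for approximate images of countably many vectors, and this works because the
  two-sided estimates on a graph survive limits.\<close>

definition iso_graph :: "real \<Rightarrow> ('a::real_normed_vector \<times> 'a) set \<Rightarrow> bool" where
  "iso_graph K \<Gamma> \<longleftrightarrow> subspace \<Gamma> \<and>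
     (\<forall>x y. (x, y) \<in> \<Gamma> \<longrightarrow> norm y \<le> K * norm x \<and> norm x \<le> K * norm y)"

text \<open>With graphs and one bound for both directions, inversion is a swap, composition is
  relational, and closures and limits are taken on the graph itself. The spaces need not be closed,
  so algebraic spans can be handled first and completed at the end.\<close>

definition kiso :: "real \<Rightarrow> 'a::real_normed_vector set \<Rightarrow> 'a set \<Rightarrow> bool" where
  "kiso K Y Z \<longleftrightarrow> (\<exists>\<Gamma>. iso_graph K \<Gamma> \<and> fst ` \<Gamma> = Y \<and> snd ` \<Gamma> = Z)"

lemma iso_graphD:
  assumes "iso_graph K \<Gamma>"
  shows "subspace \<Gamma>" "(x, y) \<in> \<Gamma> \<Longrightarrow> norm y \<le> K * norm x" "(x, y) \<in> \<Gamma> \<Longrightarrow> norm x \<le> K * norm y"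
  using assms by (auto simp: iso_graph_def)

lemma iso_graph_mono:
  assumes "iso_graph K \<Gamma>" "K \<le> L"
  shows "iso_graph L \<Gamma>"
  using assms unfolding iso_graph_def
  by (meson mult_right_mono norm_ge_zero order_trans)

lemma kiso_mono: "kiso K Y Z \<Longrightarrow> K \<le> L \<Longrightarrow> kiso L Y Z"
  unfolding kiso_def using iso_graph_mono by blast

lemma subspace_swap: "subspace \<Gamma> \<Longrightarrow> subspace (prod.swap ` \<Gamma>)"
  by (rule linear_subspace_image) (auto intro!: linearI)

lemma kiso_sym: "kiso K Y Z \<Longrightarrow> kiso K Z Y"
  unfolding kiso_def iso_graph_def
proof (elim exE conjE)
  fix \<Gamma> assume "subspace \<Gamma>" "\<forall>x y. (x, y) \<in> \<Gamma> \<longrightarrow> norm y \<le> K * norm x \<and> norm x \<le> K * norm y"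
    "fst ` \<Gamma> = Y" "snd ` \<Gamma> = Z"
  then show "\<exists>\<Gamma>. (subspace \<Gamma> \<and> (\<forall>x y. (x, y) \<in> \<Gamma> \<longrightarrow> norm y \<le> K * norm x \<and> norm x \<le> K * norm y)) \<and>
      fst ` \<Gamma> = Z \<and> snd ` \<Gamma> = Y"
    by (intro exI[of _ "prod.swap ` \<Gamma>"]) (auto simp: subspace_swap image_image)
qed

lemma kiso_trans:
  assumes "kiso K X Y" "kiso L Y Z" "K \<ge> 0" "L \<ge> 0"
  shows "kiso (K * L) X Z"
proof -
  obtain \<Gamma> \<Delta> where \<Gamma>: "iso_graph K \<Gamma>" "fst ` \<Gamma> = X" "snd ` \<Gamma> = Y"
    and \<Delta>: "iso_graph L \<Delta>" "fst ` \<Delta> = Y" "snd ` \<Delta> = Z"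
    using assms unfolding kiso_def by blast
  note [simp] = iso_graphD(1)[OF \<Gamma>(1)] iso_graphD(1)[OF \<Delta>(1)]
  have "subspace (\<Gamma> O \<Delta>)"
  proof (rule subspaceI)
    show "0 \<in> \<Gamma> O \<Delta>"
      using subspace_0[of \<Gamma>] subspace_0[of \<Delta>] by (auto simp: zero_prod_def)
  next
    fix p q assume "p \<in> \<Gamma> O \<Delta>" "q \<in> \<Gamma> O \<Delta>"
    then obtain x y z x' y' z' where "p = (x, z)" "(x, y) \<in> \<Gamma>" "(y, z) \<in> \<Delta>"
      "q = (x', z')" "(x', y') \<in> \<Gamma>" "(y', z') \<in> \<Delta>" by auto
    then show "p + q \<in> \<Gamma> O \<Delta>"
      using subspace_add[of \<Gamma> "(x, y)" "(x', y')"] subspace_add[of \<Delta> "(y, z)" "(y', z')"] by auto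
  next
    fix c p assume "p \<in> \<Gamma> O \<Delta>"
    then obtain x y z where "p = (x, z)" "(x, y) \<in> \<Gamma>" "(y, z) \<in> \<Delta>" by auto
    then show "c *\<^sub>R p \<in> \<Gamma> O \<Delta>"
      using subspace_scale[of \<Gamma> "(x, y)" c] subspace_scale[of \<Delta> "(y, z)" c] by auto
  qed
  moreover have "norm z \<le> K * L * norm x \<and> norm x \<le> K * L * norm z" if xz: "(x, z) \<in> \<Gamma> O \<Delta>" for x z
  proof -
    obtain y where y: "(x, y) \<in> \<Gamma>" "(y, z) \<in> \<Delta>" using xz by blast
    have "norm z \<le> L * norm y" "norm y \<le> K * norm x" "norm x \<le> K * norm y" "norm y \<le> L * norm z"
      using y iso_graphD(2,3)[OF \<Gamma>(1)] iso_graphD(2,3)[OF \<Delta>(1)] by auto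
    then have "norm z \<le> L * (K * norm x)" "norm x \<le> K * (L * norm z)"
      using assms(3,4) by (meson mult_left_mono order_trans)+
    then show ?thesis by (simp add: mult_ac)
  qed
  ultimately have "iso_graph (K * L) (\<Gamma> O \<Delta>)"
    by (simp add: iso_graph_def)
  moreover have "fst ` (\<Gamma> O \<Delta>) = X" "snd ` (\<Gamma> O \<Delta>) = Z"
  proof -
    have "x \<in> fst ` (\<Gamma> O \<Delta>)" if x: "x \<in> X" for x
    proof -
      obtain y where y: "(x, y) \<in> \<Gamma>" using x \<Gamma>(2) by force
      then have "y \<in> fst ` \<Delta>" using \<Gamma>(3) \<Delta>(2) by force
      then obtain z where "(y, z) \<in> \<Delta>" by force
      with y show ?thesis by force
    qed
    moreover have "fst p \<in> X" if "p \<in> \<Gamma> O \<Delta>" for p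
      using that \<Gamma>(2) by force
    ultimately show "fst ` (\<Gamma> O \<Delta>) = X" by blast
    have "z \<in> snd ` (\<Gamma> O \<Delta>)" if z: "z \<in> Z" for z
    proof -
      obtain y where y: "(y, z) \<in> \<Delta>" using z \<Delta>(3) by force
      then have "y \<in> snd ` \<Gamma>" using \<Gamma>(3) \<Delta>(2) by force
      then obtain x where "(x, y) \<in> \<Gamma>" by force
      with y show ?thesis by force
    qed
    moreover have "snd p \<in> Z" if "p \<in> \<Gamma> O \<Delta>" for p
      using that \<Delta>(3) by force
    ultimately show "snd ` (\<Gamma> O \<Delta>) = Z" by blast
  qed
  ultimately show ?thesis unfolding kiso_def by blast
qed

lemma kiso_refl:
  assumes "subspace Y" "K \<ge> 1"
  shows "kiso K Y Y"
proof -
  have "subspace ((\<lambda>x. (x, x)) ` Y)"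
    by (rule linear_subspace_image) (auto intro!: linearI assms)
  moreover have "norm x \<le> K * norm x" for x :: 'a
    using mult_right_mono[OF assms(2) norm_ge_zero[of x]] by simp
  ultimately show ?thesis
    unfolding kiso_def iso_graph_def
    by (intro exI[of _ "(\<lambda>x. (x, x)) ` Y"]) (auto simp: image_image)
qed

lemma closure_sequential_pairs:
  fixes x :: "'a::real_normed_vector" and y :: "'b::real_normed_vector"
  shows
  "(x, y) \<in> closure \<Gamma> \<longleftrightarrow> (\<exists>u v. (\<forall>n. (u n, v n) \<in> \<Gamma>) \<and> u \<longlonglongrightarrow> x \<and> v \<longlonglongrightarrow> y)"
proof
  assume "(x, y) \<in> closure \<Gamma>"
  then obtain f where f: "\<forall>n. f n \<in> \<Gamma>" "f \<longlonglongrightarrow> (x, y)"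
    unfolding closure_sequential by blast
  then show "\<exists>u v. (\<forall>n. (u n, v n) \<in> \<Gamma>) \<and> u \<longlonglongrightarrow> x \<and> v \<longlonglongrightarrow> y"
    by (intro exI[of _ "fst \<circ> f"] exI[of _ "snd \<circ> f"])
       (auto simp: o_def dest: tendsto_fst tendsto_snd)
next
  assume "\<exists>u v. (\<forall>n. (u n, v n) \<in> \<Gamma>) \<and> u \<longlonglongrightarrow> x \<and> v \<longlonglongrightarrow> y"
  then show "(x, y) \<in> closure \<Gamma>"
    unfolding closure_sequential
  proof (elim exE conjE)
    fix u v assume "\<forall>n. (u n, v n) \<in> \<Gamma>" "u \<longlonglongrightarrow> x" "v \<longlonglongrightarrow> y"
    then show "\<exists>f. (\<forall>n. f n \<in> \<Gamma>) \<and> f \<longlonglongrightarrow> (x, y)"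
      by (intro exI[of _ "\<lambda>n. (u n, v n)"]) (simp add: tendsto_Pair)
  qed
qed

lemma subspace_closure:
  fixes S :: "'a::real_normed_vector set"
  assumes "subspace S" shows "subspace (closure S)"
proof (rule subspaceI)
  show "0 \<in> closure S" using assms closure_subset subspace_0 by blast
next
  fix x y assume "x \<in> closure S" "y \<in> closure S"
  then obtain u v where "\<forall>n. u n \<in> S" "u \<longlonglongrightarrow> x" "\<forall>n. v n \<in> S" "v \<longlonglongrightarrow> y"
    unfolding closure_sequential by blast
  then show "x + y \<in> closure S"
    unfolding closure_sequential
    by (intro exI[of _ "\<lambda>n. u n + v n"]) (auto intro: tendsto_add subspace_add[OF assms])
next
  fix c x assume "x \<in> closure S"
  then obtain u where "\<forall>n. u n \<in> S" "u \<longlonglongrightarrow> x"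
    unfolding closure_sequential by blast
  then show "c *\<^sub>R x \<in> closure S"
    unfolding closure_sequential
    by (intro exI[of _ "\<lambda>n. c *\<^sub>R u n"]) (auto intro: tendsto_intros subspace_scale[OF assms])
qed

lemma iso_graph_closure:
  assumes "iso_graph K \<Gamma>"
  shows "iso_graph K (closure \<Gamma>)"
proof -
  have "norm y \<le> K * norm x \<and> norm x \<le> K * norm y" if xy: "(x, y) \<in> closure \<Gamma>" for x y
  proof -
    obtain u v where "\<forall>n. (u n, v n) \<in> \<Gamma>" and [tendsto_intros]: "u \<longlonglongrightarrow> x" "v \<longlonglongrightarrow> y"
      using xy unfolding closure_sequential_pairs by blast
    then have *: "norm (v n) \<le> K * norm (u n)" "norm (u n) \<le> K * norm (v n)" for n
      using iso_graphD(2,3)[OF assms] by auto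
    have lu: "(\<lambda>n. norm (u n)) \<longlonglongrightarrow> norm x" "(\<lambda>n. norm (v n)) \<longlonglongrightarrow> norm y"
      "(\<lambda>n. K * norm (u n)) \<longlonglongrightarrow> K * norm x" "(\<lambda>n. K * norm (v n)) \<longlonglongrightarrow> K * norm y"
      by (intro tendsto_intros)+
    show ?thesis
      using LIMSEQ_le[OF lu(2) lu(3)] LIMSEQ_le[OF lu(1) lu(4)] * by blast
  qed
  then show ?thesis
    using subspace_closure[OF iso_graphD(1)[OF assms]] by (simp add: iso_graph_def)
qed

text \<open>If the first coordinates converge, the estimate makes the second coordinates Cauchy, and
  completeness supplies the missing partner of the limit.\<close>

lemma iso_graph_fst_closure:
  fixes \<Gamma> :: "('a::banach \<times> 'a) set"
  assumes "iso_graph K \<Gamma>"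
  shows "fst ` closure \<Gamma> = closure (fst ` \<Gamma>)"
proof
  show "fst ` closure \<Gamma> \<subseteq> closure (fst ` \<Gamma>)"
  proof
    fix x assume "x \<in> fst ` closure \<Gamma>"
    then obtain y u v where "\<forall>n. (u n, v n) \<in> \<Gamma>" "u \<longlonglongrightarrow> x"
      by (force simp: closure_sequential_pairs)
    then show "x \<in> closure (fst ` \<Gamma>)"
      unfolding closure_sequential by (intro exI[of _ u]) force
  qed
  show "closure (fst ` \<Gamma>) \<subseteq> fst ` closure \<Gamma>"
  proof
    fix x assume "x \<in> closure (fst ` \<Gamma>)"
    then obtain u where u: "\<forall>n. u n \<in> fst ` \<Gamma>" "u \<longlonglongrightarrow> x"
      unfolding closure_sequential by blast
    then have "\<forall>n. \<exists>y. (u n, y) \<in> \<Gamma>" by force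
    then obtain v where v: "\<And>n. (u n, v n) \<in> \<Gamma>" by metis
    have "Cauchy v"
    proof (rule metric_CauchyI)
      fix r :: real assume "r > 0"
      have "r / (\<bar>K\<bar> + 1) > 0" using \<open>r > 0\<close> by (simp add: add_nonneg_pos)
      then obtain N where N: "\<And>m n. m \<ge> N \<Longrightarrow> n \<ge> N \<Longrightarrow> dist (u m) (u n) < r / (\<bar>K\<bar> + 1)"
        using LIMSEQ_imp_Cauchy[OF u(2)] unfolding Cauchy_def by blast
      have "dist (v m) (v n) < r" if "m \<ge> N" "n \<ge> N" for m n
      proof -
        have "(u m - u n, v m - v n) \<in> \<Gamma>"
          using subspace_diff[OF iso_graphD(1)[OF assms] v[of m] v[of n]] by simp
        then have "norm (v m - v n) \<le> K * norm (u m - u n)"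
          using iso_graphD(2)[OF assms] by blast
        also have "\<dots> \<le> (\<bar>K\<bar> + 1) * norm (u m - u n)"
          by (intro mult_right_mono) auto
        also have "\<dots> < r"
          using N[OF that] by (simp add: dist_norm field_simps)
        finally show ?thesis by (simp add: dist_norm)
      qed
      then show "\<exists>M. \<forall>m\<ge>M. \<forall>n\<ge>M. dist (v m) (v n) < r" by blast
    qed
    then obtain y where "v \<longlonglongrightarrow> y"
      using Cauchy_convergent_iff convergent_def by blast
    then have "(x, y) \<in> closure \<Gamma>"
      using u v unfolding closure_sequential_pairs by blast
    then show "x \<in> fst ` closure \<Gamma>" by force
  qed
qed

lemma iso_graph_swap: "iso_graph K \<Gamma> \<Longrightarrow> iso_graph K (prod.swap ` \<Gamma>)"
  by (auto simp: iso_graph_def subspace_swap)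

lemma iso_graph_snd_closure:
  fixes \<Gamma> :: "('a::banach \<times> 'a) set"
  assumes "iso_graph K \<Gamma>"
  shows "snd ` closure \<Gamma> = closure (snd ` \<Gamma>)"
proof -
  have swap: "(x, y) \<in> prod.swap ` A \<longleftrightarrow> (y, x) \<in> A" for x y and A :: "('a \<times> 'a) set"
    by force
  have "(x, y) \<in> prod.swap ` closure \<Gamma> \<longleftrightarrow> (x, y) \<in> closure (prod.swap ` \<Gamma>)" for x y
    unfolding swap closure_sequential_pairs by blast
  then have "prod.swap ` closure \<Gamma> = closure (prod.swap ` \<Gamma>)" by (simp add: set_eq_iff)
  then have "snd ` closure \<Gamma> = fst ` closure (prod.swap ` \<Gamma>)"
    by (metis (no_types, lifting) fst_swap image_cong image_image)
  also have "\<dots> = closure (snd ` \<Gamma>)"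
    by (subst iso_graph_fst_closure[OF iso_graph_swap[OF assms]]) (simp add: image_image)
  finally show ?thesis .
qed

lemma kiso_closure:
  fixes Y Z :: "'a::banach set"
  assumes "kiso K Y Z"
  shows "kiso K (closure Y) (closure Z)"
  using assms unfolding kiso_def
  by (metis iso_graph_closure iso_graph_fst_closure iso_graph_snd_closure)

text \<open>A pair in the graph with one coordinate \<open>0\<close> has both coordinates
  \<open>0\<close> by the estimates. Applied to differences, this makes the graph that of an
  injective function.\<close>

lemma kiso_imp_isomorphism_on:
  assumes "kiso K Y Z"
  obtains T where "isomorphism_on Y Z T" "\<And>x. x \<in> Y \<Longrightarrow> norm (T x) \<le> K * norm x"
    "\<And>z. z \<in> Z \<Longrightarrow> norm (inv_into Y T z) \<le> K * norm z"
proof -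
  obtain \<Gamma> where \<Gamma>: "iso_graph K \<Gamma>" and Y: "fst ` \<Gamma> = Y" and Z: "snd ` \<Gamma> = Z"
    using assms unfolding kiso_def by blast
  note sub = iso_graphD(1)[OF \<Gamma>]
  have uniq: "y = y'" if "(x, y) \<in> \<Gamma>" "(x, y') \<in> \<Gamma>" for x y y'
  proof -
    have "(0, y - y') \<in> \<Gamma>" using subspace_diff[OF sub that] by simp
    then show ?thesis using iso_graphD(2)[OF \<Gamma>] by fastforce
  qed
  have uniq': "x = x'" if "(x, y) \<in> \<Gamma>" "(x', y) \<in> \<Gamma>" for x x' y
  proof -
    have "(x - x', 0) \<in> \<Gamma>" using subspace_diff[OF sub that] by simp
    then show ?thesis using iso_graphD(3)[OF \<Gamma>] by fastforce
  qed
  define T where "T x = (THE y. (x, y) \<in> \<Gamma>)" for x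
  have T: "T x = y" if "(x, y) \<in> \<Gamma>" for x y
    unfolding T_def using that uniq by blast
  have TG: "(x, T x) \<in> \<Gamma>" if "x \<in> Y" for x
    using that T Y by force
  have TY: "T ` Y = Z"
  proof
    show "T ` Y \<subseteq> Z"
    proof
      fix z assume "z \<in> T ` Y"
      then obtain x where "(x, z) \<in> \<Gamma>" using TG by blast
      then show "z \<in> Z" using Z by force
    qed
    show "Z \<subseteq> T ` Y"
    proof
      fix z assume "z \<in> Z"
      then obtain x where x: "(x, z) \<in> \<Gamma>" using Z by force
      then have "x \<in> Y" using Y by force
      then show "z \<in> T ` Y" using T[OF x] by blast
    qed
  qed
  have inj: "inj_on T Y"
    by (rule inj_onI) (metis TG uniq')
  have IG: "(inv_into Y T z, z) \<in> \<Gamma>" if "z \<in> Z" for z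
    using that TG TY by (metis f_inv_into_f inv_into_into)
  have I: "inv_into Y T z = x" if "(x, z) \<in> \<Gamma>" for x z
  proof -
    have "z \<in> Z" using that Z by force
    then show ?thesis using IG uniq' that by blast
  qed
  have blT: "bounded_linear_on Y T"
    unfolding bounded_linear_on_def
  proof (intro conjI ballI allI exI[of _ K])
    fix x y assume "x \<in> Y" "y \<in> Y"
    then show "T (x + y) = T x + T y"
      using subspace_add[OF sub TG[of x] TG[of y]] T by simp
  next
    fix c x assume "x \<in> Y"
    then show "T (c *\<^sub>R x) = c *\<^sub>R T x"
      using subspace_scale[OF sub TG[of x], of c] T by simp
  next
    fix x assume "x \<in> Y" then show "norm (T x) \<le> K * norm x"
      using TG iso_graphD(2)[OF \<Gamma>] by blast
  qed
  have blI: "bounded_linear_on Z (inv_into Y T)"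
    unfolding bounded_linear_on_def
  proof (intro conjI ballI allI exI[of _ K])
    fix x y assume "x \<in> Z" "y \<in> Z"
    then show "inv_into Y T (x + y) = inv_into Y T x + inv_into Y T y"
      using subspace_add[OF sub IG[of x] IG[of y]] I by simp
  next
    fix c x assume "x \<in> Z"
    then show "inv_into Y T (c *\<^sub>R x) = c *\<^sub>R inv_into Y T x"
      using subspace_scale[OF sub IG[of x], of c] I by simp
  next
    fix x assume "x \<in> Z" then show "norm (inv_into Y T x) \<le> K * norm x"
      using IG iso_graphD(3)[OF \<Gamma>] by blast
  qed
  show ?thesis
  proof
    show "isomorphism_on Y Z T"
      using inj TY blT blI by (simp add: isomorphism_on_def bij_betw_def)
    show "norm (T x) \<le> K * norm x" if "x \<in> Y" for x
      using TG that iso_graphD(2)[OF \<Gamma>] by blast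
    show "norm (inv_into Y T z) \<le> K * norm z" if "z \<in> Z" for z
      using IG that iso_graphD(3)[OF \<Gamma>] by blast
  qed
qed

lemma onorm_on_bounds:
  assumes "0 \<in> Y" "\<And>x. x \<in> Y \<Longrightarrow> norm (T x) \<le> K * norm x" "K \<ge> 0"
  shows "0 \<le> onorm_on Y T" "onorm_on Y T \<le> K"
proof -
  have b: "norm (T x) / norm x \<le> K" if "x \<in> Y" for x
    using assms(2)[OF that] assms(3) by (cases "x = 0") (auto simp: field_simps)
  show "onorm_on Y T \<le> K"
    unfolding onorm_on_def using assms(1) b by (intro cSUP_least) auto
  \<comment> \<open>The quotient at \<open>0\<close> is \<open>0\<close> by the convention on
    division, so the supremum is nonnegative even on the zero space.\<close>
  have "norm (T 0) / norm (0::'a) \<le> onorm_on Y T"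
    unfolding onorm_on_def using assms(1) b by (intro cSUP_upper bdd_aboveI2[of _ _ K]) auto
  then show "0 \<le> onorm_on Y T" by simp
qed

lemma kiso_imp_K_isomorphic:
  assumes "kiso K Y Z" "K \<ge> 0"
  shows "K_isomorphic (K * K) Y Z"
proof -
  obtain T where T: "isomorphism_on Y Z T" "\<And>x. x \<in> Y \<Longrightarrow> norm (T x) \<le> K * norm x"
    "\<And>z. z \<in> Z \<Longrightarrow> norm (inv_into Y T z) \<le> K * norm z"
    using kiso_imp_isomorphism_on[OF assms(1)] by metis
  obtain \<Gamma> where "subspace \<Gamma>" "fst ` \<Gamma> = Y" "snd ` \<Gamma> = Z"
    using assms(1) unfolding kiso_def iso_graph_def by blast
  then have "0 \<in> Y" "0 \<in> Z" using subspace_0[of \<Gamma>] by force+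
  then have "onorm_on Y T * onorm_on Z (inv_into Y T) \<le> K * K"
    using onorm_on_bounds[of Y T K] onorm_on_bounds[of Z "inv_into Y T" K] T(2,3) assms(2)
    by (intro mult_mono) auto
  then show ?thesis using T(1) unfolding K_isomorphic_def by blast
qed

text \<open>Integer constants suffice, which makes isomorphism a countable union of relations with
  fixed constant, as category arguments require.\<close>

lemma isomorphic_spaces_iff_kiso:
  assumes "subspace Y"
  shows "isomorphic_spaces Y Z \<longleftrightarrow> (\<exists>k::nat. kiso (real k) Y Z)"
proof
  assume "\<exists>k::nat. kiso (real k) Y Z"
  then show "isomorphic_spaces Y Z"
    unfolding isomorphic_spaces_def by (metis kiso_imp_isomorphism_on)
next
  assume "isomorphic_spaces Y Z"
  then obtain T where T: "isomorphism_on Y Z T" unfolding isomorphic_spaces_def by blast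
  then have bij: "bij_betw T Y Z" by (simp add: isomorphism_on_def)
  obtain C where C: "\<And>x. x \<in> Y \<Longrightarrow> norm (T x) \<le> C * norm x"
    using T unfolding isomorphism_on_def bounded_linear_on_def by blast
  obtain D where D: "\<And>z. z \<in> Z \<Longrightarrow> norm (inv_into Y T z) \<le> D * norm z"
    using T unfolding isomorphism_on_def bounded_linear_on_def by blast
  obtain k :: nat where k: "C \<le> real k" "D \<le> real k"
    using real_arch_simple[of "max C D"] by auto
  let ?\<Gamma> = "(\<lambda>x. (x, T x)) ` Y"
  have lin: "T (x + y) = T x + T y" "T (c *\<^sub>R x) = c *\<^sub>R T x" if "x \<in> Y" "y \<in> Y" for x y c
    using T that unfolding isomorphism_on_def bounded_linear_on_def by blast+
  have "subspace ?\<Gamma>"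
  proof (rule subspaceI)
    show "0 \<in> ?\<Gamma>"
      using lin(2)[of 0 0 0] subspace_0[OF assms] by (force simp: zero_prod_def image_iff)
  next
    fix p q assume "p \<in> ?\<Gamma>" "q \<in> ?\<Gamma>"
    then show "p + q \<in> ?\<Gamma>"
      using lin(1) subspace_add[OF assms] by force
  next
    fix c p assume "p \<in> ?\<Gamma>"
    then show "c *\<^sub>R p \<in> ?\<Gamma>"
      using lin(2) subspace_scale[OF assms] by force
  qed
  moreover have "norm (T x) \<le> real k * norm x \<and> norm x \<le> real k * norm (T x)" if "x \<in> Y" for x
  proof -
    have "T x \<in> Z" "inv_into Y T (T x) = x"
      using bij that by (auto simp: bij_betw_def)
    then have "norm x \<le> D * norm (T x)" using D by metis
    with C[OF that] k show ?thesis
      by (meson mult_right_mono norm_ge_zero order_trans)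
  qed
  ultimately have "iso_graph (real k) ?\<Gamma>" by (auto simp: iso_graph_def)
  moreover have "fst ` ?\<Gamma> = Y" "snd ` ?\<Gamma> = Z"
    using bij by (auto simp: bij_betw_def image_image)
  ultimately show "\<exists>k::nat. kiso (real k) Y Z" unfolding kiso_def by blast
qed

section \<open>Finite-codimensional extensions\<close>

text \<open>The extension is recorded as a chain of single vectors rather than as the dimension of a
  quotient, so that two chains of equal length can be climbed in parallel.\<close>

inductive codim :: "nat \<Rightarrow> 'a::real_normed_vector set \<Rightarrow> 'a set \<Rightarrow> bool" where
  codim_0: "codim 0 W W"
| codim_Suc: "codim n W Y \<Longrightarrow> v \<notin> Y \<Longrightarrow> codim (Suc n) W (span (insert v Y))"

lemma codim_split: "codim (m + n) W Y \<Longrightarrow> \<exists>Z. codim m W Z \<and> codim n Z Y"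
proof (induction n arbitrary: Y)
  case 0 then show ?case using codim_0 by auto
next
  case (Suc n)
  from Suc.prems obtain Y' v where "codim (m + n) W Y'" "v \<notin> Y'" "Y = span (insert v Y')"
    by (auto elim: codim.cases)
  then show ?case using Suc.IH codim_Suc by blast
qed

lemma codim_trans: "codim n Z Y \<Longrightarrow> codim m W Z \<Longrightarrow> codim (m + n) W Y"
  by (induction rule: codim.induct) (auto intro: codim_Suc)

lemma span_of_subspace: "subspace W \<Longrightarrow> span W = W"
  by simp

lemma mem_span_insert_subspace:
  assumes "subspace W"
  shows "x \<in> span (insert v W) \<longleftrightarrow> (\<exists>a. \<exists>w\<in>W. x = w + a *\<^sub>R v)"
proof -
  have "x \<in> span (insert v W) \<longleftrightarrow> (\<exists>a. x - a *\<^sub>R v \<in> W)"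
    unfolding span_insert span_of_subspace[OF assms] by simp
  then show ?thesis by (metis add_diff_cancel diff_add_cancel)
qed

text \<open>Riesz's lemma: subtract from \<open>v\<close> a point of \<open>W\<close> whose distance
  to \<open>v\<close> is less than twice the infimum, and normalise. The factor 2 of the coordinate
  bound is that slack, so it is the same for all \<open>W\<close> and \<open>v\<close>.\<close>

lemma one_dim_extension_unit_vector:
  fixes W :: "'a::real_normed_vector set"
  assumes "subspace W" "closed W" "v \<notin> W"
  obtains u where "norm u = 1" "u \<in> span (insert v W)" "span (insert u W) = span (insert v W)"
    "\<And>w a. w \<in> W \<Longrightarrow> \<bar>a\<bar> \<le> 2 * norm (w + a *\<^sub>R u)"
proof -
  define d where "d = infdist v W"
  have W0: "0 \<in> W" "W \<noteq> {}" using subspace_0[OF assms(1)] by auto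
  have "d > 0"
    unfolding d_def using assms(2,3) W0 in_closed_iff_infdist_zero infdist_nonneg
    by (metis less_eq_real_def)
  then have "infdist v W < 2 * d" by (simp add: d_def)
  then obtain w0 where w0: "w0 \<in> W" "dist v w0 < 2 * d"
    unfolding infdist_def using W0 by (auto simp: cINF_less_iff)
  have dist: "d \<le> norm (v - w)" if "w \<in> W" for w
    using infdist_le[OF that, of v] by (simp add: d_def dist_norm)
  define \<rho> where "\<rho> = norm (v - w0)"
  have \<rho>: "\<rho> > 0" "\<rho> < 2 * d"
    using dist[OF w0(1)] \<open>d > 0\<close> w0(2) by (auto simp: \<rho>_def dist_norm)
  define u where "u = (1 / \<rho>) *\<^sub>R (v - w0)"
  have v: "v = \<rho> *\<^sub>R u + w0" using \<rho> by (simp add: u_def)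
  show thesis
  proof
    show "norm u = 1" using \<rho> by (simp add: u_def \<rho>_def)
    have "u \<in> span (insert v W)"
      unfolding u_def using w0(1) by (intro span_scale span_diff) (auto intro: span_base)
    moreover have "v \<in> span (insert u W)"
      unfolding v using w0(1) by (intro span_add span_scale) (auto intro: span_base)
    moreover have "W \<subseteq> span (insert x W)" for x by (auto intro: span_base)
    ultimately show "u \<in> span (insert v W)" "span (insert u W) = span (insert v W)"
      by (simp_all add: span_eq)
    fix w a assume w: "w \<in> W"
    show "\<bar>a\<bar> \<le> 2 * norm (w + a *\<^sub>R u)"
    proof (cases "a = 0")
      case False
      have "w0 - (\<rho> / a) *\<^sub>R w \<in> W"
        using w w0 assms(1) by (intro subspace_diff subspace_scale) auto
      from dist[OF this] have "d \<le> norm (\<rho> *\<^sub>R u + (\<rho> / a) *\<^sub>R w)" by (simp add: v)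
      also have "\<rho> *\<^sub>R u + (\<rho> / a) *\<^sub>R w = (\<rho> / a) *\<^sub>R (w + a *\<^sub>R u)"
        using False by (simp add: scaleR_add_right)
      also have "norm \<dots> = \<rho> / \<bar>a\<bar> * norm (w + a *\<^sub>R u)" using \<rho> by simp
      finally have "\<bar>a\<bar> * d \<le> \<rho> * norm (w + a *\<^sub>R u)" using False by (simp add: field_simps)
      also have "\<dots> \<le> 2 * d * norm (w + a *\<^sub>R u)" using \<rho> by (intro mult_right_mono) auto
      finally show ?thesis using \<open>d > 0\<close> by (simp add: field_simps)
    qed simp
  qed
qed

lemma norm_le_of_coordinate:
  fixes u :: "'a::real_normed_vector"
  assumes "norm u = 1" "\<bar>a\<bar> \<le> 2 * norm (w + a *\<^sub>R u)"
  shows "norm w \<le> 3 * norm (w + a *\<^sub>R u)"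
  using norm_triangle_ineq4[of "w + a *\<^sub>R u" "a *\<^sub>R u"] assms by simp

lemma closed_span_insert:
  fixes W :: "'a::banach set"
  assumes "subspace W" "closed W"
  shows "closed (span (insert v W))"
proof (cases "v \<in> W")
  case True
  then show ?thesis using assms by (simp add: insert_absorb span_of_subspace)
next
  case False
  obtain u where u: "norm u = 1" "span (insert u W) = span (insert v W)"
    "\<And>w a. w \<in> W \<Longrightarrow> \<bar>a\<bar> \<le> 2 * norm (w + a *\<^sub>R u)"
    using one_dim_extension_unit_vector[OF assms False] by metis
  have "x \<in> span (insert u W)" if x: "\<forall>n. f n \<in> span (insert u W)" "f \<longlonglongrightarrow> x" for f x
  proof -
    have "\<forall>n. \<exists>a w. w \<in> W \<and> f n = w + a *\<^sub>R u"
      using x(1) unfolding mem_span_insert_subspace[OF assms(1)] by metis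
    then obtain a w where f: "\<And>n. w n \<in> W" "\<And>n. f n = w n + a n *\<^sub>R u" by metis
    have "Cauchy a"
    proof (rule metric_CauchyI)
      fix r :: real assume "r > 0"
      then obtain N where N: "\<And>m n. m \<ge> N \<Longrightarrow> n \<ge> N \<Longrightarrow> dist (f m) (f n) < r / 2"
        using LIMSEQ_imp_Cauchy[OF x(2)] unfolding Cauchy_def by (meson half_gt_zero)
      have "dist (a m) (a n) < r" if "m \<ge> N" "n \<ge> N" for m n
        using u(3)[OF subspace_diff[OF assms(1) f(1)[of m] f(1)[of n]], of "a m - a n"] N[OF that]
        by (simp add: f(2) dist_norm algebra_simps)
      then show "\<exists>M. \<forall>m\<ge>M. \<forall>n\<ge>M. dist (a m) (a n) < r" by blast
    qed
    then obtain b where b: "a \<longlonglongrightarrow> b"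
      using Cauchy_convergent_iff convergent_def by blast
    have "(\<lambda>n. f n - a n *\<^sub>R u) \<longlonglongrightarrow> x - b *\<^sub>R u"
      by (intro tendsto_intros x(2) b)
    then have "w \<longlonglongrightarrow> x - b *\<^sub>R u" by (simp add: f(2))
    then have "x - b *\<^sub>R u \<in> W"
      using assms(2) f(1) closed_sequentially by blast
    then show ?thesis
      unfolding mem_span_insert_subspace[OF assms(1)] by (metis diff_add_cancel)
  qed
  then show ?thesis
    unfolding u(2)[symmetric] closed_sequential_limits by blast
qed

lemma codim_closed:
  fixes W :: "'a::banach set"
  shows "codim n W Y \<Longrightarrow> subspace W \<Longrightarrow> closed W \<Longrightarrow> subspace Y \<and> closed Y"
  by (induction rule: codim.induct) (auto intro: closed_span_insert)

text \<open>For \<open>x = w + c *\<^sub>R u\<close>, the part \<open>w\<close> has norm at most 3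
  times, and the coordinate \<open>c\<close> at most 2 times, that of \<open>x\<close>. Mapping
  \<open>w\<close> with constant \<open>K\<close> and \<open>u\<close> to \<open>u'\<close> gives
  \<open>3 * K + 2\<close>.\<close>

lemma iso_graph_extend:
  assumes \<Gamma>: "iso_graph K \<Gamma>" and u: "norm u = 1" "norm u' = 1" and K: "K \<ge> 0"
    and a: "\<And>w a. w \<in> fst ` \<Gamma> \<Longrightarrow> \<bar>a\<bar> \<le> 2 * norm (w + a *\<^sub>R u)"
    and a': "\<And>w a. w \<in> snd ` \<Gamma> \<Longrightarrow> \<bar>a\<bar> \<le> 2 * norm (w + a *\<^sub>R u')"
  shows "iso_graph (3 * K + 2) (span (insert (u, u') \<Gamma>))"
proof -
  have "norm y \<le> (3 * K + 2) * norm x \<and> norm x \<le> (3 * K + 2) * norm y"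
    if xy: "(x, y) \<in> span (insert (u, u') \<Gamma>)" for x y
  proof -
    obtain c p where p: "p \<in> \<Gamma>" "(x, y) = p + c *\<^sub>R (u, u')"
      using xy unfolding mem_span_insert_subspace[OF iso_graphD(1)[OF \<Gamma>]] by blast
    obtain w w' where w: "(w, w') \<in> \<Gamma>" and xy: "x = w + c *\<^sub>R u" "y = w' + c *\<^sub>R u'"
      using p by (cases p) auto
    have mem: "w \<in> fst ` \<Gamma>" "w' \<in> snd ` \<Gamma>" using w by force+
    have c: "\<bar>c\<bar> \<le> 2 * norm x" "\<bar>c\<bar> \<le> 2 * norm y"
      using a[OF mem(1), of c] a'[OF mem(2), of c] by (auto simp: xy)
    have n: "norm w \<le> 3 * norm x" "norm w' \<le> 3 * norm y"
      using norm_le_of_coordinate[OF u(1) a[OF mem(1)]] norm_le_of_coordinate[OF u(2) a'[OF mem(2)]]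
      by (auto simp: xy)
    have "norm w' \<le> K * (3 * norm x)" "norm w \<le> K * (3 * norm y)"
      using iso_graphD(2,3)[OF \<Gamma> w] mult_left_mono[OF n(1) K] mult_left_mono[OF n(2) K] by linarith+
    moreover have "norm y \<le> norm w' + \<bar>c\<bar>" "norm x \<le> norm w + \<bar>c\<bar>"
      using norm_triangle_ineq[of w' "c *\<^sub>R u'"] norm_triangle_ineq[of w "c *\<^sub>R u"] u by (auto simp: xy)
    ultimately show ?thesis using c by (auto simp: algebra_simps)
  qed
  then show ?thesis by (simp add: iso_graph_def)
qed

lemma fst_span_insert:
  assumes "subspace \<Gamma>"
  shows "fst ` span (insert (u, u') \<Gamma>) = span (insert u (fst ` \<Gamma>))"
    "snd ` span (insert (u, u') \<Gamma>) = span (insert u' (snd ` \<Gamma>))"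
proof -
  have "linear (fst :: 'a \<times> 'b \<Rightarrow> 'a)" "linear (snd :: 'a \<times> 'b \<Rightarrow> 'b)"
    by (auto intro!: linearI)
  from linear_span_image[OF this(1)] linear_span_image[OF this(2)]
  show "fst ` span (insert (u, u') \<Gamma>) = span (insert u (fst ` \<Gamma>))"
    "snd ` span (insert (u, u') \<Gamma>) = span (insert u' (snd ` \<Gamma>))"
    by (metis fst_conv image_insert) (metis \<open>\<And>S. span (snd ` S) = snd ` span S\<close> snd_conv image_insert)
qed

lemma kiso_extend:
  fixes W W' :: "'a::banach set"
  assumes "kiso K W W'" "K \<ge> 0" "closed W" "closed W'" "v \<notin> W" "v' \<notin> W'"
  shows "kiso (3 * K + 2) (span (insert v W)) (span (insert v' W'))"
proof -
  obtain \<Gamma> where \<Gamma>: "iso_graph K \<Gamma>" "fst ` \<Gamma> = W" "snd ` \<Gamma> = W'"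
    using assms(1) unfolding kiso_def by blast
  note sub = iso_graphD(1)[OF \<Gamma>(1)]
  have lin: "linear (fst :: 'a \<times> 'a \<Rightarrow> 'a)" "linear (snd :: 'a \<times> 'a \<Rightarrow> 'a)"
    by (auto intro!: linearI)
  have W: "subspace W" "subspace W'"
    using linear_subspace_image[OF lin(1) sub] linear_subspace_image[OF lin(2) sub] \<Gamma> by auto
  obtain u where u: "norm u = 1" "span (insert u W) = span (insert v W)"
    "\<And>w a. w \<in> W \<Longrightarrow> \<bar>a\<bar> \<le> 2 * norm (w + a *\<^sub>R u)"
    using one_dim_extension_unit_vector[OF W(1) assms(3,5)] by metis
  obtain u' where u': "norm u' = 1" "span (insert u' W') = span (insert v' W')"
    "\<And>w a. w \<in> W' \<Longrightarrow> \<bar>a\<bar> \<le> 2 * norm (w + a *\<^sub>R u')"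
    using one_dim_extension_unit_vector[OF W(2) assms(4,6)] by metis
  have "iso_graph (3 * K + 2) (span (insert (u, u') \<Gamma>))"
    using iso_graph_extend[OF \<Gamma>(1) u(1) u'(1) assms(2)] u(3) u'(3) \<Gamma>(2,3) by metis
  then show ?thesis
    unfolding kiso_def using fst_span_insert[OF sub, of u u'] \<Gamma>(2,3) u(2) u'(2) by auto
qed

primrec ext_const :: "real \<Rightarrow> nat \<Rightarrow> real" where
  "ext_const K 0 = K"
| "ext_const K (Suc n) = 3 * ext_const K n + 2"

lemma ext_const_ge: "K \<ge> 0 \<Longrightarrow> K \<le> ext_const K n"
  by (induction n) auto

lemma ext_const_nonneg: "K \<ge> 0 \<Longrightarrow> 0 \<le> ext_const K n"
  using ext_const_ge order_trans by blast

lemma ext_const_mono: "K \<ge> 0 \<Longrightarrow> m \<le> n \<Longrightarrow> ext_const K m \<le> ext_const K n"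
  by (rule lift_Suc_mono_le[of "ext_const K"]) (use ext_const_nonneg in \<open>auto simp: algebra_simps add_nonneg_nonneg\<close>)

text \<open>The given isomorphism is extended along both chains simultaneously; each step only uses
  that the new vectors lie outside the spaces reached so far.\<close>

lemma kiso_codim:
  fixes W W' :: "'a::banach set"
  assumes "codim n W Y" "codim n W' Y'" "kiso K W W'" "K \<ge> 0"
    "subspace W" "closed W" "subspace W'" "closed W'"
  shows "kiso (ext_const K n) Y Y'"
  using assms
proof (induction n W Y arbitrary: Y' rule: codim.induct)
  case (codim_0 W)
  then show ?case by (auto elim: codim.cases)
next
  case (codim_Suc n W Y v)
  from codim_Suc.prems(1) obtain Y0 v' where Y0: "codim n W' Y0" "v' \<notin> Y0" "Y' = span (insert v' Y0)"
    by (auto elim: codim.cases)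
  show ?case
    unfolding Y0(3) ext_const.simps
    by (intro kiso_extend codim_Suc ext_const_nonneg Y0)
      (use codim_closed[OF codim_Suc.hyps(1)] codim_closed[OF Y0(1)] codim_Suc.prems in auto)
qed

lemma closure_span_insert:
  fixes Z :: "'a::banach set"
  assumes "subspace Z"
  shows "closure (span (insert v Z)) = span (insert v (closure Z))"
proof
  have "span (insert v Z) \<subseteq> span (insert v (closure Z))"
    using closure_subset by (intro span_mono) auto
  then show "closure (span (insert v Z)) \<subseteq> span (insert v (closure Z))"
    using subspace_closure[OF assms] by (intro closure_minimal closed_span_insert) auto
  have "insert v (closure Z) \<subseteq> closure (span (insert v Z))"
  proof -
    have "insert v Z \<subseteq> span (insert v Z)" by (rule span_superset)
    then show ?thesis
      using closure_mono[of Z "span (insert v Z)"] closure_subset[of "span (insert v Z)"] by blast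
  qed
  then show "span (insert v (closure Z)) \<subseteq> closure (span (insert v Z))"
    by (intro span_minimal subspace_closure subspace_span)
qed

lemma mem_span_Un:
  assumes "subspace A" "subspace B"
  shows "x \<in> span (A \<union> B) \<longleftrightarrow> (\<exists>a\<in>A. \<exists>b\<in>B. x = a + b)"
  unfolding span_Un span_of_subspace[OF assms(1)] span_of_subspace[OF assms(2)] by blast

lemma span_Un_span: "span (A \<union> span B) = span (A \<union> B)"
  by (simp add: span_Un span_span)

lemma span_insert_span: "span (insert v (span B)) = span (insert v B)"
  using span_Un_span[of "{v}" B] by simp

lemma span_Un_assoc: "span (A \<union> span (B \<union> C)) = span (span (A \<union> B) \<union> C)"
  by (metis span_Un_span sup.assoc sup.commute)

lemma card_Int_atLeastLessThan_attains:
  fixes I :: "nat set"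
  assumes "infinite I"
  shows "\<exists>m'\<ge>m. card (I \<inter> {m..<m'}) = c"
proof (induction c)
  case 0 then show ?case by (intro exI[of _ m]) auto
next
  case (Suc c)
  then obtain m1 where m1: "m1 \<ge> m" "card (I \<inter> {m..<m1}) = c" by blast
  have ex: "\<exists>i. i \<in> I \<and> m1 \<le> i" using assms by (metis infinite_nat_iff_unbounded_le)
  define i where "i = (LEAST i. i \<in> I \<and> m1 \<le> i)"
  have i: "i \<in> I" "m1 \<le> i" using LeastI_ex[OF ex] by (auto simp: i_def)
  have "k \<notin> I" if "m1 \<le> k" "k < i" for k using not_less_Least that unfolding i_def by blast
  then have "I \<inter> {m..<Suc i} = insert i (I \<inter> {m..<m1})"
    using i m1(1) by (auto simp: not_less less_Suc_eq) (metis not_less)+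
  then have "card (I \<inter> {m..<Suc i}) = Suc c" using m1(2) i(2) by simp
  then show ?case using m1(1) i(2) by (intro exI[of _ "Suc i"]) auto
qed

section \<open>Category over a countable family of conditions\<close>

text \<open>An abstract countable base of a topology: \<open>N p\<close> is the neighbourhood given
  by \<open>p\<close>, \<open>le\<close> is extension of conditions, and \<open>common\<close> says
  that two neighbourhoods of a point contain a third one around it. Category is then expressed
  through extensions of conditions, without a topology on the points.\<close>

locale conditions =
  fixes Cond :: "'p set" and le :: "'p \<Rightarrow> 'p \<Rightarrow> bool" and N :: "'p \<Rightarrow> 'x set"
  assumes countable_Cond: "countable Cond"
    and le_refl: "p \<in> Cond \<Longrightarrow> le p p"
    and le_trans: "le r q \<Longrightarrow> le q p \<Longrightarrow> le r p"
    and le_N: "le q p \<Longrightarrow> N q \<subseteq> N p"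
    and common: "p \<in> Cond \<Longrightarrow> q \<in> Cond \<Longrightarrow> x \<in> N p \<Longrightarrow> x \<in> N q \<Longrightarrow>
      \<exists>r\<in>Cond. le r p \<and> le r q \<and> x \<in> N r"
begin

definition nwd :: "'x set \<Rightarrow> bool" where
  "nwd M \<longleftrightarrow> (\<forall>p\<in>Cond. \<exists>q\<in>Cond. le q p \<and> N q \<inter> M = {})"

definition meager :: "'x set \<Rightarrow> bool" where
  "meager A \<longleftrightarrow> (\<exists>M :: nat \<Rightarrow> 'x set. (\<forall>n. nwd (M n)) \<and> A \<subseteq> \<Union> (range M))"

lemma nwd_empty: "nwd {}"
  unfolding nwd_def using le_refl by blast

lemma meager_subset: "meager B \<Longrightarrow> A \<subseteq> B \<Longrightarrow> meager A"
  unfolding meager_def by (meson order_trans)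

lemma nwd_imp_meager: "nwd M \<Longrightarrow> meager M"
  unfolding meager_def by (intro exI[of _ "\<lambda>n. M"]) auto

lemma meager_UN_nat:
  fixes A :: "nat \<Rightarrow> 'x set"
  assumes "\<And>n. meager (A n)" shows "meager (\<Union>n. A n)"
proof -
  obtain M where M: "\<And>n k. nwd (M n (k::nat))" "\<And>n. A n \<subseteq> (\<Union>k. M n k)"
    using assms unfolding meager_def by metis
  have "(\<Union>n. A n) \<subseteq> (\<Union>j. case prod_decode j of (n, k) \<Rightarrow> M n k)"
  proof
    fix x assume "x \<in> (\<Union>n. A n)"
    then obtain n k where "x \<in> M n k" using M(2) by blast
    then show "x \<in> (\<Union>j. case prod_decode j of (n, k) \<Rightarrow> M n k)"
      by (intro UN_I[of "prod_encode (n, k)"]) auto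
  qed
  moreover have "nwd (case prod_decode j of (n, k) \<Rightarrow> M n k)" for j
    using M(1) by (cases "prod_decode j") auto
  ultimately show ?thesis unfolding meager_def by (intro exI[of _ "\<lambda>j. case prod_decode j of (n, k) \<Rightarrow> M n k"]) auto
qed

lemma meager_UN:
  assumes "countable I" "\<And>i. i \<in> I \<Longrightarrow> meager (A i)" shows "meager (\<Union>i\<in>I. A i)"
proof (cases "I = {}")
  case True then show ?thesis using nwd_empty nwd_imp_meager by simp
next
  case False
  then have "(\<Union>i\<in>I. A i) = (\<Union>n. A (from_nat_into I n))"
    using range_from_nat_into[OF False assms(1)] by (metis image_image)
  then show ?thesis using meager_UN_nat assms(2) from_nat_into[OF False] by simp
qed

lemma meager_Un: "meager A \<Longrightarrow> meager B \<Longrightarrow> meager (A \<union> B)"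
  using meager_UN[of "{A, B}" id] by auto

lemma nwd_Un:
  assumes "nwd M" "nwd M'" shows "nwd (M \<union> M')"
  unfolding nwd_def
proof
  fix p assume "p \<in> Cond"
  then obtain q where q: "q \<in> Cond" "le q p" "N q \<inter> M = {}" using assms(1) by (auto simp: nwd_def)
  then obtain r where r: "r \<in> Cond" "le r q" "N r \<inter> M' = {}" using assms(2) by (auto simp: nwd_def)
  then have "le r p" "N r \<inter> (M \<union> M') = {}" using q le_trans le_N by blast+
  then show "\<exists>q\<in>Cond. le q p \<and> N q \<inter> (M \<union> M') = {}" using r(1) by blast
qed

lemma nwd_UN_lessThan:
  "(\<And>k. nwd (M k)) \<Longrightarrow> nwd (\<Union>k<n. M (k :: nat))"
  by (induction n) (auto simp: nwd_empty lessThan_Suc intro: nwd_Un)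

text \<open>The union of these neighbourhoods is the open region throughout which \<open>A\<close>
  is non-meager.\<close>

definition heavy :: "'x set \<Rightarrow> 'p set" where
  "heavy A = {p \<in> Cond. \<forall>q\<in>Cond. le q p \<longrightarrow> \<not> meager (A \<inter> N q)}"

lemma heavy_Cond: "p \<in> heavy A \<Longrightarrow> p \<in> Cond"
  by (simp add: heavy_def)

lemma heavy_le: "p \<in> heavy A \<Longrightarrow> q \<in> Cond \<Longrightarrow> le q p \<Longrightarrow> q \<in> heavy A"
  unfolding heavy_def using le_trans by blast

lemma heavy_not_meager: "p \<in> heavy A \<Longrightarrow> \<not> meager (A \<inter> N p)"
  unfolding heavy_def using le_refl by blast

text \<open>If every condition had an extension on which \<open>A\<close> is meager, the countably
  many such neighbourhoods would cover all of \<open>A\<close> up to a nowhere dense set.\<close>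

lemma heavy_exists:
  assumes "\<not> meager A" shows "\<exists>p. p \<in> heavy A"
proof (rule ccontr)
  assume "\<not> ?thesis"
  then have light: "\<exists>q\<in>Cond. le q p \<and> meager (A \<inter> N q)" if "p \<in> Cond" for p
    using that unfolding heavy_def by blast
  define L where "L = {q \<in> Cond. meager (A \<inter> N q)}"
  have "meager (\<Union>q\<in>L. A \<inter> N q)"
    by (rule meager_UN) (auto simp: L_def intro: countable_subset[OF _ countable_Cond])
  moreover have "nwd (A - (\<Union>q\<in>L. N q))"
    unfolding nwd_def using light by (fastforce simp: L_def)
  ultimately have "meager ((\<Union>q\<in>L. A \<inter> N q) \<union> (A - (\<Union>q\<in>L. N q)))"
    using meager_Un nwd_imp_meager by blast
  then have "meager A" by (rule meager_subset) auto
  with assms show False by blast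
qed

lemma heavy_below:
  assumes "\<not> meager (A \<inter> N q)" "q \<in> Cond" shows "\<exists>r\<in>heavy A. le r q"
proof -
  obtain p where p: "p \<in> heavy (A \<inter> N q)" using heavy_exists[OF assms(1)] by blast
  have "A \<inter> N q \<inter> N p \<noteq> {}"
    using heavy_not_meager[OF p] nwd_imp_meager[OF nwd_empty] by force
  then obtain r where r: "r \<in> Cond" "le r p" "le r q"
    using common[OF heavy_Cond[OF p] assms(2)] by blast
  have "\<not> meager (A \<inter> N s)" if s: "s \<in> Cond" "le s r" for s
  proof -
    have "\<not> meager (A \<inter> N q \<inter> N s)"
      using heavy_not_meager[OF heavy_le[OF p s(1)]] le_trans[OF s(2) r(2)] by blast
    moreover have "A \<inter> N q \<inter> N s \<subseteq> A \<inter> N s" by blast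
    ultimately show ?thesis using meager_subset by blast
  qed
  then have "r \<in> heavy A" using r(1) unfolding heavy_def by blast
  then show ?thesis using r(3) by blast
qed

text \<open>Below a condition heavy for \<open>A\<close>, some \<open>B c\<close> is non-meager
  because there are only countably many, and hence heavy below a further extension. A condition
  without extensions heavy for \<open>A\<close> misses the heavy region altogether, by
  \<open>common\<close>.\<close>

lemma nwd_heavy_diff:
  fixes B :: "nat \<Rightarrow> 'x set"
  assumes "A \<subseteq> (\<Union>c. B c)"
  shows "nwd (\<Union> (N ` heavy A) - (\<Union>c. \<Union> (N ` heavy (B c))))"
  unfolding nwd_def
proof
  fix p assume p: "p \<in> Cond"
  show "\<exists>q\<in>Cond. le q p \<and> N q \<inter> (\<Union> (N ` heavy A) - (\<Union>c. \<Union> (N ` heavy (B c)))) = {}"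
  proof (cases "\<exists>q\<in>heavy A. le q p")
    case True
    then obtain q where q: "q \<in> heavy A" "le q p" by blast
    have "\<exists>c. \<not> meager (B c \<inter> N q)"
    proof (rule ccontr)
      assume "\<nexists>c. \<not> meager (B c \<inter> N q)"
      then have "meager (\<Union>c. B c \<inter> N q)" by (intro meager_UN_nat) auto
      then have "meager (A \<inter> N q)" by (rule meager_subset) (use assms in blast)
      then show False using heavy_not_meager[OF q(1)] by blast
    qed
    then obtain c r where r: "r \<in> heavy (B c)" "le r q"
      using heavy_below[OF _ heavy_Cond[OF q(1)]] by blast
    then show ?thesis
      using le_trans[OF r(2) q(2)] heavy_Cond[OF r(1)] by (intro bexI[of _ r]) auto
  next
    case False
    have "x \<notin> N q" if "x \<in> N p" "q \<in> heavy A" for x q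
      using common[OF p heavy_Cond[OF that(2)] that(1)] heavy_le[OF that(2)] False by blast
    then show ?thesis using le_refl[OF p] p by (intro bexI[of _ p]) auto
  qed
qed

text \<open>This replaces the Baire property of analytic sets: \<open>A []\<close> is the projection of a closed set
  along sequences \<open>z\<close>, and \<open>A s\<close> is the part of it witnessed by the \<open>z\<close> extending \<open>s\<close>.\<close>
lemma comeager_below_of_not_meager:
  fixes A :: "nat list \<Rightarrow> 'x set"
  assumes split: "\<And>s. A s \<subseteq> (\<Union>c. A (s @ [c]))"
    and limit: "\<And>x (z :: nat \<Rightarrow> nat). (\<And>n p. p \<in> Cond \<Longrightarrow> x \<in> N p \<Longrightarrow> A (map z [0..<n]) \<inter> N p \<noteq> {}) \<Longrightarrow>
      (\<exists>p\<in>Cond. x \<in> N p) \<Longrightarrow> x \<in> B"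
    and "\<not> meager (A [])"
  shows "\<exists>p\<in>Cond. meager (N p - B)"
proof -
  obtain p where p: "p \<in> heavy (A [])" using heavy_exists assms(3) by blast
  \<comment> \<open>\<open>E s\<close> consists of the points lying in the heavy region of the node
    \<open>s\<close> but of none of its children. There are countably many nodes, so these sets are
    negligible, and outside them an infinite branch of heavy nodes can be followed.\<close>
  define E where "E s = \<Union> (N ` heavy (A s)) - (\<Union>c. \<Union> (N ` heavy (A (s @ [c]))))" for s
  have "meager (\<Union>s\<in>UNIV. E s)"
    using nwd_heavy_diff[OF split] by (intro meager_UN) (auto intro: nwd_imp_meager simp: E_def)
  moreover have "x \<in> B" if x: "x \<in> N p" "\<And>s. x \<notin> E s" for x
  proof -
    have "\<exists>f. \<forall>n. (x \<in> \<Union> (N ` heavy (A (f n))) \<and> length (f n) = n) \<and> (\<exists>c. f (Suc n) = f n @ [c])"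
    proof (rule dependent_nat_choice)
      show "\<exists>s. x \<in> \<Union> (N ` heavy (A s)) \<and> length s = 0" using x p by auto
    next
      fix s n assume "x \<in> \<Union> (N ` heavy (A s)) \<and> length s = n"
      moreover obtain c where "x \<in> \<Union> (N ` heavy (A (s @ [c])))"
        using x(2)[of s] calculation unfolding E_def by blast
      ultimately show "\<exists>t. (x \<in> \<Union> (N ` heavy (A t)) \<and> length t = Suc n) \<and> (\<exists>c. t = s @ [c])"
        by (intro exI[of _ "s @ [c]"]) auto
    qed
    then obtain f c where f: "\<And>n. x \<in> \<Union> (N ` heavy (A (f n)))" "\<And>n. length (f n) = n"
      "\<And>n. f (Suc n) = f n @ [c n]" by metis
    have fz: "f n = map c [0..<n]" for n
      by (induction n) (use f(2)[of 0] f(3) in auto)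
    show ?thesis
    proof (rule limit)
      fix n q assume q: "q \<in> Cond" "x \<in> N q"
      obtain r where r: "r \<in> heavy (A (f n))" "x \<in> N r" using f(1) by blast
      obtain t where t: "t \<in> Cond" "le t q" "le t r"
        using common[OF q(1) heavy_Cond[OF r(1)] q(2) r(2)] by blast
      \<comment> \<open>Heaviness passes to \<open>t\<close>, and non-meager implies nonempty, which
        is all that \<open>limit\<close> asks for.\<close>
      have "\<not> meager (A (f n) \<inter> N t)"
        using heavy_not_meager heavy_le r t by blast
      then have "A (f n) \<inter> N t \<noteq> {}" using nwd_imp_meager[OF nwd_empty] by force
      then show "A (map c [0..<n]) \<inter> N q \<noteq> {}" using le_N[OF t(2)] fz by force
    qed (use heavy_Cond[OF p] x in blast)
  qed
  ultimately have "meager (N p - B)" by (elim meager_subset) auto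
  then show ?thesis using heavy_Cond[OF p] by blast
qed

end

section \<open>The projections of a Schauder basis\<close>

locale basis =
  fixes e :: "nat \<Rightarrow> 'a::banach"
  assumes basis: "schauder_basis e"
begin

definition cf :: "nat \<Rightarrow> 'a \<Rightarrow> real" where "cf i x = basis_coeff e x i"

definition P :: "nat \<Rightarrow> 'a \<Rightarrow> 'a" where "P n x = (\<Sum>i<n. cf i x *\<^sub>R e i)"

lemma cf_sums: "(\<lambda>n. cf n x *\<^sub>R e n) sums x"
proof -
  have "\<exists>!a. (\<lambda>n. a n *\<^sub>R e n) sums x" using basis by (auto simp: schauder_basis_def)
  from theI'[OF this] show ?thesis by (simp add: cf_def basis_coeff_def)
qed

lemma cf_unique: "(\<lambda>n. a n *\<^sub>R e n) sums x \<Longrightarrow> cf i x = a i"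
  using basis cf_sums[of x] unfolding schauder_basis_def by (metis (no_types))

lemma supp_eq: "supp e x = {i. cf i x \<noteq> 0}"
  by (simp add: supp_def cf_def)

lemma cf_add [simp]: "cf i (x + y) = cf i x + cf i y"
  using sums_add[OF cf_sums[of x] cf_sums[of y]]
  by (intro cf_unique) (simp add: scaleR_add_left)

lemma cf_scaleR [simp]: "cf i (c *\<^sub>R x) = c * cf i x"
  using bounded_linear.sums[OF bounded_linear_scaleR_right[of c] cf_sums[of x]]
  by (intro cf_unique) simp

lemma linear_cf: "linear (cf i)"
  by (auto intro: linearI)

lemma cf_0 [simp]: "cf i 0 = 0" and cf_diff [simp]: "cf i (x - y) = cf i x - cf i y"
  and cf_sum: "cf i (sum f A) = (\<Sum>a\<in>A. cf i (f a))"
  by (simp_all add: linear_0 linear_diff linear_sum linear_cf)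

lemma cf_e [simp]: "cf i (e j) = (if i = j then 1 else 0)"
proof (rule cf_unique)
  have "(\<lambda>n. (if n = j then 1 else 0) *\<^sub>R e n) sums (\<Sum>n\<in>{j}. (if n = j then 1 else 0) *\<^sub>R e n)"
    by (rule sums_finite) auto
  then show "(\<lambda>n. (if n = j then 1 else 0) *\<^sub>R e n) sums e j" by simp
qed

lemma e_nonzero [simp]: "e n \<noteq> 0"
  by (metis cf_0 cf_e zero_neq_one)

lemma cf_ext: "(\<And>i. cf i x = cf i y) \<Longrightarrow> x = y"
  using sums_unique2[OF cf_sums[of x]] cf_sums[of y] by simp

lemma linear_P: "linear (P n)"
  unfolding P_def by (auto intro!: linearI simp: scaleR_add_left sum.distrib scaleR_sum_right)

lemma P_add: "P n (x + y) = P n x + P n y" and P_diff: "P n (x - y) = P n x - P n y"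
  and P_scaleR: "P n (c *\<^sub>R x) = c *\<^sub>R P n x" and P_0 [simp]: "P n 0 = 0"
  by (simp_all add: linear_add linear_diff linear_scale linear_0 linear_P)

lemma P_zero [simp]: "P 0 x = 0"
  by (simp add: P_def)

lemma P_tendsto: "(\<lambda>n. P n x) \<longlonglongrightarrow> x"
  using cf_sums[of x] by (simp add: sums_def P_def)

lemma cf_P: "cf i (P n x) = (if i < n then cf i x else 0)"
  by (auto simp: P_def cf_sum sum.delta if_distrib cong: if_cong)

lemma P_P: "P m (P n x) = P (min m n) x"
  by (rule cf_ext) (simp add: cf_P)

lemma P_P_le: "m \<le> n \<Longrightarrow> P m (P n x) = P m x" "n \<le> m \<Longrightarrow> P m (P n x) = P n x"
  by (simp_all add: P_P min_def)

lemma P_Suc_diff: "P (Suc i) x - P i x = cf i x *\<^sub>R e i"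
  by (simp add: P_def)

text \<open>By the Baire theorem some set of vectors with bounded projections is dense in a ball.
  Only closures of these sets can be used, since the projections are not yet known to be continuous;
  hence the conclusion is approximate.\<close>

lemma small_projections_near:
  obtains k r where "k > 0" "r > 0"
    "\<And>y \<epsilon>. norm y < r \<Longrightarrow> \<epsilon> > 0 \<Longrightarrow> \<exists>x. (\<forall>n. norm (P n x) \<le> k) \<and> norm (y - x) < \<epsilon>"
proof -
  define B where "B k = {x. \<forall>n. norm (P n x) \<le> k}" for k
  have "\<exists>k::nat. x \<in> B (real k)" for x
  proof -
    have "Bseq (\<lambda>n. P n x)" using P_tendsto convergent_imp_Bseq convergent_def by blast
    then obtain K where "\<And>n. norm (P n x) \<le> K" by (auto simp: Bseq_def)
    then show ?thesis
      unfolding B_def using real_arch_simple[of K] by (blast intro: order_trans)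
  qed
  then have "\<Union> (range (\<lambda>k::nat. closure (B (real k)))) = UNIV"
    using closure_subset by blast
  moreover have "euclidean interior_of (\<Union> (range (\<lambda>k::nat. closure (B (real k))))) = {}"
    if "\<And>k::nat. interior (closure (B (real k))) = {}"
    using that by (intro Baire_category_alt) (auto intro: completely_metrizable_space_euclidean)
  ultimately obtain k :: nat where "interior (closure (B (real k))) \<noteq> {}" by auto
  then obtain x0 r where r: "r > 0" "ball x0 r \<subseteq> closure (B (real k))"
    by (meson ex_in_conv mem_interior)
  show thesis
  proof
    show "real k + 1 > 0" "r > 0" using r by auto
    fix y :: 'a and \<epsilon> :: real assume y: "norm y < r" "\<epsilon> > 0"
    then have "x0 + y \<in> closure (B (real k))" "x0 - y \<in> closure (B (real k))"
      using r(2) by (auto simp: dist_norm subset_iff)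
    then obtain a b where a: "a \<in> B (real k)" "dist a (x0 + y) < \<epsilon>"
      and b: "b \<in> B (real k)" "dist b (x0 - y) < \<epsilon>"
      using y(2) by (meson closure_approachable)
    \<comment> \<open>Half the difference of approximations to \<open>x0 + y\<close> and
      \<open>x0 - y\<close> moves the ball from \<open>x0\<close> to the origin.\<close>
    let ?x = "(1/2) *\<^sub>R (a - b)"
    have "norm (P n ?x) \<le> real k + 1" for n
      using a(1) b(1) norm_triangle_ineq4[of "P n a" "P n b"]
      by (auto simp: P_scaleR P_diff B_def) (smt (verit) field_sum_of_halves)
    moreover have "norm (y - ?x) < \<epsilon>"
    proof -
      have "y - ?x = (1/2) *\<^sub>R (((x0 + y) - a) - ((x0 - y) - b))"
        by (simp add: algebra_simps flip: scaleR_left.add)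
      then have "norm (y - ?x) \<le> (norm ((x0 + y) - a) + norm ((x0 - y) - b)) / 2"
        using norm_triangle_ineq4[of "(x0 + y) - a" "(x0 - y) - b"] by simp
      then show ?thesis using a(2) b(2) by (simp add: dist_norm norm_minus_commute)
    qed
    ultimately show "\<exists>x. (\<forall>n. norm (P n x) \<le> real k + 1) \<and> norm (y - x) < \<epsilon>" by blast
  qed
qed

text \<open>As in the open mapping theorem, \<open>y\<close> is written as a series of approximants
  whose projections are bounded by \<open>k / 2 ^ j\<close>. The coefficients of the partial sums
  converge, and their limits form an expansion of \<open>y\<close>.\<close>

lemma projections_bounded: "\<exists>C\<ge>1. \<forall>n x. norm (P n x) \<le> C * norm x"
proof -
  obtain k r where k: "k > 0" and r: "r > 0" and
    near: "\<And>y \<epsilon>. norm y < r \<Longrightarrow> \<epsilon> > 0 \<Longrightarrow> \<exists>x. (\<forall>n. norm (P n x) \<le> k) \<and> norm (y - x) < \<epsilon>"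
    using small_projections_near by metis
  have near': "\<exists>x. (\<forall>n. norm (P n x) \<le> k / 2^j) \<and> norm (y - x) < r / 2 ^ Suc j"
    if "norm y < r / 2 ^ j" for y j
  proof -
    have "norm ((2::real)^j *\<^sub>R y) < r" using that by (simp add: field_simps)
    with near[of "2^j *\<^sub>R y" "r / 2"] r
    obtain x where x: "\<And>n. norm (P n x) \<le> k" "norm ((2::real)^j *\<^sub>R y - x) < r / 2" by auto
    have "y - (1/2^j) *\<^sub>R x = (1/2^j) *\<^sub>R ((2::real)^j *\<^sub>R y - x)" by (simp add: scaleR_diff_right)
    then have "norm (y - (1/2^j) *\<^sub>R x) = norm ((2::real)^j *\<^sub>R y - x) / 2^j" by simp
    also have "\<dots> < r / 2 / 2^j" using x(2) by (intro divide_strict_right_mono) auto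
    finally have "norm (y - (1/2^j) *\<^sub>R x) < r / 2 ^ Suc j" by simp
    moreover have "norm (P n ((1/2^j) *\<^sub>R x)) \<le> k / 2^j" for n
      using x(1)[of n] by (simp add: P_scaleR divide_right_mono)
    ultimately show ?thesis by blast
  qed
  define g where "g j y = (SOME x. (\<forall>n. norm (P n x) \<le> k / 2^j) \<and> norm (y - x) < r / 2 ^ Suc j)" for j y
  have g: "norm (P n (g j y)) \<le> k / 2^j" "norm (y - g j y) < r / 2 ^ Suc j"
    if "norm y < r / 2 ^ j" for y j n
    using someI_ex[OF near'[OF that]] unfolding g_def by blast+
  have bound: "norm (P n y) \<le> 2 * k" if y: "norm y < r" for n y
  proof -
    define Y where "Y = rec_nat y (\<lambda>j z. z - g j z)"
    have Y0: "Y 0 = y" and YS: "Y (Suc j) = Y j - g j (Y j)" for j by (simp_all add: Y_def)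
    have Yr: "norm (Y j) < r / 2^j" for j
      by (induction j) (use y in \<open>simp_all add: Y0 YS g(2) del: power_Suc\<close>)
    define s where "s j = y - Y j" for j
    have sS: "s (Suc j) = s j + g j (Y j)" for j by (simp add: s_def YS)
    have s_diff: "norm (P n (s (j + i) - s j)) \<le> 2 * k / 2^j - 2 * k / 2^(j + i)" for n i j
    proof (induction i)
      case (Suc i)
      have "norm (P n (s (j + Suc i) - s j)) \<le> norm (P n (s (j + i) - s j)) + norm (P n (g (j + i) (Y (j + i))))"
        using norm_triangle_ineq[of "P n (s (j + i) - s j)" "P n (g (j + i) (Y (j + i)))"]
        by (simp add: sS flip: P_add) (simp add: algebra_simps)
      also have "\<dots> \<le> 2 * k / 2^j - 2 * k / 2^(j + i) + k / 2^(j + i)"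
        using Suc g(1)[OF Yr] by (intro add_mono) auto
      finally show ?case by simp
    qed simp
    have s_diff': "norm (P n (s J - s j)) \<le> 2 * k / 2^j" if "j \<le> J" for n j J
    proof -
      have "0 \<le> 2 * k / 2^J" using k by simp
      then show ?thesis using s_diff[of n j "J - j"] that by simp
    qed
    have k0: "(\<lambda>j. c / 2^j) \<longlonglongrightarrow> 0" for c :: real
      using tendsto_mult[OF tendsto_const[of c] LIMSEQ_power_zero[of "1/2::real"]]
      by (simp add: power_one_over divide_simps)
    have "\<exists>a. (\<lambda>j. cf i (s j)) \<longlonglongrightarrow> a" for i
    proof -
      have le: "norm (cf i (s J - s j)) * norm (e i) \<le> 4 * k / 2^j" if "j \<le> J" for j J
        using norm_triangle_ineq4[of "P (Suc i) (s J - s j)" "P i (s J - s j)"]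
          s_diff'[OF that, of "Suc i"] s_diff'[OF that, of i]
        unfolding P_Suc_diff by simp
      have "Cauchy (\<lambda>j. cf i (s j))"
      proof (rule CauchyI')
        fix \<epsilon> :: real assume "\<epsilon> > 0"
        then have "\<epsilon> * norm (e i) > 0" by simp
        with k0[of "4 * k"] have "\<forall>\<^sub>F j in sequentially. 4 * k / 2^j < \<epsilon> * norm (e i)"
          by (rule order_tendstoD)
        then obtain M where M: "\<And>j. j \<ge> M \<Longrightarrow> 4 * k / 2^j < \<epsilon> * norm (e i)"
          by (auto simp: eventually_sequentially)
        have "dist (cf i (s m)) (cf i (s n)) < \<epsilon>" if "m \<ge> M" "n > m" for m n
        proof -
          have "norm (cf i (s n - s m)) * norm (e i) < \<epsilon> * norm (e i)"
            using le[OF less_imp_le[OF that(2)]] M[OF that(1)] by linarith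
          then have "norm (cf i (s n - s m)) < \<epsilon>"
            by (rule mult_right_less_imp_less) simp
          then show ?thesis by (simp add: dist_norm norm_minus_commute)
        qed
        then show "\<exists>M. \<forall>m\<ge>M. \<forall>n>m. dist (cf i (s m)) (cf i (s n)) < \<epsilon>" by blast
      qed
      then show ?thesis using Cauchy_convergent_iff convergent_def by blast
    qed
    then obtain a where a: "\<And>i. (\<lambda>j. cf i (s j)) \<longlonglongrightarrow> a i" by metis
    define p where "p n = (\<Sum>i<n. a i *\<^sub>R e i)" for n
    have p: "(\<lambda>j. P n (s j)) \<longlonglongrightarrow> p n" for n
      unfolding P_def p_def by (intro tendsto_intros a)
    have p_diff: "norm (p n - P n (s j)) \<le> 2 * k / 2^j" for n j
    proof (rule tendsto_upperbound)
      show "(\<lambda>J. norm (P n (s J) - P n (s j))) \<longlonglongrightarrow> norm (p n - P n (s j))"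
        by (intro tendsto_intros p)
      show "\<forall>\<^sub>F J in sequentially. norm (P n (s J) - P n (s j)) \<le> 2 * k / 2^j"
        using s_diff'[of j] unfolding eventually_sequentially P_diff by blast
    qed simp
    have "p \<longlonglongrightarrow> y"
    proof (rule LIMSEQ_I)
      fix \<epsilon> :: real assume "\<epsilon> > 0"
      then have e3: "\<epsilon> / 3 > 0" by simp
      have "\<forall>\<^sub>F j in sequentially. 2 * k / 2^j < \<epsilon> / 3 \<and> r / 2^j < \<epsilon> / 3"
        by (intro eventually_conj order_tendstoD(2)[OF k0 e3])
      then obtain j where j: "2 * k / 2^j < \<epsilon> / 3" "r / 2^j < \<epsilon> / 3"
        by (auto simp: eventually_sequentially)
      obtain N where N: "\<And>n. n \<ge> N \<Longrightarrow> norm (P n (s j) - s j) < \<epsilon> / 3"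
        using LIMSEQ_D[OF P_tendsto e3] by blast
      have "norm (p n - y) < \<epsilon>" if "n \<ge> N" for n
      proof -
        have "p n - y = (p n - P n (s j)) + (P n (s j) - s j) - Y j" by (simp add: s_def)
        then have "norm (p n - y) \<le> norm (p n - P n (s j)) + norm (P n (s j) - s j) + norm (Y j)"
          by (smt (verit) norm_triangle_ineq norm_triangle_ineq4)
        then show ?thesis using N[OF that] p_diff[of n j] j Yr[of j] by linarith
      qed
      then show "\<exists>N. \<forall>n\<ge>N. norm (p n - y) < \<epsilon>" by blast
    qed
    then have "(\<lambda>n. a n *\<^sub>R e n) sums y" by (simp add: sums_def p_def[abs_def])
    \<comment> \<open>Uniqueness of the expansion identifies the limit of the projections with the
      projection of the limit; the estimate at \<open>s 0 = 0\<close> then bounds it by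
      \<open>2 * k\<close>.\<close>
    then have "P n y = p n" by (simp add: P_def p_def cf_unique)
    moreover have "s 0 = 0" by (simp add: s_def Y0)
    ultimately show ?thesis using p_diff[of n 0] by simp
  qed
  have "norm (P n x) \<le> (4 * k / r) * norm x" for n x
  proof (cases "x = 0")
    case False
    let ?y = "(r / (2 * norm x)) *\<^sub>R x"
    have "norm ?y < r" using False r by simp
    from bound[OF this, of n] have "r / (2 * norm x) * norm (P n x) \<le> 2 * k"
      using r by (simp add: P_scaleR)
    then show ?thesis using False r by (simp add: field_simps)
  qed simp
  then have "norm (P n x) \<le> max 1 (4 * k / r) * norm x" for n x
    by (meson max.cobounded2 mult_right_mono norm_ge_zero order_trans)
  then show ?thesis by (intro exI[of _ "max 1 (4 * k / r)"]) auto
qed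

definition C :: real where "C = (SOME C. C \<ge> 1 \<and> (\<forall>n x. norm (P n x) \<le> C * norm x))"

lemma C_ge_1: "C \<ge> 1" and norm_P: "norm (P n x) \<le> C * norm x"
  using someI_ex[OF projections_bounded] unfolding C_def by auto

lemma bounded_linear_P: "bounded_linear (P n)"
  using linear_P norm_P by (auto intro!: bounded_linear_intro[of _ C] simp: P_add P_scaleR mult.commute)

lemma norm_P_diff: "norm (P n x - P m x) \<le> 2 * C * norm x"
  using norm_triangle_ineq4[of "P n x" "P m x"] norm_P[of n x] norm_P[of m x] by linarith

lemma norm_cf: "\<bar>cf i x\<bar> * norm (e i) \<le> 2 * C * norm x"
  using norm_P_diff[of "Suc i" x i] by (simp add: P_Suc_diff)

lemma bounded_linear_cf: "bounded_linear (cf i)"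
proof (rule bounded_linear_intro[of _ "2 * C / norm (e i)"])
  show "norm (cf i x) \<le> norm x * (2 * C / norm (e i))" for x
    using norm_cf[of i x] by (simp add: field_simps)
qed auto

definition tail :: "nat \<Rightarrow> 'a set" where "tail l = {x. P l x = 0}"

definition blk :: "nat \<Rightarrow> nat \<Rightarrow> 'a set" where "blk l u = {x. P l x = 0 \<and> P u x = x}"

lemma P_eq_0_iff: "P l x = 0 \<longleftrightarrow> (\<forall>i<l. cf i x = 0)"
  by (metis cf_0 cf_P cf_ext)

lemma P_eq_self_iff: "P u x = x \<longleftrightarrow> (\<forall>i\<ge>u. cf i x = 0)"
  by (metis cf_P cf_ext linorder_not_less)

lemma mem_tail: "x \<in> tail l \<longleftrightarrow> (\<forall>i<l. cf i x = 0)"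
  by (simp add: tail_def P_eq_0_iff)

lemma mem_blk: "x \<in> blk l u \<longleftrightarrow> (\<forall>i. cf i x \<noteq> 0 \<longrightarrow> l \<le> i \<and> i < u)"
  unfolding blk_def mem_Collect_eq P_eq_0_iff P_eq_self_iff by (meson not_less)

lemma subspace_tail: "subspace (tail l)" and subspace_blk: "subspace (blk l u)"
  by (auto intro!: subspaceI simp: tail_def blk_def P_add P_scaleR)

lemma tail_antimono: "l \<le> m \<Longrightarrow> tail m \<subseteq> tail l"
  by (auto simp: mem_tail)

lemma blk_mono: "l' \<le> l \<Longrightarrow> u \<le> u' \<Longrightarrow> blk l u \<subseteq> blk l' u'"
  by (fastforce simp: mem_blk)

lemma blk_subset_tail: "blk l u \<subseteq> tail l"
  by (auto simp: blk_def tail_def)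

lemma e_in_blk: "l \<le> i \<Longrightarrow> i < u \<Longrightarrow> e i \<in> blk l u"
  by (auto simp: mem_blk)

lemma P_in_blk: "l \<le> u \<Longrightarrow> P u x - P l x \<in> blk l u"
  by (auto simp: mem_blk cf_P split: if_splits)

section \<open>Leading coordinates\<close>

text \<open>For a finite-dimensional \<open>S\<close>, the number of leading coordinates is the dimension.\<close>

definition Lead :: "'a set \<Rightarrow> nat set" where
  "Lead S = {i. \<exists>v\<in>S \<inter> tail i. cf i v \<noteq> 0}"

lemma tail_not_Lead: "i \<notin> Lead S \<Longrightarrow> S \<inter> tail i = S \<inter> tail (Suc i)"
  unfolding Lead_def by (auto simp: mem_tail less_Suc_eq)

lemma tail_Lead:
  assumes "subspace S" "i \<in> Lead S"
  obtains v where "cf i v \<noteq> 0" "S \<inter> tail i = span (insert v (S \<inter> tail (Suc i)))"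
proof -
  obtain v where v: "v \<in> S" "v \<in> tail i" "cf i v \<noteq> 0" using assms(2) by (auto simp: Lead_def)
  have "x \<in> span (insert v (S \<inter> tail (Suc i)))" if x: "x \<in> S \<inter> tail i" for x
  proof -
    let ?y = "x - (cf i x / cf i v) *\<^sub>R v"
    have "?y \<in> S" using x v assms(1) by (auto intro: subspace_diff subspace_scale)
    moreover have "?y \<in> tail (Suc i)"
      using x v by (auto simp: mem_tail less_Suc_eq)
    ultimately have "?y \<in> span (insert v (S \<inter> tail (Suc i)))" by (auto intro!: span_base)
    then have "?y + (cf i x / cf i v) *\<^sub>R v \<in> span (insert v (S \<inter> tail (Suc i)))"
      by (intro span_add span_scale) (auto intro: span_base)
    then show ?thesis by simp
  qed
  moreover have "span (insert v (S \<inter> tail (Suc i))) \<subseteq> S \<inter> tail i"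
    using v(1,2) tail_antimono[of i "Suc i"] assms(1) subspace_tail
    by (intro span_minimal subspace_inter) auto
  ultimately show thesis using that[OF v(3)] by blast
qed

text \<open>For a leading \<open>i\<close>, the new vector has nonzero coordinate \<open>i\<close>,
  whereas this continuous coordinate vanishes on the smaller space and so on its closure. The head
  contributes nothing at \<open>i\<close> because it lives below \<open>m\<close>. The cardinality
  is 0 or 1 and treats both cases at once.\<close>

lemma codim_Lead_step:
  assumes "subspace S" "subspace H" "H \<subseteq> blk 0 m" "m \<le> i"
  shows "codim (card (Lead S \<inter> {i})) (closure (span (H \<union> (S \<inter> tail (Suc i)))))
     (closure (span (H \<union> (S \<inter> tail i))))"
proof (cases "i \<in> Lead S")
  case False
  then have "S \<inter> tail i = S \<inter> tail (Suc i)"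
    by (rule tail_not_Lead)
  then show ?thesis using False codim_0 by simp
next
  case True
  then obtain v where v: "cf i v \<noteq> 0" "S \<inter> tail i = span (insert v (S \<inter> tail (Suc i)))"
    using tail_Lead assms(1) by blast
  define Z where "Z = span (H \<union> (S \<inter> tail (Suc i)))"
  have Z0: "Z \<subseteq> {x. cf i x = 0}"
    unfolding Z_def
  proof (rule span_minimal)
    show "H \<union> S \<inter> tail (Suc i) \<subseteq> {x. cf i x = 0}"
      using assms(3,4) by (fastforce simp: mem_tail mem_blk)
    show "subspace {x. cf i x = 0}" by (auto intro!: subspaceI)
  qed
  have "closed {x. cf i x = 0}"
  proof -
    have "{x. cf i x = 0} = cf i -` {0}" by auto
    then show ?thesis
      using continuous_closed_vimage[OF closed_singleton, of "cf i"] bounded_linear_cf[of i]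
      by (simp add: linear_continuous_at)
  qed
  with Z0 have "closure Z \<subseteq> {x. cf i x = 0}" by (rule closure_minimal)
  then have vZ: "v \<notin> closure Z" using v by blast
  have "span (H \<union> (S \<inter> tail i)) = span (insert v Z)"
    unfolding Z_def v(2) span_Un_span span_insert_span by simp
  then have "closure (span (H \<union> (S \<inter> tail i))) = span (insert v (closure Z))"
    by (simp add: closure_span_insert Z_def)
  then show ?thesis
    using codim_Suc[OF codim_0 vZ] True by (simp add: Z_def)
qed

lemma codim_Lead:
  assumes "subspace S" "subspace H" "H \<subseteq> blk 0 m" "m \<le> m'"
  shows "codim (card (Lead S \<inter> {m..<m'})) (closure (span (H \<union> (S \<inter> tail m'))))
     (closure (span (H \<union> (S \<inter> tail m))))"
  using assms(4)
proof (induction m' rule: dec_induct)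
  case base then show ?case by (simp add: codim_0)
next
  case (step i)
  have "card (Lead S \<inter> {m..<Suc i}) = card (Lead S \<inter> {i}) + card (Lead S \<inter> {m..<i})"
    using step(1) by (subst card_Un_disjoint[symmetric]) (auto intro: arg_cong[where f = card])
  then show ?case
    using codim_trans[OF step.IH codim_Lead_step[OF assms(1-3) step(1)]] by simp
qed

lemma Lead_subset_blk: "H \<subseteq> blk l u \<Longrightarrow> Lead H \<subseteq> {l..<u}"
  unfolding Lead_def by (fastforce simp: mem_blk)

lemma P_span_Un:
  assumes "H \<subseteq> blk 0 m" "W \<subseteq> tail m" "h \<in> H" "w \<in> W"
  shows "P m (h + w) = h"
  using assms by (auto simp: blk_def tail_def P_add subset_iff)

lemma Lead_Un:
  assumes "subspace H" "subspace W" "H \<subseteq> blk 0 m" "W \<subseteq> tail m"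
  shows "Lead (span (H \<union> W)) = Lead H \<union> Lead W"
proof
  show "Lead H \<union> Lead W \<subseteq> Lead (span (H \<union> W))"
    unfolding Lead_def by (auto intro: span_base)
  show "Lead (span (H \<union> W)) \<subseteq> Lead H \<union> Lead W"
  proof
    fix i assume "i \<in> Lead (span (H \<union> W))"
    then obtain v where v: "v \<in> span (H \<union> W)" "v \<in> tail i" "cf i v \<noteq> 0" by (auto simp: Lead_def)
    then obtain h w where hw: "h \<in> H" "w \<in> W" "v = h + w"
      using mem_span_Un[OF assms(1,2)] by blast
    have h: "h = P m v" using P_span_Un[OF assms(3,4) hw(1,2)] hw(3) by simp
    show "i \<in> Lead H \<union> Lead W"
    proof (cases "i < m")
      case True
      then have "cf i h \<noteq> 0" "h \<in> tail i" using v unfolding h by (auto simp: cf_P mem_tail)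
      then show ?thesis using hw(1) by (auto simp: Lead_def)
    next
      case False
      then have "h = 0" unfolding h using v(2) by (auto simp: P_eq_0_iff mem_tail)
      then show ?thesis using hw v by (auto simp: Lead_def)
    qed
  qed
qed

text \<open>This is \<open>codim_Lead\<close> for \<open>span (H \<union> W)\<close> cut at
  \<open>m\<close>, with trivial head: the part in \<open>tail m\<close> is \<open>W\<close>, and
  the leading coordinates below \<open>m\<close> are those of \<open>H\<close>.\<close>

lemma codim_head:
  assumes "subspace H" "subspace W" "H \<subseteq> blk 0 m" "W \<subseteq> tail m"
  shows "codim (card (Lead H)) (closure W) (closure (span (H \<union> W)))"
proof -
  let ?S = "span (H \<union> W)"
  have "?S \<inter> tail m = W"
  proof
    show "?S \<inter> tail m \<subseteq> W"
    proof
      fix x assume x: "x \<in> ?S \<inter> tail m"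
      then obtain h w where hw: "h \<in> H" "w \<in> W" "x = h + w"
        using mem_span_Un[OF assms(1,2)] by blast
      then have "h = P m x" using P_span_Un[OF assms(3,4)] by simp
      then show "x \<in> W" using x hw by (simp add: tail_def)
    qed
    show "W \<subseteq> ?S \<inter> tail m" using assms(4) by (auto intro: span_base)
  qed
  moreover have "Lead ?S \<inter> {0..<m} = Lead H"
    using Lead_Un[OF assms] Lead_subset_blk[OF assms(3)] assms(4)
    by (auto simp: Lead_def mem_tail subset_iff)
  moreover have "?S \<inter> tail 0 = ?S" by (auto simp: mem_tail)
  ultimately show ?thesis
    using codim_Lead[of ?S "{}" 0 m] codim_Lead[of ?S "{0}" 0 m] assms(2)
    by (simp add: span_of_subspace insert_absorb subspace_0 mem_blk subspace_single_0)
qed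

text \<open>Both spaces extend \<open>closure W\<close> by the same number of vectors, so the
  identity of \<open>closure W\<close> can be extended.\<close>

lemma kiso_change_head:
  assumes "subspace H" "subspace H'" "subspace W" "H \<subseteq> blk 0 m" "H' \<subseteq> blk 0 m" "W \<subseteq> tail m"
    "card (Lead H) = card (Lead H')"
  shows "kiso (ext_const 1 (card (Lead H))) (closure (span (H \<union> W))) (closure (span (H' \<union> W)))"
  using codim_head[OF assms(1,3,4,6)] codim_head[OF assms(2,3,5,6)] assms(7)
    subspace_closure[OF assms(3)] kiso_refl[of "closure W" 1]
  by (intro kiso_codim) auto

section \<open>Finite nets and rounding\<close>

text \<open>Lowering the cut from \<open>u\<close> to 0 adds at most one vector per coordinate. The
  bound \<open>n \<le> u\<close> is what keeps the factor \<open>3 ^ n\<close> of the rounding error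
  under control.\<close>

lemma codim_zero_blk:
  assumes "subspace D" "D \<subseteq> blk 0 u"
  shows "\<exists>n\<le>u. codim n {0} D"
proof -
  have "\<exists>n\<le>u - i. codim n {0} (D \<inter> tail i)" if "i \<le> u" for i
    using that
  proof (induction i rule: inc_induct)
    case base
    have "D \<inter> tail u = {0}"
      using assms subspace_0[OF assms(1)] by (auto simp: blk_def tail_def subset_iff)
    then show ?case using codim_0 by auto
  next
    case (step i)
    then obtain n where n: "n \<le> u - Suc i" "codim n {0} (D \<inter> tail (Suc i))" by blast
    show ?case
    proof (cases "i \<in> Lead D")
      case True
      obtain v where v: "cf i v \<noteq> 0" "D \<inter> tail i = span (insert v (D \<inter> tail (Suc i)))"
        using tail_Lead[OF assms(1) True] by blast
      have "v \<notin> D \<inter> tail (Suc i)" using v(1) by (auto simp: mem_tail)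
      then have "codim (Suc n) {0} (D \<inter> tail i)" using codim_Suc[OF n(2)] v(2) by simp
      then show ?thesis using n(1) step by (intro exI[of _ "Suc n"]) auto
    next
      case False
      then show ?thesis using n tail_not_Lead by (intro exI[of _ n]) auto
    qed
  qed
  from this[of 0] show ?thesis by (simp add: tail_def)
qed

lemma grid_exists:
  assumes "t > 0"
  shows "\<exists>G::real set. finite G \<and> 0 \<in> G \<and> 1 \<in> G \<and> (\<forall>a. \<bar>a\<bar> \<le> b \<longrightarrow> (\<exists>c\<in>G. \<bar>a - c\<bar> \<le> t))"
proof (intro exI conjI allI impI)
  let ?G = "{0, 1} \<union> (\<lambda>k. t * of_int k) ` {- \<lceil>b / t\<rceil> - 1..\<lceil>b / t\<rceil> + 1}"
  show "finite ?G" "0 \<in> ?G" "1 \<in> ?G" by auto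
  fix a :: real assume a: "\<bar>a\<bar> \<le> b"
  have "\<bar>a / t\<bar> \<le> b / t" using a assms by (simp add: divide_right_mono)
  then have "\<lfloor>a / t\<rfloor> \<in> {- \<lceil>b / t\<rceil> - 1..\<lceil>b / t\<rceil> + 1}"
    unfolding atLeastAtMost_iff by linarith
  moreover have "\<bar>a - t * of_int \<lfloor>a / t\<rfloor>\<bar> \<le> t"
  proof -
    have "a - t * of_int \<lfloor>a / t\<rfloor> = t * (a / t - of_int \<lfloor>a / t\<rfloor>)"
      using assms by (simp add: right_diff_distrib)
    moreover have "\<bar>a / t - of_int \<lfloor>a / t\<rfloor>\<bar> \<le> 1" by linarith
    ultimately show ?thesis using assms by (simp add: abs_mult)
  qed
  ultimately show "\<exists>c\<in>?G. \<bar>a - c\<bar> \<le> t" by blast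
qed

definition eps :: real where "eps = 1 / (4 * C)"

lemma eps_pos: "eps > 0" using C_ge_1 by (simp add: eps_def)

text \<open>The precision \<open>eps / 6 ^ u\<close> leaves \<open>eps / 2 ^ u\<close> for a subspace of \<open>blk l u\<close>: such a subspace is built
  from at most \<open>u\<close> vectors, each of which may triple the rounding error. With \<open>eps = 1 / (4 * C)\<close> the
  errors of consecutive blocks, each read off by a difference of two projections, add up to at
  most \<open>1 / 2\<close>.\<close>

definition grid :: "nat \<Rightarrow> real set" where
  "grid u = (SOME G. finite G \<and> 0 \<in> G \<and> 1 \<in> G \<and>
     (\<forall>a. \<bar>a\<bar> \<le> (\<Sum>i<u. 2 * C * (real u + 1) / norm (e i)) \<longrightarrow>
        (\<exists>c\<in>G. \<bar>a - c\<bar> \<le> eps / 6 ^ u / (1 + (\<Sum>i<u. norm (e i))))))"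

lemma grid_step_pos: "eps / 6 ^ u / (1 + (\<Sum>i<u. norm (e i))) > 0"
  using eps_pos by (intro divide_pos_pos add_pos_nonneg sum_nonneg) auto

lemma grid:
  "finite (grid u)" "0 \<in> grid u" "1 \<in> grid u"
  "\<bar>a\<bar> \<le> (\<Sum>i<u. 2 * C * (real u + 1) / norm (e i)) \<Longrightarrow>
     \<exists>c\<in>grid u. \<bar>a - c\<bar> \<le> eps / 6 ^ u / (1 + (\<Sum>i<u. norm (e i)))"
  using someI_ex[OF grid_exists[OF grid_step_pos]] unfolding grid_def by blast+

text \<open>The grids for different \<open>u\<close> are chosen independently and need not be
  nested. The union over \<open>v \<le> u\<close> makes the nets increase, so that an admissible
  head stays admissible at later cut points.\<close>

definition Net :: "nat \<Rightarrow> 'a set" where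
  "Net u = {x \<in> blk 0 u. \<forall>i<u. cf i x \<in> (\<Union>v\<le>u. grid v)}"

lemma Net_blk: "Net u \<subseteq> blk 0 u"
  by (auto simp: Net_def)

lemma Net_finite: "finite (Net u)"
proof (rule finite_subset)
  let ?F = "PiE {..<u} (\<lambda>_. \<Union>v\<le>u. grid v)"
  show "finite ((\<lambda>f. \<Sum>i<u. f i *\<^sub>R e i) ` ?F)"
    by (intro finite_imageI finite_PiE) (auto simp: grid)
  show "Net u \<subseteq> (\<lambda>f. \<Sum>i<u. f i *\<^sub>R e i) ` ?F"
  proof
    fix x assume x: "x \<in> Net u"
    then have "x = (\<Sum>i<u. restrict (\<lambda>i. cf i x) {..<u} i *\<^sub>R e i)"
      by (simp add: Net_def blk_def P_def)
    moreover have "restrict (\<lambda>i. cf i x) {..<u} \<in> ?F" using x by (auto simp: Net_def)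
    ultimately show "x \<in> (\<lambda>f. \<Sum>i<u. f i *\<^sub>R e i) ` ?F" by (rule image_eqI)
  qed
qed

lemma Net_mono: "u \<le> u' \<Longrightarrow> Net u \<subseteq> Net u'"
proof
  fix x assume u: "u \<le> u'" and x: "x \<in> Net u"
  have "cf i x \<in> (\<Union>v\<le>u'. grid v)" for i
  proof (cases "i < u")
    case True
    then have "cf i x \<in> (\<Union>v\<le>u. grid v)" using x by (simp add: Net_def)
    then show ?thesis using u by fastforce
  next
    case False
    then have "cf i x = 0" using x by (auto simp: Net_def mem_blk)
    then show ?thesis using grid(2) by auto
  qed
  moreover have "x \<in> blk 0 u'" using x u blk_mono[of 0 0 u u'] by (auto simp: Net_def)
  ultimately show "x \<in> Net u'" by (simp add: Net_def)
qed

lemma Net_diff_P: "x \<in> Net u \<Longrightarrow> x - P m x \<in> Net u"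
  using grid(2) by (auto simp: Net_def mem_blk cf_P)

lemma e_in_Net: "i < u \<Longrightarrow> e i \<in> Net u"
  using grid(2,3) by (auto simp: Net_def e_in_blk)

text \<open>Zero coefficients are rounded to zero, which keeps the approximant in the same block.
  Unit vectors are enough for rounding subspaces; the growing bound \<open>real u + 1\<close> serves
  to make the union of all nets dense in the whole space.\<close>

lemma Net_dense:
  assumes "x \<in> blk l u" "norm x \<le> real u + 1"
  shows "\<exists>q\<in>Net u \<inter> blk l u. norm (x - q) \<le> eps / 6 ^ u"
proof -
  let ?t = "eps / 6 ^ u / (1 + (\<Sum>i<u. norm (e i)))"
  have ex: "\<exists>c\<in>grid u. \<bar>cf i x - c\<bar> \<le> ?t \<and> (cf i x = 0 \<longrightarrow> c = 0)" if i: "i < u" for i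
  proof (cases "cf i x = 0")
    case True then show ?thesis using grid(2) grid_step_pos less_imp_le by (intro bexI[of _ 0]) auto
  next
    case False
    have "\<bar>cf i x\<bar> * norm (e i) \<le> 2 * C * (real u + 1)"
      using norm_cf[of i x] mult_left_mono[OF assms(2), of "2 * C"] C_ge_1 by linarith
    then have "\<bar>cf i x\<bar> \<le> 2 * C * (real u + 1) / norm (e i)" by (simp add: pos_le_divide_eq)
    also have "\<dots> \<le> (\<Sum>i<u. 2 * C * (real u + 1) / norm (e i))"
      using i C_ge_1 by (intro member_le_sum) auto
    finally show ?thesis using grid(4) False by blast
  qed
  then obtain c where c: "\<And>i. i < u \<Longrightarrow> c i \<in> grid u" "\<And>i. i < u \<Longrightarrow> \<bar>cf i x - c i\<bar> \<le> ?t"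
    "\<And>i. i < u \<Longrightarrow> cf i x = 0 \<Longrightarrow> c i = 0" by metis
  define q where "q = (\<Sum>i<u. c i *\<^sub>R e i)"
  have cfq: "cf i q = (if i < u then c i else 0)" for i
    by (auto simp: q_def cf_sum sum.delta if_distrib cong: if_cong)
  have qb: "q \<in> blk l u"
    unfolding mem_blk cfq using c(3) assms(1)[unfolded mem_blk] by (metis (full_types))
  moreover have "q \<in> Net u"
    using c(1) blk_mono[of 0 l u u] qb by (auto simp: Net_def cfq)
  moreover have "norm (x - q) \<le> eps / 6 ^ u"
  proof -
    have "x = P u x" using assms(1) by (simp add: blk_def)
    then have "x - q = (\<Sum>i<u. (cf i x - c i) *\<^sub>R e i)"
      by (simp add: q_def P_def scaleR_diff_left sum_subtractf)
    also have "norm \<dots> \<le> (\<Sum>i<u. ?t * norm (e i))"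
      by (intro sum_norm_le, unfold norm_scaleR, intro mult_right_mono) (use c(2) in auto)
    also have "\<dots> = ?t * (\<Sum>i<u. norm (e i))" by (simp add: sum_distrib_left)
    also have "\<dots> \<le> ?t * (1 + (\<Sum>i<u. norm (e i)))"
      using grid_step_pos[of u] by (intro mult_left_mono) auto
    also have "\<dots> = eps / 6 ^ u"
    proof -
      have "1 + (\<Sum>i<u. norm (e i)) > 0" by (intro add_pos_nonneg sum_nonneg) auto
      then show ?thesis by simp
    qed
    finally show ?thesis .
  qed
  ultimately show ?thesis by blast
qed

definition R :: "nat \<Rightarrow> nat \<Rightarrow> 'a set set" where
  "R l u = {span Q |Q. Q \<subseteq> Net u \<inter> blk l u}"

lemma R_finite: "finite (R l u)"
proof -
  have "R l u = span ` Pow (Net u \<inter> blk l u)" by (auto simp: R_def)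
  then show ?thesis using Net_finite by simp
qed

lemma R_subspace: "G \<in> R l u \<Longrightarrow> subspace G"
  by (auto simp: R_def)

lemma R_blk: "G \<in> R l u \<Longrightarrow> G \<subseteq> blk l u"
  using span_minimal[OF _ subspace_blk] unfolding R_def by blast

lemma R_mono: "l' \<le> l \<Longrightarrow> u \<le> u' \<Longrightarrow> R l u \<subseteq> R l' u'"
  unfolding R_def using Net_mono[of u u'] blk_mono[of l' l u u'] by blast

lemma R_Un: "A \<in> R l m \<Longrightarrow> B \<in> R m u \<Longrightarrow> l \<le> m \<Longrightarrow> m \<le> u \<Longrightarrow> span (A \<union> B) \<in> R l u"
proof -
  assume "A \<in> R l m" "B \<in> R m u" and le: "l \<le> m" "m \<le> u"
  then obtain Q Q' where Q: "A = span Q" "B = span Q'" "Q \<subseteq> Net m \<inter> blk l m" "Q' \<subseteq> Net u \<inter> blk m u"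
    by (auto simp: R_def)
  have "span (A \<union> B) = span (Q \<union> Q')" unfolding Q(1,2) by (simp add: span_Un span_span)
  moreover have "Q \<union> Q' \<subseteq> Net u \<inter> blk l u"
    using Q(3,4) Net_mono[OF le(2)] blk_mono[of l l m u] blk_mono[of l m u u] le by blast
  ultimately show ?thesis unfolding R_def by blast
qed

lemma R_zero: "{0} \<in> R l u"
  unfolding R_def by (intro CollectI exI[of _ "{}"]) auto

lemma R_e: "I \<subseteq> {l..<u} \<Longrightarrow> span (e ` I) \<in> R l u"
proof -
  assume "I \<subseteq> {l..<u}"
  then have "e ` I \<subseteq> Net u \<inter> blk l u" using e_in_Net e_in_blk by (fastforce simp: subset_iff)
  then show ?thesis unfolding R_def by blast
qed

text \<open>If \<open>A\<close> is invariant under \<open>P m\<close>, then subtracting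
  \<open>P m x\<close> maps \<open>A\<close> onto \<open>A \<inter> tail m\<close>, and the nets are
  stable under this map because 0 belongs to the grids.\<close>

lemma R_tail:
  assumes "A \<in> R 0 u" "P m ` A \<subseteq> A"
  shows "A \<inter> tail m \<in> R m u"
proof -
  obtain Q where Q: "A = span Q" "Q \<subseteq> Net u \<inter> blk 0 u" using assms(1) by (auto simp: R_def)
  have lin: "linear (\<lambda>x. x - P m x)" by (intro linearI) (simp_all add: P_add P_scaleR algebra_simps)
  have "A \<inter> tail m = (\<lambda>x. x - P m x) ` A"
  proof
    show "A \<inter> tail m \<subseteq> (\<lambda>x. x - P m x) ` A" by (force simp: tail_def)
    show "(\<lambda>x. x - P m x) ` A \<subseteq> A \<inter> tail m"
      using assms(2) Q(1) by (auto simp: tail_def P_diff P_P_le intro!: span_diff)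
  qed
  also have "\<dots> = span ((\<lambda>x. x - P m x) ` Q)"
    unfolding Q(1) using linear_span_image[OF lin] by simp
  finally have "A \<inter> tail m = span ((\<lambda>x. x - P m x) ` Q)" .
  moreover have "(\<lambda>x. x - P m x) ` Q \<subseteq> Net u \<inter> blk m u"
  proof (intro image_subsetI)
    fix x assume "x \<in> Q"
    then have x: "x \<in> Net u" using Q by blast
    then have "x - P m x \<in> Net u" by (rule Net_diff_P)
    moreover from this have "x - P m x \<in> blk m u"
      using Net_blk[of u] by (auto simp: mem_blk cf_P) 
    ultimately show "x - P m x \<in> Net u \<inter> blk m u" by blast
  qed
  ultimately show ?thesis unfolding R_def by blast
qed

lemma subspace_pair_0: "subspace {(0::'a, 0::'a)}"
  using subspace_single_0[where 'a = "'a \<times> 'a"] by (simp add: zero_prod_def)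

text \<open>The error coefficient, in units of the precision, satisfies
  \<open>a (n + 1) = 3 * a n + 2\<close> with \<open>a 0 = 0\<close>: the old part may be 3 times as
  long as the vector, and the coordinate of the newly rounded unit vector is at most twice its norm.
  The solution is \<open>3 ^ n - 1\<close>.\<close>

lemma blk_rounding_codim:
  assumes "codim n {0} Y" "Y \<subseteq> blk l u"
  shows "\<exists>\<Gamma>. subspace \<Gamma> \<and> fst ` \<Gamma> = Y \<and> snd ` \<Gamma> \<in> R l u \<and>
    (\<forall>x y. (x, y) \<in> \<Gamma> \<longrightarrow> norm (y - x) \<le> eps / 6 ^ u * (3 ^ n - 1) * norm x)"
  using assms
proof (induction n "{0::'a}" Y rule: codim.induct)
  case codim_0
  then show ?case using R_zero by (intro exI[of _ "{(0, 0)}"]) (auto simp: subspace_pair_0)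
next
  case (codim_Suc n Y v)
  have "Y \<subseteq> blk l u"
    using codim_Suc.prems span_superset[of "insert v Y"] by blast
  then obtain \<Gamma> where \<Gamma>: "subspace \<Gamma>" "fst ` \<Gamma> = Y" "snd ` \<Gamma> \<in> R l u"
    and b: "\<And>x y. (x, y) \<in> \<Gamma> \<Longrightarrow> norm (y - x) \<le> eps / 6 ^ u * (3 ^ n - 1) * norm x"
    using codim_Suc.hyps by blast
  have Y: "subspace Y" "closed Y" using codim_closed[OF codim_Suc.hyps(1)] by auto
  obtain b where w: "norm b = 1" "b \<in> span (insert v Y)" "span (insert b Y) = span (insert v Y)"
    "\<And>w a. w \<in> Y \<Longrightarrow> \<bar>a\<bar> \<le> 2 * norm (w + a *\<^sub>R b)"
    using one_dim_extension_unit_vector[OF Y codim_Suc.hyps(3)] by metis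
  have "b \<in> blk l u" using w(2) codim_Suc.prems by blast
  then obtain q where q: "q \<in> Net u" "q \<in> blk l u" "norm (b - q) \<le> eps / 6 ^ u"
    using Net_dense[of b] w(1) by auto
  have "snd ` span (insert (b, q) \<Gamma>) = span (insert q (snd ` \<Gamma>))"
    "fst ` span (insert (b, q) \<Gamma>) = span (insert v Y)"
    using fst_span_insert[OF \<Gamma>(1)] \<Gamma>(2) w(3) by auto
  moreover obtain Q where "snd ` \<Gamma> = span Q" "Q \<subseteq> Net u \<inter> blk l u"
    using \<Gamma>(3) by (auto simp: R_def)
  then have "span (insert q (snd ` \<Gamma>)) \<in> R l u"
    unfolding R_def using q by (intro CollectI exI[of _ "insert q Q"]) (auto simp: span_insert_span)
  moreover have "norm (y - x) \<le> eps / 6 ^ u * (3 ^ Suc n - 1) * norm x"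
    if xy: "(x, y) \<in> span (insert (b, q) \<Gamma>)" for x y
  proof -
    obtain c p where p: "p \<in> \<Gamma>" "(x, y) = p + c *\<^sub>R (b, q)"
      using xy unfolding mem_span_insert_subspace[OF \<Gamma>(1)] by blast
    obtain w1 w2 where ww: "(w1, w2) \<in> \<Gamma>" and x: "x = w1 + c *\<^sub>R b" and y: "y = w2 + c *\<^sub>R q"
      using p by (cases p) auto
    have w1: "w1 \<in> Y" using ww \<Gamma>(2) by force
    have c: "\<bar>c\<bar> \<le> 2 * norm x" using w(4)[OF w1, of c] by (simp add: x)
    have n: "norm w1 \<le> 3 * norm x" using norm_le_of_coordinate[OF w(1) w(4)[OF w1]] by (simp add: x)
    have "y - x = (w2 - w1) + c *\<^sub>R (q - b)" by (simp add: x y algebra_simps)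
    then have "norm (y - x) \<le> norm (w2 - w1) + \<bar>c\<bar> * norm (b - q)"
      using norm_triangle_ineq[of "w2 - w1" "c *\<^sub>R (q - b)"] by (simp add: norm_minus_commute)
    also have "\<dots> \<le> eps / 6 ^ u * (3 ^ n - 1) * (3 * norm x) + 2 * norm x * (eps / 6 ^ u)"
    proof (intro add_mono mult_mono)
      have "0 \<le> eps / 6 ^ u * (3 ^ n - 1 :: real)" using eps_pos by simp
      then show "norm (w2 - w1) \<le> eps / 6 ^ u * (3 ^ n - 1) * (3 * norm x)"
        using b[OF ww] mult_left_mono[OF n] by (meson order_trans)
    qed (use c q eps_pos in auto)
    also have "\<dots> = eps / 6 ^ u * (3 ^ Suc n - 1) * norm x" by (simp add: field_simps)
    finally show ?thesis .
  qed
  ultimately show ?case by (intro exI[of _ "span (insert (b, q) \<Gamma>)"]) auto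
qed

text \<open>The error is stated as a difference so that it telescopes over consecutive intervals.
  For \<open>l < u\<close> this difference is at least \<open>1 / 2 ^ u\<close>; an empty interval
  carries only the zero space.\<close>

lemma blk_rounding:
  assumes "subspace Y" "Y \<subseteq> blk l u" "l \<le> u"
  shows "\<exists>\<Gamma>. subspace \<Gamma> \<and> fst ` \<Gamma> = Y \<and> snd ` \<Gamma> \<in> R l u \<and>
    (\<forall>x y. (x, y) \<in> \<Gamma> \<longrightarrow> norm (y - x) \<le> eps * (1 / 2 ^ l - 1 / 2 ^ u) * norm x)"
proof (cases "l = u")
  case True
  then have "Y = {0}" using assms(1,2) subspace_0[OF assms(1)] by (fastforce simp: blk_def)
  then show ?thesis using R_zero by (intro exI[of _ "{(0, 0)}"]) (auto simp: subspace_pair_0)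
next
  case False
  then have l: "Suc l \<le> u" using assms(3) by simp
  have "Y \<subseteq> blk 0 u" using assms(2) blk_mono[of 0 l u u] by auto
  then obtain n where n: "n \<le> u" "codim n {0} Y" using codim_zero_blk[OF assms(1)] by blast
  have "eps / 6 ^ u * (3 ^ n - 1) \<le> eps / 6 ^ u * (3 ^ u)"
  proof (intro mult_left_mono)
    show "3 ^ n - 1 \<le> (3::real) ^ u" using power_increasing[OF n(1), of "3::real"] by linarith
  qed (use eps_pos in auto)
  also have "\<dots> = eps * (1 / 2 ^ u)"
  proof -
    have "(6::real) ^ u = 2 ^ u * 3 ^ u" by (simp flip: power_mult_distrib)
    then show ?thesis by (simp add: field_simps)
  qed
  also have "\<dots> \<le> eps * (1 / 2 ^ l - 1 / 2 ^ u)"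
  proof (intro mult_left_mono)
    have "(2::real) ^ Suc l \<le> 2 ^ u" using l by (intro power_increasing) auto
    then have "2 * (1 / (2::real) ^ u) \<le> 1 / 2 ^ l" by (simp add: field_simps)
    then show "1 / (2::real) ^ u \<le> 1 / 2 ^ l - 1 / 2 ^ u" by simp
  qed (use eps_pos in auto)
  finally have le: "eps / 6 ^ u * (3 ^ n - 1) * norm x \<le> eps * (1 / 2 ^ l - 1 / 2 ^ u) * norm x" for x :: 'a
    by (intro mult_right_mono) auto
  obtain \<Gamma> where \<Gamma>: "subspace \<Gamma>" "fst ` \<Gamma> = Y" "snd ` \<Gamma> \<in> R l u"
    "\<And>x y. (x, y) \<in> \<Gamma> \<Longrightarrow> norm (y - x) \<le> eps / 6 ^ u * (3 ^ n - 1) * norm x"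
    using blk_rounding_codim[OF n(2) assms(2)] by blast
  then show ?thesis using order_trans[OF \<Gamma>(4) le] by blast
qed

section \<open>Block sequences, their algebraic sums and blockwise perturbation\<close>

definition c00 :: "'a set" where "c00 = {x. \<exists>n. P n x = x}"

lemma c00_P: "P n x = x \<Longrightarrow> n \<le> m \<Longrightarrow> P m x = x"
  by (metis P_P_le(2))

lemma subspace_c00: "subspace c00"
proof (rule subspaceI)
  fix x y assume "x \<in> c00" "y \<in> c00"
  then obtain n m where "P n x = x" "P m y = y" by (auto simp: c00_def)
  then have "P (max n m) (x + y) = x + y" by (simp add: P_add c00_P[of n x] c00_P[of m y])
  then show "x + y \<in> c00" unfolding c00_def by blast
qed (auto simp: c00_def P_scaleR)

lemma blk_subset_c00: "blk l u \<subseteq> c00"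
  by (auto simp: blk_def c00_def)

lemma mem_blk_0: "x \<in> blk 0 m \<longleftrightarrow> P m x = x"
  by (simp add: blk_def)

text \<open>Cut points are merely monotone: an empty interval carries the block \<open>{0}\<close>,
  so cut points can later be raised to a common lower bound without reindexing.\<close>

definition block_seq :: "(nat \<Rightarrow> nat) \<Rightarrow> (nat \<Rightarrow> 'a set) \<Rightarrow> bool" where
  "block_seq j G \<longleftrightarrow> mono j \<and> (\<forall>k. subspace (G k) \<and> G k \<subseteq> blk (j k) (j (Suc k)))"

definition bsum :: "(nat \<Rightarrow> 'a set) \<Rightarrow> 'a set" where "bsum G = span (\<Union>k. G k)"

definition bhead :: "nat \<Rightarrow> (nat \<Rightarrow> 'a set) \<Rightarrow> 'a set" where "bhead n G = span (\<Union>k<n. G k)"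

lemma subspace_bsum: "subspace (bsum G)" and subspace_bhead: "subspace (bhead n G)"
  by (simp_all add: bsum_def bhead_def)

lemma bhead_subset_bsum: "bhead n G \<subseteq> bsum G"
  unfolding bhead_def bsum_def by (intro span_mono) auto

lemma bhead_Suc: "bhead (Suc n) G = span (bhead n G \<union> G n)"
  unfolding bhead_def lessThan_Suc UN_insert by (simp add: span_Un span_span Un_commute)

lemma bhead_0 [simp]: "bhead 0 G = {0}"
  by (simp add: bhead_def)

lemma block_seqD:
  assumes "block_seq j G"
  shows "m \<le> n \<Longrightarrow> j m \<le> j n" "subspace (G k)" "G k \<subseteq> blk (j k) (j (Suc k))"
  using assms unfolding block_seq_def by (auto dest: monoD)

lemma block_P:
  assumes "block_seq j G" "x \<in> G i"
  shows "P (j k) x = (if i < k then x else 0)"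
proof -
  have x: "P (j i) x = 0" "P (j (Suc i)) x = x"
    using assms block_seqD(3)[OF assms(1), of i] by (auto simp: blk_def)
  show ?thesis
  proof (cases "i < k")
    case True
    then show ?thesis using c00_P[OF x(2)] block_seqD(1)[OF assms(1), of "Suc i" k] by simp
  next
    case False
    then have "P (j k) x = P (j k) (P (j i) x)"
      using block_seqD(1)[OF assms(1), of k i] by (simp add: P_P_le)
    then show ?thesis using False x by simp
  qed
qed

lemma subspace_vimage_P: "subspace S \<Longrightarrow> subspace {x. P n x \<in> S}"
  by (auto intro!: subspaceI simp: P_add P_scaleR subspace_add subspace_scale subspace_0)

lemma bhead_blk: "block_seq j G \<Longrightarrow> bhead n G \<subseteq> blk 0 (j n)"
  unfolding bhead_def using block_P
  by (intro span_minimal subspace_blk) (auto simp: mem_blk_0)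

lemma P_bsum:
  assumes "block_seq j G"
  shows "P (j n) ` bsum G = bhead n G"
proof
  have "bsum G \<subseteq> {x. P (j n) x \<in> bhead n G}"
    unfolding bsum_def
  proof (rule span_minimal)
    show "(\<Union>k. G k) \<subseteq> {x. P (j n) x \<in> bhead n G}"
    proof
      fix x assume "x \<in> (\<Union>k. G k)"
      then obtain k where k: "x \<in> G k" by blast
      then have "k < n \<Longrightarrow> x \<in> bhead n G" unfolding bhead_def by (intro span_base) blast
      then show "x \<in> {x. P (j n) x \<in> bhead n G}"
        using block_P[OF assms k, of n] subspace_0[OF subspace_bhead, of n G] by simp
    qed
  qed (intro subspace_vimage_P subspace_bhead)
  then show "P (j n) ` bsum G \<subseteq> bhead n G" by blast
  show "bhead n G \<subseteq> P (j n) ` bsum G"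
  proof
    fix x assume x: "x \<in> bhead n G"
    then have "P (j n) x = x" using bhead_blk[OF assms, of n] mem_blk_0 by blast
    then have "x = P (j n) x" by simp
    then show "x \<in> P (j n) ` bsum G" using x bhead_subset_bsum by blast
  qed
qed

lemma bsum_splits: "block_seq j G \<Longrightarrow> P (j n) ` bsum G \<subseteq> bsum G"
  using P_bsum bhead_subset_bsum by blast

lemma bsum_c00: "block_seq j G \<Longrightarrow> bsum G \<subseteq> c00"
  unfolding bsum_def using block_seqD(3) blk_subset_c00
  by (intro span_minimal subspace_c00) blast

lemma bsum_blk:
  assumes "block_seq j G"
  shows "bsum G \<inter> blk (j n) (j (Suc n)) = G n"
proof
  have "bsum G \<subseteq> {x. P (j (Suc n)) x - P (j n) x \<in> G n}"
    unfolding bsum_def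
  proof (rule span_minimal)
    show "(\<Union>k. G k) \<subseteq> {x. P (j (Suc n)) x - P (j n) x \<in> G n}"
      using block_P[OF assms] subspace_0[OF block_seqD(2)[OF assms]]
      by (auto simp: less_Suc_eq)
    show "subspace {x. P (j (Suc n)) x - P (j n) x \<in> G n}"
      using subspace_0[OF block_seqD(2)[OF assms]]
        subspace_add[OF block_seqD(2)[OF assms]] subspace_scale[OF block_seqD(2)[OF assms]]
      by (auto intro!: subspaceI simp: P_add P_scaleR add_diff_add simp flip: scaleR_diff_right)
  qed
  then show "bsum G \<inter> blk (j n) (j (Suc n)) \<subseteq> G n" by (fastforce simp: blk_def)
  show "G n \<subseteq> bsum G \<inter> blk (j n) (j (Suc n))"
    using block_seqD(3)[OF assms] by (auto simp: bsum_def intro: span_base)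
qed

lemma bhead_R:
  assumes "block_seq j G" "\<And>k. G k \<in> R (j k) (j (Suc k))"
  shows "bhead n G \<in> R 0 (j n)"
proof (induction n)
  case 0 then show ?case using R_zero by simp
next
  case (Suc n)
  then show ?case
    unfolding bhead_Suc using assms(2)[of n] block_seqD(1)[OF assms(1), of n "Suc n"]
    by (intro R_Un) auto
qed

lemma bsum_of_splits:
  assumes "subspace Y" "Y \<subseteq> c00" "mono j" "j 0 = 0" "\<And>n. \<exists>k. n \<le> j k" "\<And>k. P (j k) ` Y \<subseteq> Y"
  shows "bsum (\<lambda>k. Y \<inter> blk (j k) (j (Suc k))) = Y"
proof
  show "bsum (\<lambda>k. Y \<inter> blk (j k) (j (Suc k))) \<subseteq> Y"
    unfolding bsum_def using assms(1) by (intro span_minimal) auto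
  show "Y \<subseteq> bsum (\<lambda>k. Y \<inter> blk (j k) (j (Suc k)))"
  proof
    fix x assume x: "x \<in> Y"
    then obtain m where m: "P m x = x" using assms(2) by (auto simp: c00_def)
    obtain k where "m \<le> j k" using assms(5) by blast
    then have "x = P (j k) x" using c00_P[OF m] by simp
    also have "\<dots> = (\<Sum>i<k. P (j (Suc i)) x - P (j i) x)"
      using sum_lessThan_telescope[of "\<lambda>i. P (j i) x" k] assms(4) by simp
    also have "\<dots> \<in> bsum (\<lambda>k. Y \<inter> blk (j k) (j (Suc k)))"
      unfolding bsum_def
    proof (rule span_sum, rule span_base)
      fix i
      have "P (j (Suc i)) x - P (j i) x \<in> Y"
        using assms(6)[of i] assms(6)[of "Suc i"] x by (intro subspace_diff[OF assms(1)]) auto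
      moreover have "P (j (Suc i)) x - P (j i) x \<in> blk (j i) (j (Suc i))"
        using assms(3) by (intro P_in_blk) (simp add: monoD)
      ultimately show "P (j (Suc i)) x - P (j i) x \<in> (\<Union>k. Y \<inter> blk (j k) (j (Suc k)))" by blast
    qed
    finally show "x \<in> bsum (\<lambda>k. Y \<inter> blk (j k) (j (Suc k)))" .
  qed
qed

text \<open>A small perturbation argument: projecting a pair of the summed graph to an interval
  gives a pair of \<open>\<Gamma> k\<close> again (\<open>pieces\<close>), so blockwise errors add
  up to at most half the norm of \<open>x\<close>, however many blocks are involved. This gives the
  constant 2.\<close>

lemma kiso_blockwise:
  assumes j: "mono j" "j 0 = 0" "\<And>n. \<exists>k. n \<le> j k"
    and \<Gamma>: "\<And>k. subspace (\<Gamma> k)" "\<And>k. fst ` \<Gamma> k \<subseteq> blk (j k) (j (Suc k))"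
      "\<And>k. snd ` \<Gamma> k \<subseteq> blk (j k) (j (Suc k))"
    and close: "\<And>k x y. (x, y) \<in> \<Gamma> k \<Longrightarrow> norm (y - x) \<le> eps * (1 / 2 ^ j k - 1 / 2 ^ j (Suc k)) * norm x"
  shows "kiso 2 (bsum (\<lambda>k. fst ` \<Gamma> k)) (bsum (\<lambda>k. snd ` \<Gamma> k))"
proof -
  have lin: "linear (fst :: 'a \<times> 'a \<Rightarrow> 'a)" "linear (snd :: 'a \<times> 'a \<Rightarrow> 'a)"
    by (auto intro!: linearI)
  have bs: "block_seq j (\<lambda>k. fst ` \<Gamma> k)" "block_seq j (\<lambda>k. snd ` \<Gamma> k)"
    using j(1) \<Gamma> lin by (auto simp: block_seq_def intro: linear_subspace_image)
  define \<Delta> where "\<Delta> = span (\<Union>k. \<Gamma> k)"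
  have fs: "fst ` \<Delta> = bsum (\<lambda>k. fst ` \<Gamma> k)" "snd ` \<Delta> = bsum (\<lambda>k. snd ` \<Gamma> k)"
    unfolding \<Delta>_def bsum_def image_UN[symmetric]
    by (simp_all only: linear_span_image[OF lin(1)] linear_span_image[OF lin(2)])
  have pieces: "\<Delta> \<subseteq> {p. \<forall>k. (P (j (Suc k)) (fst p) - P (j k) (fst p), P (j (Suc k)) (snd p) - P (j k) (snd p)) \<in> \<Gamma> k}"
    (is "_ \<subseteq> ?S")
    unfolding \<Delta>_def
  proof (rule span_minimal)
    show "(\<Union>k. \<Gamma> k) \<subseteq> ?S"
    proof
      fix p assume "p \<in> (\<Union>k. \<Gamma> k)"
      then obtain i where i: "p \<in> \<Gamma> i" by blast
      have "(P (j (Suc k)) (fst p) - P (j k) (fst p), P (j (Suc k)) (snd p) - P (j k) (snd p)) = (if k = i then p else 0)" for k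
        using block_P[OF bs(1), of "fst p" i] block_P[OF bs(2), of "snd p" i] i
        by (auto simp: less_Suc_eq zero_prod_def)
      then show "p \<in> ?S" using i subspace_0[OF \<Gamma>(1)] by simp
    qed
    show "subspace ?S"
    proof (rule subspaceI)
      show "0 \<in> ?S" using subspace_0[OF \<Gamma>(1)] by (simp add: zero_prod_def)
    next
      fix p q assume "p \<in> ?S" "q \<in> ?S"
      then show "p + q \<in> ?S"
        using subspace_add[OF \<Gamma>(1)] by (fastforce simp: P_add add_diff_add)
    next
      fix c p assume "p \<in> ?S"
      then show "c *\<^sub>R p \<in> ?S"
        using subspace_scale[OF \<Gamma>(1), of _ _ c] by (fastforce simp: P_scaleR simp flip: scaleR_diff_right)
    qed
  qed
  have near: "norm (y - x) \<le> norm x / 2" if xy: "(x, y) \<in> \<Delta>" for x y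
  proof -
    have "x \<in> c00" "y \<in> c00"
      using xy fs bsum_c00[OF bs(1)] bsum_c00[OF bs(2)] by (metis fst_conv imageI subsetD, metis snd_conv imageI subsetD)
    then obtain m m' where "P m x = x" "P m' y = y" by (auto simp: c00_def)
    moreover obtain n where "max m m' \<le> j n" using j(3) by blast
    ultimately have n: "x = P (j n) x" "y = P (j n) y" by (simp_all add: c00_P[of m x] c00_P[of m' y])
    let ?x = "\<lambda>k. P (j (Suc k)) x - P (j k) x" and ?y = "\<lambda>k. P (j (Suc k)) y - P (j k) y"
    let ?d = "\<lambda>k. 1 / 2 ^ j k - 1 / 2 ^ j (Suc k) :: real"
    have d0: "?d k \<ge> 0" for k
      using j(1) by (simp add: monoD frac_le power_increasing)
    have "y - x = (\<Sum>k<n. ?y k - ?x k)"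
      unfolding sum_subtractf[of ?y] sum_lessThan_telescope[of "\<lambda>k. P (j k) y"] sum_lessThan_telescope[of "\<lambda>k. P (j k) x"]
      using n j(2) by simp
    then have "norm (y - x) \<le> (\<Sum>k<n. norm (?y k - ?x k))" by (simp only: norm_sum)
    also have "\<dots> \<le> (\<Sum>k<n. eps * ?d k * (2 * C * norm x))"
    proof (rule sum_mono)
      fix k
      have "(?x k, ?y k) \<in> \<Gamma> k" using pieces xy by force
      then have "norm (?y k - ?x k) \<le> eps * ?d k * norm (?x k)" by (rule close)
      also have "\<dots> \<le> eps * ?d k * (2 * C * norm x)"
        using d0 eps_pos norm_P_diff by (intro mult_left_mono) auto
      finally show "norm (?y k - ?x k) \<le> eps * ?d k * (2 * C * norm x)" .
    qed
    also have "\<dots> = eps * (2 * C * norm x) * (\<Sum>k<n. ?d k)"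
      by (simp add: sum_distrib_left mult_ac)
    also have "(\<Sum>k<n. ?d k) = 1 - 1 / 2 ^ j n"
      using sum_lessThan_telescope'[of "\<lambda>k. 1 / 2 ^ j k :: real" n] j(2) by simp
    also have "eps * (2 * C * norm x) * (1 - 1 / 2 ^ j n) \<le> eps * (2 * C * norm x) * 1"
      using eps_pos C_ge_1 by (intro mult_left_mono) auto
    also have "\<dots> = norm x / 2" using C_ge_1 by (simp add: eps_def)
    finally show ?thesis .
  qed
  have "norm y \<le> 2 * norm x \<and> norm x \<le> 2 * norm y" if "(x, y) \<in> \<Delta>" for x y
    using near[OF that] norm_triangle_ineq2[of y x] norm_triangle_ineq2[of x y]
    by (simp add: norm_minus_commute)
  then have "iso_graph 2 \<Delta>" by (simp add: iso_graph_def \<Delta>_def)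
  then show ?thesis unfolding kiso_def using fs by blast
qed

text \<open>Blocks already spanned by net vectors are left exactly as they are. This is essential,
  since rounding must destroy neither the prescribed head nor the blocks \<open>F n\<close>.\<close>

lemma rounding:
  assumes Y: "subspace Y" "Y \<subseteq> c00" and j: "mono j" "j 0 = 0" "\<And>n. \<exists>k. n \<le> j k"
    and splits: "\<And>k. P (j k) ` Y \<subseteq> Y"
  obtains G where "\<And>k. G k \<in> R (j k) (j (Suc k))" "block_seq j G"
    "\<And>k. Y \<inter> blk (j k) (j (Suc k)) \<in> R (j k) (j (Suc k)) \<Longrightarrow> G k = Y \<inter> blk (j k) (j (Suc k))"
    "kiso 2 (closure Y) (closure (bsum G))"
proof -
  let ?Y = "\<lambda>k. Y \<inter> blk (j k) (j (Suc k))"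
  have "\<exists>\<Gamma>. subspace \<Gamma> \<and> fst ` \<Gamma> = ?Y k \<and> snd ` \<Gamma> \<in> R (j k) (j (Suc k)) \<and>
    (\<forall>x y. (x, y) \<in> \<Gamma> \<longrightarrow> norm (y - x) \<le> eps * (1 / 2 ^ j k - 1 / 2 ^ j (Suc k)) * norm x) \<and>
    (?Y k \<in> R (j k) (j (Suc k)) \<longrightarrow> snd ` \<Gamma> = ?Y k)" for k
  proof (cases "?Y k \<in> R (j k) (j (Suc k))")
    case True
    have "subspace ((\<lambda>x. (x, x)) ` ?Y k)"
      using Y(1) by (intro linear_subspace_image subspace_inter subspace_blk) (auto intro!: linearI)
    moreover have "0 \<le> eps * (1 / 2 ^ j k - 1 / 2 ^ j (Suc k))"
      using j(1) eps_pos by (simp add: monoD frac_le power_increasing)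
    ultimately show ?thesis
      using True by (intro exI[of _ "(\<lambda>x. (x, x)) ` ?Y k"]) (auto simp: image_image)
  next
    case False
    then show ?thesis
      using blk_rounding[of "?Y k" "j k" "j (Suc k)"] Y(1) subspace_inter[OF Y(1) subspace_blk] monoD[OF j(1)]
      by auto
  qed
  then obtain \<Gamma> where \<Gamma>: "\<And>k. subspace (\<Gamma> k)" "\<And>k. fst ` \<Gamma> k = ?Y k" "\<And>k. snd ` \<Gamma> k \<in> R (j k) (j (Suc k))"
    "\<And>k x y. (x, y) \<in> \<Gamma> k \<Longrightarrow> norm (y - x) \<le> eps * (1 / 2 ^ j k - 1 / 2 ^ j (Suc k)) * norm x"
    "\<And>k. ?Y k \<in> R (j k) (j (Suc k)) \<Longrightarrow> snd ` \<Gamma> k = ?Y k"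
    by metis
  show thesis
  proof
    show "block_seq j (\<lambda>k. snd ` \<Gamma> k)"
      using j(1) R_subspace[OF \<Gamma>(3)] R_blk[OF \<Gamma>(3)] by (simp add: block_seq_def)
    have "kiso 2 (bsum (\<lambda>k. fst ` \<Gamma> k)) (bsum (\<lambda>k. snd ` \<Gamma> k))"
      using \<Gamma>(2,4) R_blk[OF \<Gamma>(3)] by (intro kiso_blockwise[OF j \<Gamma>(1)]) auto
    then show "kiso 2 (closure Y) (closure (bsum (\<lambda>k. snd ` \<Gamma> k)))"
      unfolding \<Gamma>(2) bsum_of_splits[OF Y j splits] by (rule kiso_closure)
  qed (use \<Gamma> in auto)
qed

section \<open>Pairs of block subspaces\<close>

definition splits :: "nat \<Rightarrow> 'a set \<Rightarrow> 'a set \<Rightarrow> bool" where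
  "splits m S A \<longleftrightarrow> P m ` S = A \<and> A \<subseteq> S"

lemma splits_refl: "A \<subseteq> blk 0 m \<Longrightarrow> splits m A A"
  unfolding splits_def mem_blk_0[symmetric] by (auto simp: blk_def image_iff subset_iff)

lemma splits_trans: "splits m' S A' \<Longrightarrow> splits m A' A \<Longrightarrow> m \<le> m' \<Longrightarrow> splits m S A"
  unfolding splits_def by (auto simp: image_image P_P_le)

lemma splits_common:
  assumes "splits m S A" "splits m' S A'" "m \<le> m'"
  shows "splits m A' A"
  unfolding splits_def
proof
  show "P m ` A' = A" using assms unfolding splits_def by (auto simp: image_image P_P_le)
  show "A \<subseteq> A'"
  proof
    fix a assume a: "a \<in> A"
    then have "P m' a = a" using assms by (auto simp: splits_def P_P_le)
    moreover have "a \<in> S" using a assms by (auto simp: splits_def)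
    ultimately show "a \<in> A'" using assms(2) unfolding splits_def by (metis imageI)
  qed
qed

text \<open>A decomposition is represented by the algebraic span \<open>S\<close> of its pieces; \<open>splits m S A\<close> says that
  \<open>S\<close> is the direct sum of \<open>A = S \<inter> blk 0 m\<close> and \<open>S \<inter> tail m\<close>. A condition fixes the two heads at a common
  splitting point, and only heads from the finite sets \<open>R 0 m\<close> are allowed.\<close>

definition pts :: "('a set \<times> 'a set) set" where
  "pts = {(S, S'). subspace S \<and> subspace S' \<and> S \<subseteq> c00 \<and> S' \<subseteq> c00 \<and>
     (\<forall>n. \<exists>m\<ge>n. \<exists>A\<in>R 0 m. \<exists>B\<in>R 0 m. splits m S A \<and> splits m S' B)}"

definition Cond :: "(nat \<times> 'a set \<times> 'a set) set" where
  "Cond = (SIGMA m:UNIV. R 0 m \<times> R 0 m)"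

definition nb :: "nat \<times> 'a set \<times> 'a set \<Rightarrow> ('a set \<times> 'a set) set" where
  "nb p = {(S, S') \<in> pts. splits (fst p) S (fst (snd p)) \<and> splits (fst p) S' (snd (snd p))}"

definition cle :: "nat \<times> 'a set \<times> 'a set \<Rightarrow> nat \<times> 'a set \<times> 'a set \<Rightarrow> bool" where
  "cle q p \<longleftrightarrow> fst p \<le> fst q \<and> splits (fst p) (fst (snd q)) (fst (snd p)) \<and>
     splits (fst p) (snd (snd q)) (snd (snd p))"

sublocale conditions Cond cle nb
proof
  show "countable Cond"
    unfolding Cond_def by (intro countable_SIGMA) (auto simp: R_finite countable_finite)
  show "cle p p" if "p \<in> Cond" for p
    using that R_blk splits_refl by (auto simp: Cond_def cle_def)
  show "cle r p" if "cle r q" "cle q p" for p q r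
    using that splits_trans unfolding cle_def by (meson order_trans)
  show "nb q \<subseteq> nb p" if "cle q p" for p q
    using that splits_trans unfolding cle_def nb_def by blast
  show "\<exists>r\<in>Cond. cle r p \<and> cle r q \<and> x \<in> nb r"
    if pq: "p \<in> Cond" "q \<in> Cond" "x \<in> nb p" "x \<in> nb q" for p q x
  proof -
    obtain S S' where x: "x = (S, S')" by (cases x)
    have refl: "cle p p" "cle q q"
      using pq R_blk splits_refl by (auto simp: Cond_def cle_def)
    \<comment> \<open>Two conditions satisfied by the same pair record heads of the same two spaces,
      so the longer extends the shorter and is itself the common extension.\<close>
    show ?thesis
    proof (cases "fst p \<le> fst q")
      case True
      then have "cle q p" using pq splits_common unfolding cle_def nb_def x by blast
      then show ?thesis using refl pq by blast
    next
      case False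
      then have "fst q \<le> fst p" by simp
      then have "cle p q" using pq splits_common unfolding cle_def nb_def x by blast
      then show ?thesis using refl pq by blast
    qed
  qed
qed

section \<open>Isomorphism with fixed constant as the projection of a closed set\<close>

definition iso_pairs :: "real \<Rightarrow> ('a set \<times> 'a set) set" where
  "iso_pairs K = {(S, S') \<in> pts. kiso K (closure S) (closure S')}"

definition QQ :: "'a set" where "QQ = (\<Union>u. Net u)"

lemma QQ_dense:
  assumes "\<epsilon> > 0" shows "\<exists>q\<in>QQ. norm (x - q) < \<epsilon>"
proof -
  have e2: "\<epsilon> / 2 > 0" using assms by simp
  have "(\<lambda>u. eps * (1 / 6) ^ u) \<longlonglongrightarrow> eps * 0"
    by (intro tendsto_mult tendsto_const LIMSEQ_power_zero) auto
  then have "\<forall>\<^sub>F u in sequentially. eps * (1 / 6) ^ u < \<epsilon> / 2"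
    using e2 order_tendstoD(2) by fastforce
  moreover have "\<forall>\<^sub>F u in sequentially. norm (P u x - x) < \<epsilon> / 2"
    using tendstoD[OF P_tendsto e2] by (simp add: dist_norm)
  moreover have "\<forall>\<^sub>F u in sequentially. C * norm x \<le> real u"
    using eventually_ge_at_top[of "nat \<lceil>C * norm x\<rceil>"] by eventually_elim linarith
  ultimately have "\<forall>\<^sub>F u in sequentially. eps * (1 / 6) ^ u < \<epsilon> / 2 \<and> norm (P u x - x) < \<epsilon> / 2 \<and> C * norm x \<le> real u"
    by (intro eventually_conj)
  then obtain u where u: "eps * (1 / 6) ^ u < \<epsilon> / 2" "norm (P u x - x) < \<epsilon> / 2" "C * norm x \<le> real u"
    by (auto simp: eventually_sequentially)
  have "norm (P u x) \<le> real u + 1" using norm_P[of u x] u(3) by linarith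
  moreover have "P u x \<in> blk 0 u" by (simp add: blk_def P_P_le)
  ultimately obtain q where q: "q \<in> Net u" "norm (P u x - q) \<le> eps / 6 ^ u"
    using Net_dense by blast
  have "norm (x - q) \<le> norm (P u x - x) + norm (P u x - q)"
    using norm_triangle_ineq4[of "P u x - q" "P u x - x"] by simp
  also have "\<dots> < \<epsilon>"
  proof -
    have "eps / 6 ^ u < \<epsilon> / 2" using u(1) by (simp add: power_one_over)
    then show ?thesis using u(2) q(2) by linarith
  qed
  finally show ?thesis using q(1) by (auto simp: QQ_def)
qed

lemma countable_QQ: "countable QQ"
  unfolding QQ_def by (auto intro: countable_finite Net_finite)

text \<open>Every vector of \<open>S\<close> lies in some head, and heads in \<open>R 0 m\<close>
  are generated by net vectors; so countably many vectors determine \<open>S\<close>.\<close>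

lemma span_QQ:
  assumes "subspace S" "S \<subseteq> c00" "\<And>n. \<exists>m\<ge>n. \<exists>A\<in>R 0 m. splits m S A"
  shows "S = span (S \<inter> QQ)"
proof
  show "span (S \<inter> QQ) \<subseteq> S" using assms(1) by (intro span_minimal) auto
  show "S \<subseteq> span (S \<inter> QQ)"
  proof
    fix x assume x: "x \<in> S"
    then obtain n where n: "P n x = x" using assms(2) by (auto simp: c00_def)
    obtain m A where m: "m \<ge> n" "A \<in> R 0 m" "splits m S A" using assms(3) by blast
    obtain Q where Q: "A = span Q" "Q \<subseteq> Net m" using m(2) by (auto simp: R_def)
    have "x = P m x" using c00_P[OF n m(1)] by simp
    then have "x \<in> A" using x m(3) unfolding splits_def by blast
    moreover have "Q \<subseteq> S \<inter> QQ"
      using Q span_superset[of Q] m(3) by (auto simp: splits_def QQ_def)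
    ultimately show "x \<in> span (S \<inter> QQ)" using Q(1) span_mono by blast
  qed
qed

text \<open>The Kuratowski lower limit of a sequence of graphs.\<close>

definition lim_graph :: "(nat \<Rightarrow> ('a \<times> 'a) set) \<Rightarrow> ('a \<times> 'a) set" where
  "lim_graph \<Gamma> = {(x, y). \<exists>u v. (\<forall>n. (u n, v n) \<in> \<Gamma> n) \<and> u \<longlonglongrightarrow> x \<and> v \<longlonglongrightarrow> y}"

lemma lim_graphE:
  assumes "p \<in> lim_graph \<Gamma>"
  obtains u v where "\<And>n. (u n, v n) \<in> \<Gamma> n" "u \<longlonglongrightarrow> fst p" "v \<longlonglongrightarrow> snd p"
  using assms unfolding lim_graph_def by force

lemma lim_graphI:
  "(\<And>n. (u n, v n) \<in> \<Gamma> n) \<Longrightarrow> u \<longlonglongrightarrow> x \<Longrightarrow> v \<longlonglongrightarrow> y \<Longrightarrow> (x, y) \<in> lim_graph \<Gamma>"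
  unfolding lim_graph_def by blast

lemma iso_graph_lim_graph:
  assumes "\<And>n. iso_graph K (\<Gamma> n)"
  shows "iso_graph K (lim_graph \<Gamma>)"
  unfolding iso_graph_def
proof (intro conjI allI impI)
  note sub = iso_graphD(1)[OF assms]
  show "subspace (lim_graph \<Gamma>)"
  proof (rule subspaceI)
    show "0 \<in> lim_graph \<Gamma>"
      using subspace_0[OF sub] unfolding lim_graph_def zero_prod_def
      by (auto intro!: exI[of _ "\<lambda>_. 0"])
  next
    fix p q assume "p \<in> lim_graph \<Gamma>" "q \<in> lim_graph \<Gamma>"
    obtain u v where uv: "\<And>n. (u n, v n) \<in> \<Gamma> n" "u \<longlonglongrightarrow> fst p" "v \<longlonglongrightarrow> snd p"
      using lim_graphE[OF \<open>p \<in> lim_graph \<Gamma>\<close>] by blast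
    obtain u' v' where uv': "\<And>n. (u' n, v' n) \<in> \<Gamma> n" "u' \<longlonglongrightarrow> fst q" "v' \<longlonglongrightarrow> snd q"
      using lim_graphE[OF \<open>q \<in> lim_graph \<Gamma>\<close>] by blast
    have "(u n + u' n, v n + v' n) \<in> \<Gamma> n" for n
      using subspace_add[OF sub, of "(u n, v n)" n "(u' n, v' n)"] uv(1) uv'(1) by simp
    then have "(fst p + fst q, snd p + snd q) \<in> lim_graph \<Gamma>"
      by (rule lim_graphI) (intro tendsto_add uv uv')+
    then show "p + q \<in> lim_graph \<Gamma>" by (simp add: plus_prod_def)
  next
    fix c p assume "p \<in> lim_graph \<Gamma>"
    obtain u v where uv: "\<And>n. (u n, v n) \<in> \<Gamma> n" "u \<longlonglongrightarrow> fst p" "v \<longlonglongrightarrow> snd p"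
      using lim_graphE[OF \<open>p \<in> lim_graph \<Gamma>\<close>] by blast
    have "(c *\<^sub>R u n, c *\<^sub>R v n) \<in> \<Gamma> n" for n
      using subspace_scale[OF sub, of "(u n, v n)" n c] uv(1) by simp
    then have "(c *\<^sub>R fst p, c *\<^sub>R snd p) \<in> lim_graph \<Gamma>"
      by (rule lim_graphI) (intro tendsto_intros uv)+
    then show "c *\<^sub>R p \<in> lim_graph \<Gamma>" by (simp add: scaleR_prod_def)
  qed
  fix x y assume "(x, y) \<in> lim_graph \<Gamma>"
  then obtain u v where uv: "\<And>n. (u n, v n) \<in> \<Gamma> n" "u \<longlonglongrightarrow> x" "v \<longlonglongrightarrow> y"
    by (elim lim_graphE) auto
  have "(\<lambda>n. norm (u n)) \<longlonglongrightarrow> norm x" "(\<lambda>n. norm (v n)) \<longlonglongrightarrow> norm y"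
    "(\<lambda>n. K * norm (u n)) \<longlonglongrightarrow> K * norm x" "(\<lambda>n. K * norm (v n)) \<longlonglongrightarrow> K * norm y"
    using uv(2,3) by (auto intro!: tendsto_intros)
  then show "norm y \<le> K * norm x" "norm x \<le> K * norm y"
    using iso_graphD(2,3)[OF assms uv(1)] by (auto intro: LIMSEQ_le)
qed

text \<open>The hypothesis \<open>approx\<close> puts the images of a net vector, for each
  \<open>k\<close>, eventually within \<open>1 / (real k + 1)\<close> of one centre, so they
  converge and the vector enters the domain of the limit. Conversely, the spaces \<open>Sn n\<close>
  have the same heads as \<open>S\<close> up to \<open>n\<close>, which confines the domain.\<close>

lemma closure_fst_lim_graph:
  assumes \<Gamma>: "\<And>n. iso_graph K (\<Gamma> n)" "\<And>n. fst ` \<Gamma> n = closure (Sn n)"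
    and S: "subspace S" "S = span (S \<inter> QQ)" "S \<subseteq> c00" "\<And>n. \<exists>m\<ge>n. P m ` S \<subseteq> S"
    and heads: "\<And>m n. m \<le> n \<Longrightarrow> P m ` Sn n = P m ` S" "\<And>n. S \<inter> blk 0 n \<subseteq> Sn n"
    and approx: "\<And>q k. q \<in> S \<inter> QQ \<Longrightarrow>
      \<exists>c N. \<forall>n\<ge>N. q \<in> Sn n \<longrightarrow> (\<exists>y. (q, y) \<in> \<Gamma> n \<and> norm (y - c) < 1 / (real k + 1))"
  shows "closure (fst ` lim_graph \<Gamma>) = closure S"
proof
  have lin: "linear (fst :: 'a \<times> 'a \<Rightarrow> 'a)" by (auto intro!: linearI)
  have sub: "subspace (fst ` lim_graph \<Gamma>)"
    using iso_graphD(1)[OF iso_graph_lim_graph[OF \<Gamma>(1)]] by (rule linear_subspace_image[OF lin])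
  have "q \<in> fst ` lim_graph \<Gamma>" if q: "q \<in> S \<inter> QQ" for q
  proof -
    obtain m where m: "P m q = q" using q S(3) by (auto simp: c00_def)
    have qn: "q \<in> Sn n" if "n \<ge> m" for n
      using heads(2)[of n] q c00_P[OF m that] by (auto simp: mem_blk_0)
    then have "\<exists>y. (q, y) \<in> \<Gamma> n" if "n \<ge> m" for n
      using \<Gamma>(2)[of n] closure_subset[of "Sn n"] that by (force simp: image_iff set_eq_iff)
    then obtain w where w: "\<And>n. n \<ge> m \<Longrightarrow> (q, w n) \<in> \<Gamma> n" by metis
    have uniq: "y = w n" if "(q, y) \<in> \<Gamma> n" "n \<ge> m" for n y
    proof -
      have "(0, y - w n) \<in> \<Gamma> n"
        using subspace_diff[OF iso_graphD(1)[OF \<Gamma>(1)] that(1) w[OF that(2)]] by simp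
      then show ?thesis using iso_graphD(2)[OF \<Gamma>(1)] by fastforce
    qed
    have "Cauchy w"
    proof (rule metric_CauchyI)
      fix r :: real assume "r > 0"
      obtain k :: nat where "2 / r < real k" using reals_Archimedean2 by blast
      then have k: "2 * (1 / (real k + 1)) < r" using \<open>r > 0\<close> by (simp add: field_simps)
      obtain c N where N: "\<And>n. n \<ge> N \<Longrightarrow> q \<in> Sn n \<Longrightarrow> (\<exists>y. (q, y) \<in> \<Gamma> n \<and> norm (y - c) < 1 / (real k + 1))"
        using approx[OF q, of k] by blast
      have wc: "norm (w n - c) < 1 / (real k + 1)" if "n \<ge> max N m" for n
        using N[of n] qn[of n] uniq[of _ n] that by auto
      have "dist (w n) (w n') < r" if "n \<ge> max N m" "n' \<ge> max N m" for n n'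
        using wc[OF that(1)] wc[OF that(2)] norm_triangle_ineq4[of "w n - c" "w n' - c"] k
        by (simp add: dist_norm)
      then show "\<exists>M. \<forall>n\<ge>M. \<forall>n'\<ge>M. dist (w n) (w n') < r" by blast
    qed
    then obtain y where y: "w \<longlonglongrightarrow> y" using Cauchy_convergent_iff convergent_def by blast
    define u v where "u n = (if n \<ge> m then q else 0)" and "v n = (if n \<ge> m then w n else 0)" for n
    have "(u n, v n) \<in> \<Gamma> n" for n
      using w subspace_0[OF iso_graphD(1)[OF \<Gamma>(1)], of n] by (simp add: u_def v_def zero_prod_def)
    moreover have "u \<longlonglongrightarrow> q"
      by (rule tendsto_eventually) (auto simp: u_def eventually_sequentially)
    moreover have "v \<longlonglongrightarrow> y"
      by (rule Lim_transform_eventually[OF y]) (auto simp: v_def eventually_sequentially)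
    ultimately have "(q, y) \<in> lim_graph \<Gamma>" unfolding lim_graph_def by blast
    then show ?thesis by force
  qed
  then have "S \<subseteq> fst ` lim_graph \<Gamma>" using S(2) span_minimal[OF _ sub] by blast
  then show "closure S \<subseteq> closure (fst ` lim_graph \<Gamma>)" by (rule closure_mono)
  have "x \<in> closure S" if x: "x \<in> fst ` lim_graph \<Gamma>" for x
  proof -
    obtain u v where u: "\<And>n. (u n, v n) \<in> \<Gamma> n" "u \<longlonglongrightarrow> x" using x by (auto elim!: lim_graphE)
    have uc: "u n \<in> closure (Sn n)" for n using u(1)[of n] \<Gamma>(2)[of n] by force
    \<comment> \<open>The closure of \<open>S\<close> is reached through the splitting points of
      \<open>S\<close>: there are arbitrarily large ones, and \<open>P m x\<close> tends to
      \<open>x\<close>.\<close>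
    have Pm: "P m x \<in> closure S" if m: "P m ` S \<subseteq> S" for m
    proof -
      have "P m (u n) \<in> closure S" if "n \<ge> m" for n
      proof -
        have "P m ` closure (Sn n) \<subseteq> closure S"
        proof (rule image_closure_subset)
          show "continuous_on (closure (Sn n)) (P m)"
            using bounded_linear_P by (simp add: linear_continuous_on)
          show "P m ` Sn n \<subseteq> closure S" using heads(1)[OF that] m closure_subset by blast
        qed auto
        then show ?thesis using uc by blast
      qed
      moreover have "(\<lambda>n. P m (u n)) \<longlonglongrightarrow> P m x"
        using bounded_linear.tendsto[OF bounded_linear_P u(2)] .
      ultimately show ?thesis
        by (intro Lim_in_closed_set[of "closure S" "\<lambda>n. P m (u n)" sequentially])
           (auto simp: eventually_sequentially)
    qed
    show ?thesis
    proof (rule ccontr)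
      assume "x \<notin> closure S"
      then have "\<forall>\<^sub>F m in sequentially. P m x \<in> - closure S"
        by (intro topological_tendstoD[OF P_tendsto]) auto
      then obtain N where "\<And>m. m \<ge> N \<Longrightarrow> P m x \<notin> closure S" by (auto simp: eventually_sequentially)
      then show False using S(4)[of N] Pm by blast
    qed
  qed
  then show "closure (fst ` lim_graph \<Gamma>) \<subseteq> closure S" by (intro closure_minimal) auto
qed

lemma swap_lim_graph: "prod.swap ` lim_graph \<Gamma> = lim_graph (\<lambda>n. prod.swap ` \<Gamma> n)"
proof -
  have swap: "(x, y) \<in> prod.swap ` A \<longleftrightarrow> (y, x) \<in> A" for x y and A :: "('a \<times> 'a) set" by force
  have "(x, y) \<in> prod.swap ` lim_graph \<Gamma> \<longleftrightarrow> (x, y) \<in> lim_graph (\<lambda>n. prod.swap ` \<Gamma> n)" for x y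
    unfolding swap unfolding lim_graph_def mem_Collect_eq case_prod_conv swap by blast
  then show ?thesis by (simp add: set_eq_iff)
qed

definition qn :: "nat \<Rightarrow> 'a" where "qn = from_nat_into QQ"

lemma QQ_nonempty: "QQ \<noteq> {}"
  using QQ_dense[of 1 0] by auto

lemma range_qn: "range qn = QQ"
  unfolding qn_def using range_from_nat_into[OF QQ_nonempty countable_QQ] .

text \<open>The requirement \<open>i\<close> stands for a vector \<open>q\<close> and a precision \<open>1 / (k + 1)\<close>; the code \<open>c\<close> names
  approximate images of \<open>q\<close> under the isomorphism and its inverse.\<close>
definition req :: "('a \<times> 'a) set \<Rightarrow> 'a set \<Rightarrow> 'a set \<Rightarrow> nat \<Rightarrow> nat \<Rightarrow> bool" where
  "req \<Gamma> S S' i c \<longleftrightarrow> (case prod_decode i of (j, k) \<Rightarrow> case prod_decode c of (a, b) \<Rightarrow>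
     (qn j \<in> S \<longrightarrow> (\<exists>y. (qn j, y) \<in> \<Gamma> \<and> norm (y - qn a) < 1 / (real k + 1))) \<and>
     (qn j \<in> S' \<longrightarrow> (\<exists>x. (x, qn j) \<in> \<Gamma> \<and> norm (x - qn b) < 1 / (real k + 1))))"

text \<open>The graph is bound inside, so it may change from code to code. A code prescribes values
  only approximately, which allows countably many continuations while a whole branch still
  determines the limits.\<close>

definition approx_pairs :: "real \<Rightarrow> nat list \<Rightarrow> ('a set \<times> 'a set) set" where
  "approx_pairs K s = {(S, S') \<in> pts. \<exists>\<Gamma>. iso_graph K \<Gamma> \<and> fst ` \<Gamma> = closure S \<and> snd ` \<Gamma> = closure S' \<and>
     (\<forall>i<length s. req \<Gamma> S S' i (s ! i))}"

lemma approx_pairs_Nil: "approx_pairs K [] = iso_pairs K"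
  by (auto simp: approx_pairs_def iso_pairs_def kiso_def)

lemma req_exists:
  assumes "S \<subseteq> fst ` \<Gamma>" "S' \<subseteq> snd ` \<Gamma>"
  shows "\<exists>c. req \<Gamma> S S' i c"
proof -
  obtain j k where jk: "prod_decode i = (j, k)" by fastforce
  have pos: "1 / (real k + 1) > 0" by simp
  have near: "\<exists>a. norm (x - qn a) < 1 / (real k + 1)" for x
    using QQ_dense[OF pos, of x] range_qn by (metis rangeE)
  have "\<exists>a. qn j \<in> S \<longrightarrow> (\<exists>y. (qn j, y) \<in> \<Gamma> \<and> norm (y - qn a) < 1 / (real k + 1))"
  proof (cases "qn j \<in> S")
    case True
    then obtain y where "(qn j, y) \<in> \<Gamma>" using assms(1) by force
    then show ?thesis using near[of y] by blast
  qed auto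
  moreover have "\<exists>b. qn j \<in> S' \<longrightarrow> (\<exists>x. (x, qn j) \<in> \<Gamma> \<and> norm (x - qn b) < 1 / (real k + 1))"
  proof (cases "qn j \<in> S'")
    case True
    then obtain x where "(x, qn j) \<in> \<Gamma>" using assms(2) by force
    then show ?thesis using near[of x] by blast
  qed auto
  ultimately obtain a b where
    "qn j \<in> S \<longrightarrow> (\<exists>y. (qn j, y) \<in> \<Gamma> \<and> norm (y - qn a) < 1 / (real k + 1))"
    "qn j \<in> S' \<longrightarrow> (\<exists>x. (x, qn j) \<in> \<Gamma> \<and> norm (x - qn b) < 1 / (real k + 1))" by blast
  then show ?thesis by (intro exI[of _ "prod_encode (a, b)"]) (simp add: req_def jk)
qed

lemma approx_pairs_split: "approx_pairs K s \<subseteq> (\<Union>c. approx_pairs K (s @ [c]))"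
proof
  fix p assume "p \<in> approx_pairs K s"
  then obtain S S' \<Gamma> where p: "p = (S, S')" "(S, S') \<in> pts" "iso_graph K \<Gamma>" "fst ` \<Gamma> = closure S"
    "snd ` \<Gamma> = closure S'" "\<forall>i<length s. req \<Gamma> S S' i (s ! i)"
    by (auto simp: approx_pairs_def)
  obtain c where "req \<Gamma> S S' (length s) c"
    using req_exists[of S \<Gamma> S'] p(4,5) closure_subset by blast
  then have "\<forall>i<length (s @ [c]). req \<Gamma> S S' i ((s @ [c]) ! i)"
    using p(6) by (auto simp: nth_append less_Suc_eq)
  then have "p \<in> approx_pairs K (s @ [c])" unfolding approx_pairs_def using p by blast
  then show "p \<in> (\<Union>c. approx_pairs K (s @ [c]))" by blast
qed

text \<open>For each \<open>n\<close> there are a pair agreeing with \<open>x\<close> up to a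
  splitting point beyond \<open>n\<close> and a graph meeting the first \<open>n\<close>
  requirements of \<open>z\<close>. These graphs are unrelated except for the requirements, but
  those make the images of each net vector converge, so the lower limit relates the two closures
  with the same \<open>K\<close>.\<close>

lemma approx_pairs_limit:
  assumes lim: "\<And>n p. p \<in> Cond \<Longrightarrow> x \<in> nb p \<Longrightarrow> approx_pairs K (map z [0..<n]) \<inter> nb p \<noteq> {}"
    and p: "\<exists>p\<in>Cond. x \<in> nb p"
  shows "x \<in> iso_pairs K"
proof -
  obtain S S' where x: "x = (S, S')" by (cases x)
  have pts: "(S, S') \<in> pts" using p x by (auto simp: nb_def)
  define W where "W n m T T' \<Gamma> \<longleftrightarrow> m \<ge> n \<and> P m ` T = P m ` S \<and> P m ` S \<subseteq> T \<and> P m ` T' = P m ` S' \<and> P m ` S' \<subseteq> T' \<and>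
      iso_graph K \<Gamma> \<and> fst ` \<Gamma> = closure T \<and> snd ` \<Gamma> = closure T' \<and> (\<forall>i<n. req \<Gamma> T T' i (z i))" for n m T T' \<Gamma>
  have "\<exists>m T T' \<Gamma>. W n m T T' \<Gamma>" for n
  proof -
    obtain m A B where m: "m \<ge> n" "A \<in> R 0 m" "B \<in> R 0 m" "splits m S A" "splits m S' B"
      using pts by (fastforce simp: pts_def)
    then have "approx_pairs K (map z [0..<n]) \<inter> nb (m, A, B) \<noteq> {}"
      using pts x by (intro lim) (auto simp: Cond_def nb_def)
    then obtain T T' where T: "(T, T') \<in> approx_pairs K (map z [0..<n])" "splits m T A" "splits m T' B"
      by (auto simp: nb_def)
    then obtain \<Gamma> where "iso_graph K \<Gamma>" "fst ` \<Gamma> = closure T" "snd ` \<Gamma> = closure T'"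
      "\<forall>i<n. req \<Gamma> T T' i (z i)"
      unfolding approx_pairs_def by auto
    then have "W n m T T' \<Gamma>" using T(2,3) m(1,4,5) by (simp add: splits_def W_def)
    then show ?thesis by blast
  qed
  then obtain m T T' \<Gamma> where W: "\<And>n. W n (m n) (T n) (T' n) (\<Gamma> n)" by metis
  from W[unfolded W_def] have m: "\<And>n. m n \<ge> (n::nat)"
    and T: "\<And>n. P (m n) ` T n = P (m n) ` S" "\<And>n. P (m n) ` S \<subseteq> T n"
      "\<And>n. P (m n) ` T' n = P (m n) ` S'" "\<And>n. P (m n) ` S' \<subseteq> T' n"
    and \<Gamma>: "\<And>n. iso_graph K (\<Gamma> n)" "\<And>n. fst ` \<Gamma> n = closure (T n)" "\<And>n. snd ` \<Gamma> n = closure (T' n)"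
    and rq: "\<And>n i. i < n \<Longrightarrow> req (\<Gamma> n) (T n) (T' n) i (z i)"
    by simp_all
  have PP: "P k ` P l ` A = P k ` A" if "k \<le> l" for k l A
    using that by (simp add: image_image P_P_le)
  have heads: "P k ` T n = P k ` S" "P k ` T' n = P k ` S'" if "k \<le> n" for k n
    using PP[of k "m n" "T n"] PP[of k "m n" S] PP[of k "m n" "T' n"] PP[of k "m n" S'] m[of n] that T(1,3)[of n]
    by simp_all
  have blk: "S \<inter> blk 0 n \<subseteq> T n" "S' \<inter> blk 0 n \<subseteq> T' n" for n
  proof -
    have "v \<in> P (m n) ` A" if "v \<in> A \<inter> blk 0 n" for v A
      using c00_P[OF _ m[of n], of v] that by (force simp: mem_blk_0)
    then show "S \<inter> blk 0 n \<subseteq> T n" "S' \<inter> blk 0 n \<subseteq> T' n" using T(2)[of n] T(4)[of n] by blast+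
  qed
  have S0: "subspace S" "S \<subseteq> c00" and S0': "subspace S'" "S' \<subseteq> c00"
    using pts by (auto simp: pts_def)
  have split: "\<exists>m\<ge>n. \<exists>A\<in>R 0 m. splits m S A" "\<exists>m\<ge>n. \<exists>B\<in>R 0 m. splits m S' B" for n
    using pts unfolding pts_def by blast+
  then have "\<exists>m\<ge>n. P m ` S \<subseteq> S" "\<exists>m\<ge>n. P m ` S' \<subseteq> S'" for n
    unfolding splits_def by blast+
  note S = S0(1) span_QQ[OF S0 split(1)] S0(2) this(1)
    and S' = S0'(1) span_QQ[OF S0' split(2)] S0'(2) this(2)
  have approx: "\<exists>a b N. \<forall>n\<ge>N.
      (q \<in> T n \<longrightarrow> (\<exists>y. (q, y) \<in> \<Gamma> n \<and> norm (y - a) < 1 / (real k + 1))) \<and>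
      (q \<in> T' n \<longrightarrow> (\<exists>y. (y, q) \<in> \<Gamma> n \<and> norm (y - b) < 1 / (real k + 1)))" if q: "q \<in> QQ" for q k
  proof -
    obtain j where j: "q = qn j" using q range_qn by blast
    define i where "i = prod_encode (j, k)"
    obtain a b where ab: "prod_decode (z i) = (a, b)" by fastforce
    have "(q \<in> T n \<longrightarrow> (\<exists>y. (q, y) \<in> \<Gamma> n \<and> norm (y - qn a) < 1 / (real k + 1))) \<and>
      (q \<in> T' n \<longrightarrow> (\<exists>y. (y, q) \<in> \<Gamma> n \<and> norm (y - qn b) < 1 / (real k + 1)))" if "n \<ge> Suc i" for n
      using rq[of i n] that unfolding req_def j i_def[symmetric] ab by (simp add: i_def)
    then show ?thesis by blast
  qed
  have 1: "closure (fst ` lim_graph \<Gamma>) = closure S"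
    using approx by (intro closure_fst_lim_graph[where Sn = T, OF \<Gamma>(1,2) S heads(1) blk(1)]) blast+
  have swap: "(x, y) \<in> prod.swap ` A \<longleftrightarrow> (y, x) \<in> A" for x y and A :: "('a \<times> 'a) set" by force
  have "closure (fst ` lim_graph (\<lambda>n. prod.swap ` \<Gamma> n)) = closure S'"
  proof (rule closure_fst_lim_graph[where Sn = T', OF _ _ S' heads(2) blk(2)])
    show "iso_graph K (prod.swap ` \<Gamma> n)" for n by (rule iso_graph_swap[OF \<Gamma>(1)])
    show "fst ` prod.swap ` \<Gamma> n = closure (T' n)" for n using \<Gamma>(3) by (simp add: image_image)
    show "\<exists>c N. \<forall>n\<ge>N. q \<in> T' n \<longrightarrow> (\<exists>y. (q, y) \<in> prod.swap ` \<Gamma> n \<and> norm (y - c) < 1 / (real k + 1))"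
      if "q \<in> S' \<inter> QQ" for q k
      unfolding swap using approx[of q k] that by blast
  qed
  then have 2: "closure (snd ` lim_graph \<Gamma>) = closure S'"
    unfolding swap_lim_graph[symmetric] by (simp add: image_image)
  have "kiso K (fst ` lim_graph \<Gamma>) (snd ` lim_graph \<Gamma>)"
    unfolding kiso_def using iso_graph_lim_graph[of K \<Gamma>, OF \<Gamma>(1)]
    by (intro exI[of _ "lim_graph \<Gamma>"]) simp
  then have "kiso K (closure S) (closure S')" using kiso_closure[of K] 1 2 by fastforce
  then show ?thesis using pts by (simp add: iso_pairs_def x)
qed

lemma iso_pairs_comeager_below:
  assumes "\<not> meager (iso_pairs K)"
  shows "\<exists>p\<in>Cond. meager (nb p - iso_pairs K)"
proof (rule comeager_below_of_not_meager[of "approx_pairs K"])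
  show "x \<in> iso_pairs K"
    if "\<And>n p. p \<in> Cond \<Longrightarrow> x \<in> nb p \<Longrightarrow> approx_pairs K (map z [0..<n]) \<inter> nb p \<noteq> {}"
      "\<exists>p\<in>Cond. x \<in> nb p" for x and z :: "nat \<Rightarrow> nat"
    using approx_pairs_limit[of x K z] that by blast
qed (use assms approx_pairs_split approx_pairs_Nil in auto)

section \<open>The meager case\<close>

lemma CondI: "A \<in> R 0 m \<Longrightarrow> B \<in> R 0 m \<Longrightarrow> (m, A, B) \<in> Cond"
  by (simp add: Cond_def)

lemma mem_nb: "(S, S') \<in> nb (m, A, B) \<longleftrightarrow> (S, S') \<in> pts \<and> splits m S A \<and> splits m S' B"
  by (simp add: nb_def)

lemma splits_ext:
  assumes "A \<in> R 0 m" "r \<in> R m m'"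
  shows "splits m (span (A \<union> r)) A"
  unfolding splits_def
proof
  have rt: "r \<subseteq> tail m" using R_blk[OF assms(2)] blk_subset_tail by blast
  show "A \<subseteq> span (A \<union> r)" by (auto intro: span_base)
  show "P m ` span (A \<union> r) = A"
  proof
    show "P m ` span (A \<union> r) \<subseteq> A"
      using mem_span_Un[OF R_subspace[OF assms(1)] R_subspace[OF assms(2)]]
        P_span_Un[OF R_blk[OF assms(1)] rt] by auto
    show "A \<subseteq> P m ` span (A \<union> r)"
    proof
      fix a assume a: "a \<in> A"
      then have "P m a = a" using R_blk[OF assms(1)] mem_blk_0 by blast
      then show "a \<in> P m ` span (A \<union> r)" using a by (metis UnI1 imageI span_base)
    qed
  qed
qed

lemma nb_ext_subset:
  assumes "A \<in> R 0 m" "B \<in> R 0 m" "r \<in> R m m'" "s \<in> R m m'" "m \<le> m'"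
  shows "nb (m', span (A \<union> r), span (B \<union> s)) \<subseteq> nb (m, A, B)"
  using splits_ext[OF assms(1,3)] splits_ext[OF assms(2,4)] assms(5)
  by (intro le_N) (simp add: cle_def)

lemma splits_decompose:
  assumes "splits m A' A" "A' \<in> R 0 m'"
  shows "A' \<inter> tail m \<in> R m m'" "A' = span (A \<union> (A' \<inter> tail m))"
proof -
  have PA: "P m ` A' \<subseteq> A'" "P m ` A' = A" using assms(1) by (auto simp: splits_def)
  show "A' \<inter> tail m \<in> R m m'" using R_tail[OF assms(2) PA(1)] .
  show "A' = span (A \<union> (A' \<inter> tail m))"
  proof
    show "span (A \<union> A' \<inter> tail m) \<subseteq> A'"
      using PA R_subspace[OF assms(2)] by (intro span_minimal) auto
    show "A' \<subseteq> span (A \<union> A' \<inter> tail m)"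
    proof
      fix x assume x: "x \<in> A'"
      then have "P m x \<in> A" "x - P m x \<in> A'"
        using PA subspace_diff[OF R_subspace[OF assms(2)]] by blast+
      moreover have "x - P m x \<in> tail m" by (simp add: tail_def P_diff P_P)
      ultimately have "P m x + (x - P m x) \<in> span (A \<union> A' \<inter> tail m)"
        by (intro span_add) (auto intro: span_base)
      then show "x \<in> span (A \<union> A' \<inter> tail m)" by simp
    qed
  qed
qed

text \<open>Extending a condition amounts to appending one block to each head; the blocks are the
  parts of the longer heads in \<open>tail m\<close>.\<close>

lemma nwd_extend:
  assumes "nwd M" "A \<in> R 0 m" "B \<in> R 0 m"
  shows "\<exists>m'\<ge>m. \<exists>r\<in>R m m'. \<exists>s\<in>R m m'. nb (m', span (A \<union> r), span (B \<union> s)) \<inter> M = {}"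
proof -
  obtain q where q: "q \<in> Cond" "cle q (m, A, B)" "nb q \<inter> M = {}"
    using assms(1) CondI[OF assms(2,3)] unfolding nwd_def by blast
  obtain m' A' B' where q': "q = (m', A', B')" by (cases q)
  have "splits m A' A" "splits m B' B" "A' \<in> R 0 m'" "B' \<in> R 0 m'" "m \<le> m'"
    using q(1,2) by (auto simp: q' cle_def Cond_def)
  with splits_decompose[of m A' A m'] splits_decompose[of m B' B m'] q(3)
  show ?thesis by (metis q')
qed

text \<open>The heads are treated one at a time, and the blocks found for one of them are appended
  for all. Earlier successes persist because appending blocks shrinks the neighbourhood.\<close>

lemma nwd_extend_all:
  assumes "nwd M" "finite F" "F \<subseteq> R 0 m \<times> R 0 m"
  shows "\<exists>m'\<ge>m. \<exists>r\<in>R m m'. \<exists>s\<in>R m m'. \<forall>(A, B)\<in>F. nb (m', span (A \<union> r), span (B \<union> s)) \<inter> M = {}"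
  using assms(2,3)
proof (induction F rule: finite_induct)
  case empty
  then show ?case using R_zero by (intro exI[of _ m]) auto
next
  case (insert p F)
  then obtain m' r s where IH: "m' \<ge> m" "r \<in> R m m'" "s \<in> R m m'"
    "\<And>A B. (A, B) \<in> F \<Longrightarrow> nb (m', span (A \<union> r), span (B \<union> s)) \<inter> M = {}" by blast
  obtain A B where p: "p = (A, B)" "A \<in> R 0 m" "B \<in> R 0 m" using insert.prems by (cases p) auto
  have ext: "span (A' \<union> r) \<in> R 0 m'" "span (A' \<union> s) \<in> R 0 m'" if "A' \<in> R 0 m" for A'
    using R_Un[OF that] IH by blast+
  obtain m'' r' s' where new: "m'' \<ge> m'" "r' \<in> R m' m''" "s' \<in> R m' m''"
    "nb (m'', span (span (A \<union> r) \<union> r'), span (span (B \<union> s) \<union> s')) \<inter> M = {}"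
    using nwd_extend[OF assms(1) ext(1)[OF p(2)] ext(2)[OF p(3)]] by blast
  have "nb (m'', span (A' \<union> span (r \<union> r')), span (B' \<union> span (s \<union> s'))) \<inter> M = {}"
    if AB: "(A', B') \<in> insert p F" for A' B'
  proof (cases "(A', B') = p")
    case True
    then show ?thesis using new(4) unfolding span_Un_assoc by (simp add: p(1))
  next
    case False
    then have "(A', B') \<in> F" "A' \<in> R 0 m" "B' \<in> R 0 m" using AB insert.prems by auto
    then show ?thesis
      using IH(4) nb_ext_subset[OF ext(1) ext(2) new(2,3,1), of A' B'] unfolding span_Un_assoc by blast
  qed
  moreover have "span (r \<union> r') \<in> R m m''" "span (s \<union> s') \<in> R m m''"
    using R_Un IH(1-3) new(1-3) by blast+
  ultimately show ?case
    using IH(1) new(1) by (intro exI[of _ m''] conjI bexI[of _ "span (r \<union> r')"] bexI[of _ "span (s \<union> s')"]) auto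
qed

lemma pts_swap: "(S, S') \<in> pts \<Longrightarrow> (S', S) \<in> pts"
  unfolding pts_def by blast

text \<open>Two binary sequences may disagree at \<open>n\<close> in either order, while the two
  separating blocks are assigned to the factors in one order only.\<close>

lemma nwd_swap:
  assumes "nwd M" shows "nwd (prod.swap ` M)"
  unfolding nwd_def
proof
  fix p assume "p \<in> Cond"
  obtain m A B where p: "p = (m, A, B)" by (cases p)
  then have "(m, B, A) \<in> Cond" using \<open>p \<in> Cond\<close> by (simp add: Cond_def)
  then obtain m' B' A' where q: "(m', B', A') \<in> Cond" "cle (m', B', A') (m, B, A)" "nb (m', B', A') \<inter> M = {}"
    using assms unfolding nwd_def by (metis prod.exhaust)
  then have "(m', A', B') \<in> Cond" "cle (m', A', B') p" by (auto simp: p Cond_def cle_def)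
  moreover have "nb (m', A', B') \<inter> prod.swap ` M = {}"
    using q(3) pts_swap by (fastforce simp: nb_def)
  ultimately show "\<exists>q\<in>Cond. cle q p \<and> nb q \<inter> prod.swap ` M = {}" by blast
qed

lemma Lead_span_e: "Lead (span (e ` {a..<b})) = {a..<b}"
proof
  have "e ` {a..<b} \<subseteq> blk a b" using e_in_blk by auto
  then show "Lead (span (e ` {a..<b})) \<subseteq> {a..<b}"
    using span_minimal[OF _ subspace_blk] by (intro Lead_subset_blk) blast
  show "{a..<b} \<subseteq> Lead (span (e ` {a..<b}))"
    unfolding Lead_def by (force simp: mem_tail intro: span_base)
qed

lemma card_Lead_Un:
  assumes "H \<in> R l m" "r \<in> R m m'"
  shows "card (Lead (span (H \<union> r))) = card (Lead H) + card (Lead r)"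
proof -
  have "H \<subseteq> blk 0 m" using R_blk[OF assms(1)] blk_mono[of 0 l m m] by auto
  moreover have "r \<subseteq> tail m" using R_blk[OF assms(2)] blk_subset_tail by blast
  ultimately have "Lead (span (H \<union> r)) = Lead H \<union> Lead r"
    using Lead_Un[OF R_subspace[OF assms(1)] R_subspace[OF assms(2)]] by blast
  moreover have L: "Lead H \<subseteq> {l..<m}" "Lead r \<subseteq> {m..<m'}"
    using Lead_subset_blk R_blk assms by blast+
  moreover have "Lead H \<inter> Lead r = {}" using L by force
  ultimately show ?thesis
    using finite_subset[OF L(1)] finite_subset[OF L(2)] by (simp add: card_Un_disjoint)
qed

lemma separating_blocks:
  assumes "nwd M"
  shows "\<exists>m'>m. \<exists>r\<in>R m m'. \<exists>s\<in>R m m'. card (Lead r) = card (Lead s) \<and>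
    (\<forall>A\<in>R 0 m. \<forall>B\<in>R 0 m. nb (m', span (A \<union> r), span (B \<union> s)) \<inter> M = {})"
proof -
  obtain m1 r s where m1: "m1 \<ge> m" "r \<in> R m m1" "s \<in> R m m1"
    "\<And>A B. A \<in> R 0 m \<Longrightarrow> B \<in> R 0 m \<Longrightarrow> nb (m1, span (A \<union> r), span (B \<union> s)) \<inter> M = {}"
    using nwd_extend_all[OF assms, of "R 0 m \<times> R 0 m" m] R_finite by auto
  let ?a = "card (Lead r)" and ?b = "card (Lead s)"
  \<comment> \<open>Each side is padded with as many basis vectors as the other has dimensions, so
    both reach \<open>?a + ?b\<close>; the additional 1 makes the interval nonempty.\<close>
  let ?m' = "m1 + ?a + ?b + 1"
  let ?er = "span (e ` {m1..<m1 + ?b})" and ?es = "span (e ` {m1..<m1 + ?a})"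
  have E: "?er \<in> R m1 ?m'" "?es \<in> R m1 ?m'" by (intro R_e; auto)+
  have "?m' > m" using m1(1) by simp
  moreover have "span (r \<union> ?er) \<in> R m ?m'" "span (s \<union> ?es) \<in> R m ?m'"
    using R_Un[OF m1(2) E(1)] R_Un[OF m1(3) E(2)] m1(1) by auto
  moreover have "card (Lead (span (r \<union> ?er))) = card (Lead (span (s \<union> ?es)))"
    using card_Lead_Un[OF m1(2) E(1)] card_Lead_Un[OF m1(3) E(2)] by (simp add: Lead_span_e)
  moreover have "nb (?m', span (A \<union> span (r \<union> ?er)), span (B \<union> span (s \<union> ?es))) \<inter> M = {}"
    if AB: "A \<in> R 0 m" "B \<in> R 0 m" for A B
  proof -
    have "span (A \<union> r) \<in> R 0 m1" "span (B \<union> s) \<in> R 0 m1"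
      using R_Un[OF AB(1) m1(2)] R_Un[OF AB(2) m1(3)] m1(1) by auto
    from nb_ext_subset[OF this E]
    show ?thesis using m1(4)[OF AB] unfolding span_Un_assoc by auto
  qed
  ultimately show ?thesis by blast
qed

lemma bsum_split: "bsum G = span (bhead n G \<union> span (\<Union>k\<in>{n..}. G k))"
proof -
  have "(\<Union>k. G k) = (\<Union>k<n. G k) \<union> (\<Union>k\<in>{n..}. G k)" by (auto, metis atLeast_iff lessThan_iff not_less)
  then show ?thesis unfolding bsum_def bhead_def by (simp add: span_Un span_span)
qed

lemma splits_bsum: "block_seq j G \<Longrightarrow> splits (j n) (bsum G) (bhead n G)"
  by (simp add: splits_def P_bsum bhead_subset_bsum)

lemma open_agree: "open {\<beta> :: nat \<Rightarrow> bool. \<forall>i<n. \<beta> i = \<alpha> i}"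
proof -
  have "open ((\<lambda>\<beta> :: nat \<Rightarrow> bool. \<beta> i) -` {\<alpha> i})" for i
    by (intro open_vimage continuous_on_product_coordinates open_discrete)
  then have "open (\<Inter>i\<in>{..<n}. (\<lambda>\<beta> :: nat \<Rightarrow> bool. \<beta> i) -` {\<alpha> i})"
    by (intro open_INT) auto
  moreover have "(\<Inter>i\<in>{..<n}. (\<lambda>\<beta> :: nat \<Rightarrow> bool. \<beta> i) -` {\<alpha> i}) = {\<beta>. \<forall>i<n. \<beta> i = \<alpha> i}" by auto
  ultimately show ?thesis by simp
qed

text \<open>An open set meets the closure exactly when it meets the algebraic sum, and a vector of
  that sum lies in a head depending on finitely many coordinates of \<open>\<alpha>\<close>. So
  preimages of the generating sets are open.\<close>

lemma measurable_closure_bsum: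
  fixes G :: "(nat \<Rightarrow> bool) \<Rightarrow> nat \<Rightarrow> 'a set"
  assumes "\<And>\<alpha> \<beta> n. \<alpha> n = \<beta> n \<Longrightarrow> G \<alpha> n = G \<beta> n"
  shows "(\<lambda>\<alpha>. closure (bsum (G \<alpha>))) \<in> borel \<rightarrow>\<^sub>M effros_borel"
  unfolding effros_borel_def
proof (rule measurable_measure_of)
  let ?f = "\<lambda>\<alpha>. closure (bsum (G \<alpha>))"
  have cl: "?f \<alpha> \<in> closed_subspaces" for \<alpha>
    by (simp add: closed_subspaces_def subspace_closure subspace_bsum)
  then show "?f \<in> space borel \<rightarrow> closed_subspaces" by blast
  fix V assume "V \<in> (\<lambda>U. {Y \<in> closed_subspaces. Y \<inter> U \<noteq> {}}) ` {U :: 'a set. open U}"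
  then obtain U where U: "open U" "V = {Y \<in> closed_subspaces. Y \<inter> U \<noteq> {}}" by blast
  have bs: "bsum (G \<alpha>) = (\<Union>n. bhead n (G \<alpha>))" for \<alpha>
  proof
    have "subspace (\<Union>n. bhead n (G \<alpha>))"
    proof (rule subspaceI)
      have mono: "bhead n (G \<alpha>) \<subseteq> bhead m (G \<alpha>)" if "n \<le> m" for n m
        unfolding bhead_def using that by (intro span_mono UN_mono) auto
      fix x y assume "x \<in> (\<Union>n. bhead n (G \<alpha>))" "y \<in> (\<Union>n. bhead n (G \<alpha>))"
      then obtain n m where "x \<in> bhead n (G \<alpha>)" "y \<in> bhead m (G \<alpha>)" by blast
      then have "x \<in> bhead (max n m) (G \<alpha>)" "y \<in> bhead (max n m) (G \<alpha>)"
        using mono[of n "max n m"] mono[of m "max n m"] by auto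
      then show "x + y \<in> (\<Union>n. bhead n (G \<alpha>))" using subspace_add[OF subspace_bhead] by blast
    qed (auto intro: subspace_0[OF subspace_bhead] subspace_scale[OF subspace_bhead])
    moreover have "(\<Union>k. G \<alpha> k) \<subseteq> (\<Union>n. bhead n (G \<alpha>))"
    proof
      fix x assume "x \<in> (\<Union>k. G \<alpha> k)"
      then obtain k where "x \<in> G \<alpha> k" by blast
      then have "x \<in> bhead (Suc k) (G \<alpha>)" unfolding bhead_def by (intro span_base) auto
      then show "x \<in> (\<Union>n. bhead n (G \<alpha>))" by blast
    qed
    ultimately show "bsum (G \<alpha>) \<subseteq> (\<Union>n. bhead n (G \<alpha>))" unfolding bsum_def by (intro span_minimal)
  qed (use bhead_subset_bsum in blast)
  have "?f -` V \<inter> space borel = {\<alpha>. bsum (G \<alpha>) \<inter> U \<noteq> {}}"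
    using cl U open_Int_closure_eq_empty[OF U(1)] by (auto simp: Int_commute)
  moreover have "open {\<alpha>. bsum (G \<alpha>) \<inter> U \<noteq> {}}"
  proof (subst open_subopen, intro ballI)
    fix \<alpha> assume "\<alpha> \<in> {\<alpha>. bsum (G \<alpha>) \<inter> U \<noteq> {}}"
    then obtain x n where x: "x \<in> U" "x \<in> bhead n (G \<alpha>)" using bs by auto
    have "x \<in> bsum (G \<beta>)" if "\<forall>i<n. \<beta> i = \<alpha> i" for \<beta>
    proof -
      have "bhead n (G \<beta>) = bhead n (G \<alpha>)"
        unfolding bhead_def using that assms by (metis (no_types, lifting) SUP_cong lessThan_iff)
      then show ?thesis using x(2) bhead_subset_bsum by blast
    qed
    then show "\<exists>T. open T \<and> \<alpha> \<in> T \<and> T \<subseteq> {\<alpha>. bsum (G \<alpha>) \<inter> U \<noteq> {}}"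
      using open_agree[of n \<alpha>] x(1) by (intro exI[of _ "{\<beta>. \<forall>i<n. \<beta> i = \<alpha> i}"]) auto
  qed
  ultimately show "?f -` V \<inter> space borel \<in> sets borel" by simp
qed auto

lemma ergodic_of_meager:
  assumes "meager (\<Union>k::nat. iso_pairs (real k))"
  shows "ergodic TYPE('a)"
proof -
  obtain M where M: "\<And>n::nat. nwd (M n)" "(\<Union>k::nat. iso_pairs (real k)) \<subseteq> \<Union> (range M)"
    using assms unfolding meager_def by blast
  define M' where "M' n = (\<Union>k<Suc n. M k \<union> prod.swap ` M k)" for n
  have "nwd (M' n)" for n
    unfolding M'_def using nwd_UN_lessThan[of "\<lambda>k. M k \<union> prod.swap ` M k"] nwd_Un nwd_swap M(1) by blast
  from separating_blocks[OF this]
  have "\<forall>m n. \<exists>m' r s. m < m' \<and> r \<in> R m m' \<and> s \<in> R m m' \<and> card (Lead r) = card (Lead s) \<and>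
    (\<forall>A\<in>R 0 m. \<forall>B\<in>R 0 m. nb (m', span (A \<union> r), span (B \<union> s)) \<inter> M' n = {})" by blast
  then obtain nx \<rho> \<sigma> where nx: "\<And>m n. m < nx m n" "\<And>m n. \<rho> m n \<in> R m (nx m n)" "\<And>m n. \<sigma> m n \<in> R m (nx m n)"
    "\<And>m n. card (Lead (\<rho> m n)) = card (Lead (\<sigma> m n))"
    "\<And>m n A B. A \<in> R 0 m \<Longrightarrow> B \<in> R 0 m \<Longrightarrow> nb (nx m n, span (A \<union> \<rho> m n), span (B \<union> \<sigma> m n)) \<inter> M' n = {}"
    by metis
  define j where "j = rec_nat 0 (\<lambda>n m. nx m n)"
  have j: "j 0 = 0" "\<And>n. j (Suc n) = nx (j n) n" by (simp_all add: j_def)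
  then have sm: "strict_mono j" using nx(1) by (simp add: strict_mono_Suc_iff)
  define G where "G \<alpha> n = (if \<alpha> n then \<sigma> (j n) n else \<rho> (j n) n)" for \<alpha> :: "nat \<Rightarrow> bool" and n
  have GR: "G \<alpha> n \<in> R (j n) (j (Suc n))" for \<alpha> n
    using nx(2,3) by (simp add: G_def j)
  have bs: "block_seq j (G \<alpha>)" for \<alpha>
    using R_subspace[OF GR] R_blk[OF GR] strict_mono_mono[OF sm] by (simp add: block_seq_def)
  have headR: "bhead n (G \<alpha>) \<in> R 0 (j n)" for n \<alpha> by (rule bhead_R[OF bs GR])
  have pts: "(bsum (G \<alpha>), bsum (G \<beta>)) \<in> pts" for \<alpha> \<beta>
    unfolding pts_def
    using subspace_bsum bsum_c00[OF bs] strict_mono_imp_increasing[OF sm] headR splits_bsum[OF bs]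
    by blast
  have mem: "(bsum (G \<alpha>), bsum (G \<beta>)) \<in> nb (j (Suc n), span (bhead n (G \<alpha>) \<union> G \<alpha> n), span (bhead n (G \<beta>) \<union> G \<beta> n))"
    for \<alpha> \<beta> n
    using pts splits_bsum[OF bs, where n = "Suc n"] by (simp add: mem_nb bhead_Suc)
  have avoid: "(bsum (G \<alpha>), bsum (G \<beta>)) \<notin> M' n" if "\<not> \<alpha> n" "\<beta> n" for \<alpha> \<beta> n
    using nx(5)[OF headR[of n \<alpha>] headR[of n \<beta>], of n] mem[of \<alpha> \<beta> n] that by (auto simp: G_def j)
  have Lead_eq: "card (Lead (bhead n (G \<alpha>))) = card (Lead (bhead n (G \<beta>)))" for \<alpha> \<beta> n
  proof (induction n)
    case (Suc n)
    have "card (Lead (G \<alpha> n)) = card (Lead (G \<beta> n))" using nx(4) by (simp add: G_def)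
    then show ?case
      unfolding bhead_Suc using Suc card_Lead_Un[OF headR GR] by simp
  qed simp
  have "isomorphic_spaces (closure (bsum (G \<alpha>))) (closure (bsum (G \<beta>)))" if "E0 \<alpha> \<beta>" for \<alpha> \<beta>
  proof -
    obtain n where n: "\<And>k. k \<ge> n \<Longrightarrow> \<alpha> k = \<beta> k" using \<open>E0 \<alpha> \<beta>\<close> by (auto simp: E0_def)
    define W where "W = span (\<Union>k\<in>{n..}. G \<alpha> k)"
    have W: "W = span (\<Union>k\<in>{n..}. G \<beta> k)"
      unfolding W_def using n by (auto simp: G_def intro!: arg_cong[where f = span])
    have "W \<subseteq> tail (j n)"
      unfolding W_def
    proof (intro span_minimal subspace_tail UN_least)
      fix k assume "k \<in> {n..}"
      then have "j n \<le> j k" using sm by (simp add: strict_mono_less_eq)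
      then show "G \<alpha> k \<subseteq> tail (j n)"
        using R_blk[OF GR[of \<alpha> k]] blk_subset_tail[of "j k"] tail_antimono by blast
    qed
    then have "kiso (ext_const 1 (card (Lead (bhead n (G \<alpha>))))) (closure (bsum (G \<alpha>))) (closure (bsum (G \<beta>)))"
      unfolding bsum_split[of "G \<alpha>" n] bsum_split[of "G \<beta>" n] W_def[symmetric] W[symmetric]
      by (intro kiso_change_head[of _ _ _ "j n"] subspace_bhead bhead_blk[OF bs] Lead_eq) (auto simp: W_def)
    then show ?thesis
      unfolding isomorphic_spaces_iff_kiso[OF subspace_closure[OF subspace_bsum]]
      using kiso_mono real_arch_simple by blast
  qed
  moreover have "E0 \<alpha> \<beta>" if iso: "isomorphic_spaces (closure (bsum (G \<alpha>))) (closure (bsum (G \<beta>)))" for \<alpha> \<beta>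
  proof -
    obtain k :: nat where "kiso (real k) (closure (bsum (G \<alpha>))) (closure (bsum (G \<beta>)))"
      using iso unfolding isomorphic_spaces_iff_kiso[OF subspace_closure[OF subspace_bsum]] by blast
    then have "(bsum (G \<alpha>), bsum (G \<beta>)) \<in> iso_pairs (real k)"
      using pts by (simp add: iso_pairs_def)
    then obtain i where i: "(bsum (G \<alpha>), bsum (G \<beta>)) \<in> M i" using M(2) by blast
    \<comment> \<open>\<open>M' n\<close> contains \<open>M i\<close> and its swap, so both orders
      of the pair lie in it, and \<open>avoid\<close> rules out either kind of disagreement at
      \<open>n\<close>.\<close>
    have "\<alpha> n = \<beta> n" if "n \<ge> i" for n
    proof -
      have "i \<in> {..<Suc n}" using that by simp
      then have "(bsum (G \<alpha>), bsum (G \<beta>)) \<in> M' n" "(bsum (G \<beta>), bsum (G \<alpha>)) \<in> M' n"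
        using i unfolding M'_def by (blast, force)
      then show ?thesis using avoid by blast
    qed
    then show ?thesis by (auto simp: E0_def)
  qed
  moreover have "(\<lambda>\<alpha>. closure (bsum (G \<alpha>))) \<in> borel \<rightarrow>\<^sub>M effros_borel"
    by (rule measurable_closure_bsum) (simp add: G_def)
  ultimately show ?thesis
    unfolding ergodic_def by (intro exI[of _ "\<lambda>\<alpha>. closure (bsum (G \<alpha>))"]) blast
qed

section \<open>The non-meager case\<close>

text \<open>The cut point \<open>l k\<close> is the least coordinate occurring in
  \<open>D k\<close>, so a gap between two blocks is attributed to the earlier one, and
  \<open>l k\<close> is a leading coordinate.\<close>

lemma successive_blocks_block_seq:
  assumes "successive_blocks e D"
  obtains l where "strict_mono l" "block_seq l D" "\<And>k. l k \<in> Lead (D k)"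
proof -
  have D: "fin_dim_block e (D k)" "block_less e (D k) (D (Suc k))" for k
    using assms by (auto simp: successive_blocks_def)
  have sub: "subspace (D k)" and D0: "D k \<noteq> {0}" and fin: "\<And>x. x \<in> D k \<Longrightarrow> finite {i. cf i x \<noteq> 0}" for k
    using D(1)[of k] by (auto simp: fin_dim_block_def supp_eq)
  have ex: "\<exists>i. \<exists>x\<in>D k. cf i x \<noteq> 0" for k
  proof -
    obtain x where "x \<in> D k" "x \<noteq> 0" using D0[of k] subspace_0[OF sub[of k]] by blast
    then show ?thesis by (metis cf_0 cf_ext)
  qed
  define l where "l k = (LEAST i. \<exists>x\<in>D k. cf i x \<noteq> 0)" for k
  have lx: "\<exists>x\<in>D k. cf (l k) x \<noteq> 0" for k unfolding l_def by (rule LeastI_ex[OF ex])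
  have lt: "D k \<subseteq> tail (l k)" for k
    using not_less_Least unfolding l_def mem_tail subset_iff by blast
  have up: "i < l (Suc k)" if "x \<in> D k" "cf i x \<noteq> 0" for i x k
  proof -
    obtain y where y: "y \<in> D (Suc k)" "cf (l (Suc k)) y \<noteq> 0" using lx by blast
    have "Max (supp e x) < Min (supp e y)"
      using D(2)[of k] that y unfolding block_less_def by fastforce
    moreover have "i \<le> Max (supp e x)" using that fin by (simp add: supp_eq)
    moreover have "Min (supp e y) \<le> l (Suc k)" using y fin by (simp add: supp_eq)
    ultimately show ?thesis by simp
  qed
  have blk: "D k \<subseteq> blk (l k) (l (Suc k))" for k
    using lt[of k] up[of _ k] by (fastforce simp: mem_blk mem_tail not_less)
  have sm: "strict_mono l"
    unfolding strict_mono_Suc_iff using lx up by blast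
  show thesis
  proof
    show "strict_mono l" by (rule sm)
    show "block_seq l D" using strict_mono_mono[OF sm] sub blk by (simp add: block_seq_def)
    show "l k \<in> Lead (D k)" for k using lx[of k] lt[of k] unfolding Lead_def by blast
  qed
qed

lemma successive_blocks_R:
  assumes j: "strict_mono j" and F: "\<And>n. F n \<in> R (j n) (j (Suc n))" "\<And>n. e (j n) \<in> F n"
  shows "successive_blocks e F"
proof -
  have blk: "F n \<subseteq> blk (j n) (j (Suc n))" for n using R_blk[OF F(1)] .
  have range: "supp e x \<subseteq> {j n..<j (Suc n)}" if "x \<in> F n" for x n
    using subsetD[OF blk that] by (auto simp: supp_eq mem_blk)
  have fin: "finite (supp e x)" if "x \<in> F n" for x n
    using finite_subset[OF range[OF that]] by simp
  have ne: "supp e x \<noteq> {}" if "x \<noteq> 0" for x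
    using that cf_ext[of x 0] by (auto simp: supp_eq)
  have "fin_dim_block e (F n)" for n
  proof -
    obtain Q where "F n = span Q" "Q \<subseteq> Net (j (Suc n))" using F(1)[of n] unfolding R_def by blast
    moreover from this have "finite Q" by (blast intro: finite_subset[OF _ Net_finite])
    moreover have "F n \<noteq> {0}" using F(2)[of n] e_nonzero[of "j n"] by (metis singletonD)
    ultimately have "(\<exists>B. finite B \<and> F n = span B) \<and> F n \<noteq> {0}" by blast
    then show ?thesis using fin unfolding fin_dim_block_def by simp
  qed
  moreover have "block_less e (F n) (F (Suc n))" for n
    unfolding block_less_def
  proof (intro ballI)
    fix x y assume xy: "x \<in> F n - {0}" "y \<in> F (Suc n) - {0}"
    have "Max (supp e x) \<in> supp e x" "Min (supp e y) \<in> supp e y"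
      using xy fin ne by auto
    then show "Max (supp e x) < Min (supp e y)"
      using range[of x n] range[of y "Suc n"] xy by fastforce
  qed
  ultimately show ?thesis by (simp add: successive_blocks_def)
qed

text \<open>Only one left head occurs, since the left space is being constructed, but the right
  space is arbitrary. The vector \<open>e m\<close> is adjoined to the right heads before the
  avoiding extension is sought; the last basis vector is put on a fresh coordinate afterwards, which
  only shrinks neighbourhoods.\<close>

lemma absorbing_block:
  assumes "nwd M" "X \<in> R 0 m"
  shows "\<exists>m'>m. \<exists>s\<in>R m m'. \<exists>r\<in>R m m'. e m \<in> r \<and> e (m' - 1) \<in> r \<and>
    (\<forall>B\<in>R 0 m. nb (m', span (X \<union> s), span (B \<union> r)) \<inter> M = {})"
proof -
  let ?v = "span (e ` {m})"
  have v: "?v \<in> R m (Suc m)" by (rule R_e) auto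
  have X: "X \<in> R 0 (Suc m)" using assms(2) R_mono[of 0 0 m "Suc m"] by auto
  have Bv: "span (B \<union> ?v) \<in> R 0 (Suc m)" if "B \<in> R 0 m" for B
    using R_Un[OF that v] by simp
  have "finite ({X} \<times> (\<lambda>B. span (B \<union> ?v)) ` R 0 m)" using R_finite by blast
  moreover have "{X} \<times> (\<lambda>B. span (B \<union> ?v)) ` R 0 m \<subseteq> R 0 (Suc m) \<times> R 0 (Suc m)"
    using X Bv by auto
  ultimately obtain m1 s r where m1: "m1 \<ge> Suc m" "s \<in> R (Suc m) m1" "r \<in> R (Suc m) m1"
    and sr: "\<forall>(A, B)\<in>{X} \<times> (\<lambda>B. span (B \<union> ?v)) ` R 0 m. nb (m1, span (A \<union> s), span (B \<union> r)) \<inter> M = {}"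
    using nwd_extend_all[OF assms(1), of "{X} \<times> (\<lambda>B. span (B \<union> ?v)) ` R 0 m" "Suc m"] by metis
  have sr: "nb (m1, span (X \<union> s), span (span (B \<union> ?v) \<union> r)) \<inter> M = {}" if "B \<in> R 0 m" for B
    using sr that by simp
  let ?w = "span (e ` {m1})"
  let ?r = "span (span (?v \<union> r) \<union> ?w)"
  have w: "?w \<in> R m1 (Suc m1)" by (rule R_e) auto
  have vr: "span (?v \<union> r) \<in> R m m1" using R_Un[OF v m1(3)] m1(1) by simp
  have "e m \<in> ?r" "e (Suc m1 - 1) \<in> ?r" by (auto intro!: span_base)
  moreover have "?r \<in> R m (Suc m1)" using R_Un[OF vr w] m1(1) by simp
  moreover have "s \<in> R m (Suc m1)" using m1(2) R_mono[of m "Suc m" m1 "Suc m1"] by auto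
  moreover have "nb (Suc m1, span (X \<union> s), span (B \<union> ?r)) \<inter> M = {}" if B: "B \<in> R 0 m" for B
  proof -
    have Xs: "span (X \<union> s) \<in> R 0 m1" using R_Un[OF X m1(2)] m1(1) by simp
    have Bvr: "span (span (B \<union> ?v) \<union> r) \<in> R 0 m1" using R_Un[OF Bv[OF B] m1(3)] m1(1) by simp
    have e1: "span (span (X \<union> s) \<union> {0}) = span (X \<union> s)"
      by (metis span_Un_span span_empty span_span sup_bot.right_neutral)
    have e2: "span (span (span (B \<union> ?v) \<union> r) \<union> ?w) = span (B \<union> ?r)"
      by (metis span_Un_assoc)
    show ?thesis
      using nb_ext_subset[OF Xs Bvr R_zero w, unfolded e1 e2] sr[OF B] by auto
  qed
  moreover have "Suc m1 > m" using m1(1) by simp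
  ultimately show ?thesis by blast
qed

text \<open>\<open>F n\<close> forces the \<open>n\<close>-th dense open set for every head in \<open>R 0 (j n)\<close> at once, which is possible because
  this set is finite. It contains the first and the last basis vector of its interval, so that a
  decomposition passing through \<open>F n\<close> splits at \<open>j n\<close> and \<open>j (Suc n)\<close>.\<close>
lemma absorbing_blocks:
  assumes mg: "meager (nb (m0, A0, B0) - iso_pairs K)" and A0: "A0 \<in> R 0 m0" and B0: "B0 \<in> R 0 m0"
  obtains j F x0 where "strict_mono j" "\<And>n. F n \<in> R (j n) (j (Suc n))" "\<And>n. e (j n) \<in> F n"
    "\<And>n. e (j (Suc n) - 1) \<in> F n" "m0 \<le> j 0"
    "\<And>y. subspace y \<Longrightarrow> y \<subseteq> c00 \<Longrightarrow> splits m0 y B0 \<Longrightarrow>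
      (\<And>N. \<exists>n\<ge>N. \<exists>B\<in>R 0 (j n). splits (j n) y B \<and> splits (j (Suc n)) y (span (B \<union> F n))) \<Longrightarrow>
      kiso K (closure x0) (closure y)"
proof -
  obtain M where M: "\<And>n::nat. nwd (M n)" "nb (m0, A0, B0) - iso_pairs K \<subseteq> \<Union> (range M)"
    using mg unfolding meager_def by blast
  define M' where "M' n = (\<Union>k<Suc n. M k)" for n
  have M': "nwd (M' n)" for n unfolding M'_def using nwd_UN_lessThan M(1) by blast
  \<comment> \<open>The premise on \<open>X\<close> is part of \<open>Q\<close>, so that total
    choice functions exist and the recursion can be set up before \<open>X n\<close> is known to be
    an admissible head.\<close>
  define Q where "Q m n X m' s r \<longleftrightarrow> X \<in> R 0 m \<longrightarrow> m < m' \<and> s \<in> R m m' \<and> r \<in> R m m' \<and> e m \<in> r \<and> e (m' - 1) \<in> r \<and>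
    (\<forall>B\<in>R 0 m. nb (m', span (X \<union> s), span (B \<union> r)) \<inter> M' n = {})" for m n X m' s r
  have "\<forall>m n X. \<exists>m' s r. Q m n X m' s r"
    using absorbing_block[OF M'] unfolding Q_def by blast
  then obtain nx \<sigma> \<rho> where "\<And>m n X. Q m n X (nx m n X) (\<sigma> m n X) (\<rho> m n X)"
    by metis
  note nx = this[unfolded Q_def, rule_format]
  define st where "st = rec_nat (m0, A0) (\<lambda>n (m, X). (nx m n X, span (X \<union> \<sigma> m n X)))"
  define j where "j n = fst (st n)" for n
  define X where "X n = snd (st n)" for n
  define F where "F n = \<rho> (j n) n (X n)" for n
  define S where "S n = \<sigma> (j n) n (X n)" for n
  have j: "j 0 = m0" "j (Suc n) = nx (j n) n (X n)" and X: "X 0 = A0" "X (Suc n) = span (X n \<union> S n)" for n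
    by (simp_all add: j_def X_def S_def st_def case_prod_unfold)
  have XR: "X n \<in> R 0 (j n)" for n
  proof (induction n)
    case 0 then show ?case using A0 by (simp add: X j)
  next
    case (Suc n)
    then show ?case using nx[OF Suc, of n] R_Un[OF Suc] by (simp add: X j S_def)
  qed
  have step: "j n < j (Suc n)" "S n \<in> R (j n) (j (Suc n))" "F n \<in> R (j n) (j (Suc n))" "e (j n) \<in> F n"
    "e (j (Suc n) - 1) \<in> F n"
    "\<And>B. B \<in> R 0 (j n) \<Longrightarrow> nb (j (Suc n), X (Suc n), span (B \<union> F n)) \<inter> M' n = {}" for n
    using nx[OF XR[of n], of n] by (simp_all add: j X F_def S_def)
  have sm: "strict_mono j" using step(1) by (simp add: strict_mono_Suc_iff)
  \<comment> \<open>Block 0 is the initial head \<open>A0\<close>, placed on the coordinates below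
    \<open>m0\<close>; hence the shift by one against the intervals of \<open>j\<close>.\<close>
  define G where "G k = (case k of 0 \<Rightarrow> A0 | Suc n \<Rightarrow> S n)" for k
  define i where "i k = (case k of 0 \<Rightarrow> 0 | Suc n \<Rightarrow> j n)" for k
  have "G k \<in> R (i k) (i (Suc k))" for k
    using A0 step(2) by (cases k) (simp_all add: G_def i_def j)
  moreover have "mono i" using less_imp_le[OF step(1)] by (intro incseq_SucI) (simp add: i_def split: nat.split)
  ultimately have bs: "block_seq i G" using R_subspace R_blk unfolding block_seq_def by blast
  have hd: "bhead (Suc n) G = X n" for n
  proof (induction n)
    case 0
    have "bhead (Suc 0) G = span A0" unfolding bhead_Suc by (simp add: G_def)
    then show ?case using R_subspace[OF A0] by (simp add: X span_of_subspace)
  next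
    case (Suc n)
    have "G (Suc n) = S n" by (simp add: G_def)
    then show ?case unfolding bhead_Suc[of "Suc n"] X Suc by simp
  qed
  have x0: "splits (j n) (bsum G) (X n)" for n
    using splits_bsum[OF bs, of "Suc n"] hd by (simp add: i_def)
  show thesis
  proof
    show "strict_mono j" by (rule sm)
    show "F n \<in> R (j n) (j (Suc n))" "e (j n) \<in> F n" "e (j (Suc n) - 1) \<in> F n" for n by (rule step)+
    show "m0 \<le> j 0" by (simp add: j)
    fix y assume y: "subspace y" "y \<subseteq> c00" "splits m0 y B0"
      and inf: "\<And>N. \<exists>n\<ge>N. \<exists>B\<in>R 0 (j n). splits (j n) y B \<and> splits (j (Suc n)) y (span (B \<union> F n))"
    have pts: "(bsum G, y) \<in> pts"
      unfolding pts_def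
    proof (intro CollectI case_prodI conjI allI subspace_bsum bsum_c00[OF bs] y)
      fix N
      obtain n B where "n \<ge> N" "B \<in> R 0 (j n)" "splits (j n) y B" using inf[of N] by blast
      moreover have "N \<le> j n" using \<open>n \<ge> N\<close> strict_mono_imp_increasing[OF sm, of n] by simp
      ultimately show "\<exists>m\<ge>N. \<exists>A\<in>R 0 m. \<exists>B\<in>R 0 m. splits m (bsum G) A \<and> splits m y B"
        using x0 XR by blast
    qed
    have "(bsum G, y) \<notin> M k" for k
    proof
      assume k: "(bsum G, y) \<in> M k"
      obtain n B where n: "n \<ge> k" "B \<in> R 0 (j n)" "splits (j (Suc n)) y (span (B \<union> F n))" using inf[of k] by blast
      have "(bsum G, y) \<in> nb (j (Suc n), X (Suc n), span (B \<union> F n))"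
        using pts x0 n(3) by (simp add: mem_nb)
      moreover have "(bsum G, y) \<in> M' n" unfolding M'_def using k n(1) by (intro UN_I[of k]) auto
      ultimately show False using step(6)[OF n(2)] by blast
    qed
    moreover have "(bsum G, y) \<in> nb (m0, A0, B0)"
      using pts x0[of 0] y(3) by (simp add: mem_nb X j)
    ultimately have "(bsum G, y) \<in> iso_pairs K" using M(2) by blast
    then show "kiso K (closure (bsum G)) (closure y)" by (simp add: iso_pairs_def)
  qed
qed

text \<open>Replacing the part of the decomposition below \<open>m\<close> by \<open>B0\<close>
  makes it meet the condition. Rounding then puts all heads into \<open>R\<close>, keeping
  \<open>B0\<close> and the blocks \<open>F n\<close> beyond \<open>m\<close>, so \<open>abs\<close>
  applies to the rounded space. The factor 2 is the cost of rounding.\<close>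

lemma kiso_through_blocks:
  assumes j: "strict_mono j" and F: "\<And>n. F n \<in> R (j n) (j (Suc n))" "\<And>n. e (j n) \<in> F n" "\<And>n. e (j (Suc n) - 1) \<in> F n"
    and abs: "\<And>y. subspace y \<Longrightarrow> y \<subseteq> c00 \<Longrightarrow> splits m0 y B0 \<Longrightarrow>
      (\<And>N. \<exists>n\<ge>N. \<exists>B\<in>R 0 (j n). splits (j n) y B \<and> splits (j (Suc n)) y (span (B \<union> F n))) \<Longrightarrow>
      kiso K (closure x0) (closure y)"
    and B0: "B0 \<in> R 0 m0" and l: "strict_mono l" "block_seq l D" "\<And>k. l k \<in> Lead (D k)"
    and inf: "infinite {n. \<exists>k. D k = F n}" and m: "m0 \<le> m" and K: "K \<ge> 0"
  shows "kiso (K * 2) (closure x0) (closure (span (B0 \<union> (bsum D \<inter> tail m))))"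
proof -
  define W where "W = bsum D \<inter> tail m"
  define Y where "Y = span (B0 \<union> W)"
  \<comment> \<open>All cut points below \<open>m\<close> collapse to \<open>m\<close>: the first
    interval is left to \<open>B0\<close>, and a block of \<open>D\<close> reaching across
    \<open>m\<close> contributes only its part in \<open>tail m\<close>.\<close>
  define i where "i k = (case k of 0 \<Rightarrow> 0 | Suc k \<Rightarrow> max (l k) m)" for k
  have i: "i 0 = 0" "i (Suc k) = max (l k) m" for k by (simp_all add: i_def)
  have W: "subspace W" "W \<subseteq> tail m" "W \<subseteq> c00"
    using subspace_bsum subspace_tail bsum_c00[OF l(2)] by (auto simp: W_def intro: subspace_inter)
  have B0s: "subspace B0" "B0 \<subseteq> blk 0 m0" "B0 \<subseteq> blk 0 m"
    using R_subspace[OF B0] R_blk[OF B0] blk_mono[of 0 0 m0 m] m by auto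
  have Yd: "x \<in> Y \<longleftrightarrow> (\<exists>h\<in>B0. \<exists>w\<in>W. x = h + w)" for x
    unfolding Y_def by (rule mem_span_Un[OF B0s(1) W(1)])
  have PW: "P (i (Suc k)) w \<in> W" if "w \<in> W" for k w
  proof -
    have w: "w \<in> bsum D" "P m w = 0" using that by (auto simp: W_def tail_def)
    have "P (l k) w \<in> bsum D" using bsum_splits[OF l(2)] w(1) by blast
    moreover have "P m (P (l k) w) = 0" using w(2) by (metis P_0 P_P min.commute)
    ultimately have "P (l k) w \<in> W" by (simp add: W_def tail_def)
    moreover have "P m w \<in> W" using w(2) subspace_0[OF W(1)] by simp
    ultimately show ?thesis by (simp add: i max_def)
  qed
  have PB: "P (i (Suc k)) h = h" if "h \<in> B0" for h k
    using that B0s(3) c00_P[of m h "i (Suc k)"] mem_blk_0 by (auto simp: i)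
  have "i k \<le> i (Suc k)" for k
    using max.mono[OF monoD[OF strict_mono_mono[OF l(1)]] order_refl] by (cases k) (simp_all add: i)
  then have mono: "mono i" by (rule incseq_SucI)
  have unb: "\<exists>k. n \<le> i k" for n
    using strict_mono_imp_increasing[OF l(1), of n] by (intro exI[of _ "Suc n"]) (simp add: i)
  have spl: "P (i k) ` Y \<subseteq> Y" for k
  proof (cases k)
    case 0 then show ?thesis using subspace_0[of Y] by (auto simp: i Y_def)
  next
    case (Suc k')
    show ?thesis
    proof
      fix z assume "z \<in> P (i k) ` Y"
      then obtain x where x: "x \<in> Y" "z = P (i k) x" by blast
      then obtain h w where hw: "h \<in> B0" "w \<in> W" "z = P (i k) (h + w)"
        using Yd[THEN iffD1, OF x(1)] by blast
      have "z = h + P (i k) w" using PB[OF hw(1), of k'] hw(3) by (simp add: Suc P_add)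
      moreover have "P (i k) w \<in> W" using PW[OF hw(2), of k'] by (simp add: Suc)
      ultimately show "z \<in> Y" unfolding Yd using hw(1) by (intro bexI[of _ h] bexI[of _ "P (i k) w"]) simp_all
    qed
  qed
  have "B0 \<union> W \<subseteq> c00" using W(3) B0s(3) blk_subset_c00 by blast
  then have Y: "subspace Y" "Y \<subseteq> c00"
    unfolding Y_def by (simp_all add: span_minimal subspace_c00)
  obtain G where G: "\<And>k. G k \<in> R (i k) (i (Suc k))" "block_seq i G"
    "\<And>k. Y \<inter> blk (i k) (i (Suc k)) \<in> R (i k) (i (Suc k)) \<Longrightarrow> G k = Y \<inter> blk (i k) (i (Suc k))"
    "kiso 2 (closure Y) (closure (bsum G))"
    using rounding[OF Y mono i(1) unb spl] by metis
  have "Y \<inter> blk (i 0) (i (Suc 0)) = B0"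
  proof
    show "B0 \<subseteq> Y \<inter> blk (i 0) (i (Suc 0))"
      using B0s(3) blk_mono[of 0 0 m "i (Suc 0)"] by (auto simp: i Y_def intro: span_base)
    show "Y \<inter> blk (i 0) (i (Suc 0)) \<subseteq> B0"
    proof
      fix x assume x: "x \<in> Y \<inter> blk (i 0) (i (Suc 0))"
      then obtain h w where hw: "h \<in> B0" "w \<in> W" "x = h + w" using Yd[of x] by blast
      have "P (i (Suc 0)) w = w" using x hw PB[OF hw(1), of 0] by (simp add: blk_def P_add)
      moreover have "P (i (Suc 0)) w = 0"
      proof -
        have "P m w = 0" using hw(2) W(2) by (auto simp: tail_def)
        moreover have "bsum D \<subseteq> tail (l 0)"
          using splits_bsum[OF l(2), of 0] by (auto simp: splits_def tail_def)
        then have "P (l 0) w = 0" using hw(2) by (auto simp: W_def tail_def)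
        ultimately show ?thesis by (simp add: i max_def)
      qed
      ultimately show "x \<in> B0" using hw by simp
    qed
  qed
  moreover have "B0 \<in> R (i 0) (i (Suc 0))" using B0 R_mono[of 0 0 m0 "i (Suc 0)"] m by (force simp: i)
  ultimately have G0: "G 0 = B0" using G(3)[of 0] by simp
  have bh1: "bhead (Suc 0) G = B0"
    unfolding bhead_Suc using span_of_subspace[OF B0s(1)] by (simp add: G0)
  have "m0 \<le> i (Suc 0)" using m by (simp add: i)
  from splits_trans[OF splits_bsum[OF G(2), of "Suc 0", unfolded bh1] splits_refl[OF B0s(2)] this]
  have "splits m0 (bsum G) B0" .
  moreover have "\<exists>n\<ge>N. \<exists>B\<in>R 0 (j n). splits (j n) (bsum G) B \<and> splits (j (Suc n)) (bsum G) (span (B \<union> F n))" for N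
  proof -
    obtain n where n: "n \<ge> max N m" "\<exists>k. D k = F n"
      using inf unfolding infinite_nat_iff_unbounded_le by blast
    then obtain k where k: "D k = F n" by blast
    have Fb: "F n \<subseteq> blk (j n) (j (Suc n))" by (rule R_blk[OF F(1)])
    have Db: "D k \<subseteq> blk (l k) (l (Suc k))" by (rule block_seqD(3)[OF l(2)])
    have "e (j n) \<in> blk (l k) (l (Suc k))" "e (j (Suc n) - 1) \<in> blk (l k) (l (Suc k))"
      using F(2,3)[of n] Db k by auto
    \<comment> \<open>The first and last basis vectors in \<open>F n\<close> force the interval of
      \<open>D k\<close> to cover that of \<open>F n\<close>. Conversely \<open>l k\<close> leads in
      \<open>D k = F n\<close>, so the left ends agree.\<close>
    then have "l k \<le> j n" "j (Suc n) - 1 < l (Suc k)" by (auto simp: mem_blk)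
    moreover have "j n \<le> l k"
      using l(3)[of k] k Lead_subset_blk[OF Fb] by auto
    moreover have "j n < j (Suc n)" using j by (simp add: strict_mono_Suc_iff)
    ultimately have jl: "l k = j n" "j (Suc n) \<le> l (Suc k)" by auto
    have mj: "m \<le> j n" using n(1) strict_mono_imp_increasing[OF j, of n] by simp
    then have ik: "i (Suc k) = j n" "i (Suc (Suc k)) = l (Suc k)"
      using jl \<open>j n < j (Suc n)\<close> by (auto simp: i max_def)
    have "Y \<inter> blk (i (Suc k)) (i (Suc (Suc k))) = F n"
    proof
      show "F n \<subseteq> Y \<inter> blk (i (Suc k)) (i (Suc (Suc k)))"
      proof
        fix x assume x: "x \<in> F n"
        then have xb: "x \<in> blk (j n) (l (Suc k))" using Db k jl by auto
        have "x \<in> bsum D" using x k unfolding bsum_def by (intro span_base) blast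
        moreover have "x \<in> tail m" using xb blk_subset_tail tail_antimono[OF mj] by blast
        ultimately have "x \<in> W" by (simp add: W_def)
        then show "x \<in> Y \<inter> blk (i (Suc k)) (i (Suc (Suc k)))"
          using xb ik by (auto simp: Y_def intro: span_base)
      qed
      show "Y \<inter> blk (i (Suc k)) (i (Suc (Suc k))) \<subseteq> F n"
      proof
        fix x assume x: "x \<in> Y \<inter> blk (i (Suc k)) (i (Suc (Suc k)))"
        then obtain h w where hw: "h \<in> B0" "w \<in> W" "x = h + w" using Yd[of x] by blast
        have "x \<in> tail m"
          using x blk_subset_tail[of "j n" "l (Suc k)"] tail_antimono[OF mj] unfolding ik by blast
        then have "h = 0" using P_span_Un[OF B0s(3) W(2) hw(1,2)] hw(3) by (simp add: tail_def)
        then have "x \<in> bsum D \<inter> blk (l k) (l (Suc k))" using x hw ik jl by (simp add: W_def)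
        then show "x \<in> F n" using bsum_blk[OF l(2)] k by simp
      qed
    qed
    moreover have "F n \<in> R (i (Suc k)) (i (Suc (Suc k)))"
      using F(1)[of n] R_mono[of "j n" "j n" "j (Suc n)" "l (Suc k)"] ik jl by auto
    ultimately have Gk: "G (Suc k) = F n" using G(3)[of "Suc k"] by simp
    let ?B = "bhead (Suc k) G"
    have BR: "?B \<in> R 0 (j n)" using bhead_R[OF G(2,1), of "Suc k"] ik by simp
    have s1: "splits (j n) (bsum G) ?B" using splits_bsum[OF G(2), of "Suc k"] ik by simp
    have s2: "splits (l (Suc k)) (bsum G) (span (?B \<union> F n))"
      using splits_bsum[OF G(2), of "Suc (Suc k)"] unfolding bhead_Suc[of "Suc k"] Gk ik .
    \<comment> \<open>The interval of \<open>D k\<close> may extend beyond \<open>j (Suc n)\<close>,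
      but only by a gap; hence the splitting point can be lowered to
      \<open>j (Suc n)\<close>.\<close>
    have "span (?B \<union> F n) \<in> R 0 (j (Suc n))"
      using R_Un[OF BR F(1)] \<open>j n < j (Suc n)\<close> by simp
    then have "splits (j (Suc n)) (bsum G) (span (?B \<union> F n))"
      using splits_trans[OF s2 splits_refl jl(2)] R_blk by blast
    then show ?thesis using n(1) BR s1 by (intro exI[of _ n]) auto
  qed
  ultimately have "kiso K (closure x0) (closure (bsum G))"
    by (intro abs subspace_bsum bsum_c00[OF G(2)])
  from kiso_trans[OF this kiso_sym[OF G(4)] K]
  show ?thesis by (simp add: Y_def W_def)
qed

text \<open>\<open>S\<close> and \<open>span (B0 \<union> (S \<inter> tail m))\<close> differ by finite-dimensional pieces of different dimensions.
  The discrepancy is absorbed by comparing two values of \<open>m\<close>; the number of dimensions involved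
  is at most \<open>m0\<close>, so the constant does not depend on \<open>S\<close>.\<close>
lemma kiso_finite_codim:
  assumes S: "subspace S" "infinite (Lead S)" and B0: "subspace B0" "B0 \<subseteq> blk 0 m0" and L: "L \<ge> 0"
    and iso: "\<And>m. m0 \<le> m \<Longrightarrow> kiso L (closure x0) (closure (span (B0 \<union> (S \<inter> tail m))))"
  shows "kiso (L * ext_const (ext_const 1 m0 * (L * L)) m0) (closure x0) (closure S)"
proof -
  define Y where "Y m = closure (span (B0 \<union> (S \<inter> tail m)))" for m
  define b where "b = card (Lead B0)"
  define a where "a = card (Lead S \<inter> {0..<m0})"
  \<comment> \<open>Below \<open>m0\<close>, \<open>S\<close> may have more or fewer leading
    coordinates than \<open>B0\<close>. The point \<open>m1\<close> is chosen so that
    \<open>S\<close> has \<open>max a b = b + c\<close> of them below it, and \<open>m2\<close> so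
    that \<open>c\<close> more lie between.\<close>
  define c where "c = max a b - b"
  have "b \<le> m0" using card_mono[OF _ Lead_subset_blk[OF B0(2)]] by (simp add: b_def)
  moreover have "a \<le> m0" using card_mono[of "{0..<m0}" "Lead S \<inter> {0..<m0}"] by (simp add: a_def)
  ultimately have bc: "b \<le> m0" "c \<le> m0" by (auto simp: c_def)
  obtain m1 where m1: "m1 \<ge> m0" "card (Lead S \<inter> {m0..<m1}) = max a b - a"
    using card_Int_atLeastLessThan_attains[OF S(2)] by blast
  obtain m2 where m2: "m2 \<ge> m1" "card (Lead S \<inter> {m1..<m2}) = c"
    using card_Int_atLeastLessThan_attains[OF S(2)] by blast
  have "Lead S \<inter> {0..<m1} = (Lead S \<inter> {0..<m0}) \<union> (Lead S \<inter> {m0..<m1})" using m1(1) by auto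
  then have "card (Lead S \<inter> {0..<m1}) = a + (max a b - a)"
    using m1(2) by (simp add: card_Un_disjoint disjoint_iff a_def)
  then have card: "card (Lead S \<inter> {0..<m1}) = b + c" by (simp add: c_def)
  have e: "span ({0} \<union> (S \<inter> tail m)) = S \<inter> tail m" for m
    using span_of_subspace[OF subspace_inter[OF S(1) subspace_tail]] subspace_0[OF S(1)]
    by (metis Un_insert_left Un_empty_left span_insert_0)
  have e0: "S \<inter> tail 0 = S" by (auto simp: tail_def)
  have e1: "span ({0} \<union> S) = S" using e[of 0] by (simp only: e0)
  have "{0} \<subseteq> blk 0 0" by (simp add: mem_blk)
  from codim_Lead[OF S(1) subspace_single_0 this le0, of m1]
  have "codim (b + c) (closure (S \<inter> tail m1)) (closure S)"
    unfolding e e0 e1 card .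
  \<comment> \<open>\<open>Z\<close> lies \<open>b\<close> dimensions above
    \<open>closure (S \<inter> tail m1)\<close>, just as \<open>Y m1\<close> does, so the two are
    comparable; \<open>iso\<close> then compares \<open>Z\<close> with \<open>Y m2\<close> as
    well.\<close>
  then obtain Z where Z: "codim b (closure (S \<inter> tail m1)) Z" "codim c Z (closure S)"
    using codim_split by blast
  have W: "subspace (S \<inter> tail m1)" using S(1) subspace_tail by (intro subspace_inter)
  have cW: "subspace (closure (S \<inter> tail m1))" using subspace_closure[OF W] .
  have Zc: "subspace Z" "closed Z" using codim_closed[OF Z(1) cW] by auto
  have Yc: "subspace (Y m)" "closed (Y m)" for m
    by (simp_all add: Y_def subspace_closure)
  have "B0 \<subseteq> blk 0 m1" using B0(2) blk_mono[of 0 0 m0 m1] m1(1) by auto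
  then have "codim b (closure (S \<inter> tail m1)) (Y m1)"
    unfolding b_def Y_def using codim_head[OF B0(1) W] by blast
  then have "kiso (ext_const 1 b) Z (Y m1)"
    using kiso_codim[OF Z(1) _ kiso_refl[OF cW order_refl]] cW by simp
  then have ZY: "kiso (ext_const 1 m0) Z (Y m1)"
    by (rule kiso_mono) (use ext_const_mono bc in simp)
  have LL: "kiso (L * L) (Y m1) (Y m2)"
    using kiso_trans[OF kiso_sym[OF iso[OF m1(1)]] iso[of m2] L L] m1(1) m2(1) by (simp add: Y_def)
  have nn: "0 \<le> ext_const 1 m0" by (rule ext_const_nonneg) simp
  have ZY2: "kiso (ext_const 1 m0 * (L * L)) Z (Y m2)"
    using kiso_trans[OF ZY LL nn] L by simp
  have nn2: "0 \<le> ext_const 1 m0 * (L * L)" using nn by simp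
  \<comment> \<open>Now \<open>closure S\<close> over \<open>Z\<close> and \<open>Y m1\<close> over
    \<open>Y m2\<close> are extensions of equal length \<open>c\<close> of comparable
    spaces.\<close>
  have "codim c (Y m2) (Y m1)"
    unfolding Y_def m2(2)[symmetric] using codim_Lead[OF S(1) B0(1) \<open>B0 \<subseteq> blk 0 m1\<close> m2(1)] .
  then have "kiso (ext_const (ext_const 1 m0 * (L * L)) c) (closure S) (Y m1)"
    using kiso_codim[OF Z(2) _ ZY2 nn2 Zc Yc] by blast
  then have "kiso (ext_const (ext_const 1 m0 * (L * L)) m0) (closure S) (Y m1)"
    by (rule kiso_mono) (use ext_const_mono[OF nn2] bc in simp)
  from kiso_trans[OF iso[OF m1(1)] kiso_sym[OF this[unfolded Y_def]] L ext_const_nonneg[OF nn2]]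
  show ?thesis .
qed

lemma homogeneous_of_not_meager:
  assumes "\<not> meager (\<Union>k::nat. iso_pairs (real k))"
  shows "\<exists>K\<ge>1. \<exists>F. successive_blocks e F \<and>
       (\<forall>D E. successive_blocks e D \<and> infinite {n. passes_through D (F n)} \<and>
              successive_blocks e E \<and> infinite {n. passes_through E (F n)} \<longrightarrow>
              K_isomorphic K (decomp_space D) (decomp_space E))"
proof -
  obtain k :: nat where "\<not> meager (iso_pairs (real k))" using assms meager_UN_nat[of "\<lambda>k. iso_pairs (real k)"] by blast
  then obtain p where p: "p \<in> Cond" "meager (nb p - iso_pairs (real k))"
    using iso_pairs_comeager_below by blast
  obtain m0 A0 B0 where p': "p = (m0, A0, B0)" "A0 \<in> R 0 m0" "B0 \<in> R 0 m0"
    using p(1) by (cases p) (auto simp: Cond_def)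
  obtain j F x0 where j: "strict_mono j" and F: "\<And>n. F n \<in> R (j n) (j (Suc n))" "\<And>n. e (j n) \<in> F n"
    "\<And>n. e (j (Suc n) - 1) \<in> F n"
    and abs: "\<And>y. subspace y \<Longrightarrow> y \<subseteq> c00 \<Longrightarrow> splits m0 y B0 \<Longrightarrow>
      (\<And>N. \<exists>n\<ge>N. \<exists>B\<in>R 0 (j n). splits (j n) y B \<and> splits (j (Suc n)) y (span (B \<union> F n))) \<Longrightarrow>
      kiso (real k) (closure x0) (closure y)"
    using absorbing_blocks[OF p(2)[unfolded p'(1)] p'(2,3)] by metis
  define L where "L = real k * 2"
  define L' where "L' = L * ext_const (ext_const 1 m0 * (L * L)) m0"
  have L: "L \<ge> 0" "L' \<ge> 0"
    by (auto simp: L_def L'_def intro!: mult_nonneg_nonneg ext_const_nonneg)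
  have main: "kiso L' (closure x0) (decomp_space D)"
    if D: "successive_blocks e D" "infinite {n. passes_through D (F n)}" for D
  proof -
    obtain l where l: "strict_mono l" "block_seq l D" "\<And>k. l k \<in> Lead (D k)"
      using successive_blocks_block_seq[OF D(1)] by metis
    have inf: "infinite {n. \<exists>k. D k = F n}" using D(2) by (simp add: passes_through_def)
    have "range l \<subseteq> Lead (bsum D)"
      using l(3) by (fastforce simp: Lead_def bsum_def intro: span_base)
    then have "infinite (Lead (bsum D))"
      using l(1) strict_mono_imp_inj_on range_inj_infinite infinite_super by metis
    moreover have "kiso L (closure x0) (closure (span (B0 \<union> (bsum D \<inter> tail m))))" if "m0 \<le> m" for m
      unfolding L_def
    proof (rule kiso_through_blocks[OF j F _ p'(3) l inf that])
      show "kiso (real k) (closure x0) (closure y)"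
        if "subspace y" "y \<subseteq> c00" "splits m0 y B0"
          "\<And>N. \<exists>n\<ge>N. \<exists>B\<in>R 0 (j n). splits (j n) y B \<and> splits (j (Suc n)) y (span (B \<union> F n))" for y
        by (rule abs[OF that])
    qed simp
    ultimately show ?thesis
      unfolding L'_def decomp_space_def bsum_def[symmetric]
      using kiso_finite_codim[OF subspace_bsum _ R_subspace[OF p'(3)] R_blk[OF p'(3)] L(1)] by blast
  qed
  \<comment> \<open>One factor \<open>L' * L'\<close> leads from \<open>D\<close> to
    \<open>E\<close> through \<open>x0\<close>. It is squared because \<open>K_isomorphic\<close>
    bounds the product of the norms of the operator and its inverse.\<close>
  define K where "K = max 1 ((L' * L') * (L' * L'))"
  have "K_isomorphic K (decomp_space D) (decomp_space E)"
    if "successive_blocks e D" "infinite {n. passes_through D (F n)}"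
      "successive_blocks e E" "infinite {n. passes_through E (F n)}" for D E
  proof -
    have "kiso (L' * L') (decomp_space D) (decomp_space E)"
      using kiso_trans[OF kiso_sym[OF main[OF that(1,2)]] main[OF that(3,4)] L(2) L(2)] .
    from kiso_imp_K_isomorphic[OF this] L(2) show ?thesis
      unfolding K_isomorphic_def K_def by (meson max.coboundedI2 mult_nonneg_nonneg)
  qed
  moreover have "successive_blocks e F" using successive_blocks_R[OF j F(1,2)] .
  moreover have "K \<ge> 1" by (simp add: K_def)
  ultimately show ?thesis by blast
qed

end

theorem theorem21:
  fixes e :: "nat \<Rightarrow> 'a::banach"
  assumes "schauder_basis e"
  shows "ergodic TYPE('a) \<or>
    (\<exists>K::real. K \<ge> 1 \<and> (\<exists>F. successive_blocks e F \<and>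
       (\<forall>D E. successive_blocks e D \<and> infinite {n. passes_through D (F n)} \<and>
              successive_blocks e E \<and> infinite {n. passes_through E (F n)} \<longrightarrow>
              K_isomorphic K (decomp_space D) (decomp_space E))))"
proof -
  interpret basis e by unfold_locales (rule assms)
  show ?thesis using ergodic_of_meager homogeneous_of_not_meager by blast
qed

end
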